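(* Let $(S,\leq)$ be a partial order having at least one element $a$ that is not the least of $S$, and that is "stable", in the sense that $\neg\neg(a\leq x)$ implies $a\leq x$, for all $x\in S$. Then the relation $R_c(x,U)$, for $x\in S$ and $U\subseteq S$, defined by $$R_c(x,U)\iff(\forall y\in S)\bigl([(\forall u\in U)\,u\leq y]\to x\leq y\bigr)\iff x\in\bigcap_{U\subseteq\downarrow y}\downarrow y,$$ cannot be proved to be set-presented in $\mathrm{CZF}^*$, $\mathrm{CTT}^*$.
   Context: Systems. CZF is Aczel's constructive set theory; CTT is Martin-Löf's constructive type theory. $\mathrm{CZF}^*$ denotes an arbitrary fixed extension of CZF consistent with the scheme GUP-CZF: for every set $I$, $(\forall x)(\exists y\in I)A(x,y)\to(\exists y\in I)(\forall x)A(x,y)$ ($x$ ranging over all sets). $\mathrm{CTT}^*$ denotes an arbitrary fixed extension of CTT consistent with GUP-CTT: for every set $I$, every $R$ mapping a proposition and an element of $I$ to a proposition, and every $F$ from propositions to $I$ with $R(P,F(P))$ for all $P$, there is $\bar i\in I$ with $R(P,\bar i)$ for all $P$. $\downarrow y\equiv\{x\in S:x\leq y\}$. "$a$ is not the least of $S$" means $\neg(\forall y\in S)\,a\leq y$. A relation $R(x,U)$ between elements and subsets of a set $S$ is set-presented if there are families of sets $I(x)$, for $x\in S$, and $C(x,i)\subseteq S$, for $x\in S$, $i\in I(x)$, such that $R(x,U)\iff(\exists i\in I(x))\,C(x,i)\subseteq U$ for all $x\in S$, $U\subseteq S$. "Cannot be proved in $T$" is a metamathematical statement: for no $(S,\leq)$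 (given by a definition in $T$) satisfying the hypotheses in $T$ does $T$ prove that $R_c$ is set-presented. *)

theory Defs
  imports Main
begin

section \<open>Constructive set theory\<close>

subsection \<open>Intuitionistic first-order logic with equality in the language of set theory\<close>

text \<open>De Bruijn indices. The only terms are variables, so substitution is renaming.\<close>

datatype fm =
    Fls
  | Mem nat nat
  | Eq nat nat
  | Conj fm fm
  | Disj fm fm
  | Imp fm fm
  | FAll fm
  | FEx fm

primrec fv :: "fm \<Rightarrow> nat set" where
  "fv Fls = {}"
| "fv (Mem i j) = {i, j}"
| "fv (Eq i j) = {i, j}"
| "fv (Conj p q) = fv p \<union> fv q"
| "fv (Disj p q) = fv p \<union> fv q"
| "fv (Imp p q) = fv p \<union> fv q"
| "fv (FAll p) = {n. Suc n \<in> fv p}"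
| "fv (FEx p) = {n. Suc n \<in> fv p}"

abbreviation sentence :: "fm \<Rightarrow> bool" where
  "sentence p \<equiv> fv p = {}"

definition up :: "(nat \<Rightarrow> nat) \<Rightarrow> nat \<Rightarrow> nat" where
  "up r = case_nat 0 (\<lambda>n. Suc (r n))"

primrec ren :: "(nat \<Rightarrow> nat) \<Rightarrow> fm \<Rightarrow> fm" where
  "ren r Fls = Fls"
| "ren r (Mem i j) = Mem (r i) (r j)"
| "ren r (Eq i j) = Eq (r i) (r j)"
| "ren r (Conj p q) = Conj (ren r p) (ren r q)"
| "ren r (Disj p q) = Disj (ren r p) (ren r q)"
| "ren r (Imp p q) = Imp (ren r p) (ren r q)"
| "ren r (FAll p) = FAll (ren (up r) p)"
| "ren r (FEx p) = FEx (ren (up r) p)"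

definition inst :: "nat \<Rightarrow> fm \<Rightarrow> fm" where
  "inst i p = ren (case_nat i id) p"

text \<open>Natural deduction. In \<open>AllI\<close> and \<open>ExE\<close> shifting the hypotheses makes index 0 the eigenvariable.\<close>

inductive proves :: "fm set \<Rightarrow> fm \<Rightarrow> bool" (infix "\<turnstile>" 25) where
  Hyp: "p \<in> H \<Longrightarrow> H \<turnstile> p"
| FlsE: "H \<turnstile> Fls \<Longrightarrow> H \<turnstile> p"
| ConjI: "H \<turnstile> p \<Longrightarrow> H \<turnstile> q \<Longrightarrow> H \<turnstile> Conj p q"
| ConjE1: "H \<turnstile> Conj p q \<Longrightarrow> H \<turnstile> p"
| ConjE2: "H \<turnstile> Conj p q \<Longrightarrow> H \<turnstile> q"
| DisjI1: "H \<turnstile> p \<Longrightarrow> H \<turnstile> Disj p q"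
| DisjI2: "H \<turnstile> q \<Longrightarrow> H \<turnstile> Disj p q"
| DisjE: "H \<turnstile> Disj p q \<Longrightarrow> insert p H \<turnstile> r \<Longrightarrow> insert q H \<turnstile> r \<Longrightarrow> H \<turnstile> r"
| ImpI: "insert p H \<turnstile> q \<Longrightarrow> H \<turnstile> Imp p q"
| ImpE: "H \<turnstile> Imp p q \<Longrightarrow> H \<turnstile> p \<Longrightarrow> H \<turnstile> q"
| AllI: "ren Suc ` H \<turnstile> p \<Longrightarrow> H \<turnstile> FAll p"
| AllE: "H \<turnstile> FAll p \<Longrightarrow> H \<turnstile> inst i p"
| ExI: "H \<turnstile> inst i p \<Longrightarrow> H \<turnstile> FEx p"
| ExE: "H \<turnstile> FEx p \<Longrightarrow> insert p (ren Suc ` H) \<turnstile> ren Suc r \<Longrightarrow> H \<turnstile> r"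
| EqRefl: "H \<turnstile> Eq i i"
| EqSubst: "H \<turnstile> Eq i j \<Longrightarrow> H \<turnstile> inst i p \<Longrightarrow> H \<turnstile> inst j p"

subsection \<open>Formulas with named bound variables\<close>

text \<open>
  A \<open>form\<close> is a formula awaiting the number \<open>d\<close> of quantifiers it stands under, and a \<open>var\<close>
  is an index awaiting that number: the variable bound at depth \<open>d\<close> has, at depth \<open>d'\<close>,
  index \<open>d' - Suc d\<close>. So \<open>P 0\<close> is the ordinary formula that \<open>P\<close> denotes; for instance
  \<open>(\<^bold>\<forall>x. \<^bold>\<exists>y. x \<^bold>\<in> y) 0 = FAll (FEx (Mem 1 0))\<close>.
\<close>

type_synonym var = "nat \<Rightarrow> nat"
type_synonym form = "nat \<Rightarrow> fm"

definition f_bot :: form ("\<^bold>\<bottom>") where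
  "\<^bold>\<bottom> = (\<lambda>d. Fls)"

definition f_mem :: "var \<Rightarrow> var \<Rightarrow> form" (infix "\<^bold>\<in>" 50) where
  "(x \<^bold>\<in> y) = (\<lambda>d. Mem (x d) (y d))"

definition f_eq :: "var \<Rightarrow> var \<Rightarrow> form" (infix "\<^bold>=" 50) where
  "(x \<^bold>= y) = (\<lambda>d. Eq (x d) (y d))"

definition f_and :: "form \<Rightarrow> form \<Rightarrow> form" (infixr "\<^bold>\<and>" 35) where
  "(P \<^bold>\<and> Q) = (\<lambda>d. Conj (P d) (Q d))"

definition f_or :: "form \<Rightarrow> form \<Rightarrow> form" (infixr "\<^bold>\<or>" 30) where
  "(P \<^bold>\<or> Q) = (\<lambda>d. Disj (P d) (Q d))"

definition f_imp :: "form \<Rightarrow> form \<Rightarrow> form" (infixr "\<^bold>\<longrightarrow>" 25) where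
  "(P \<^bold>\<longrightarrow> Q) = (\<lambda>d. Imp (P d) (Q d))"

definition f_all :: "(var \<Rightarrow> form) \<Rightarrow> form" (binder "\<^bold>\<forall>" 10) where
  "f_all P = (\<lambda>d. FAll (P (\<lambda>d'. d' - Suc d) (Suc d)))"

definition f_ex :: "(var \<Rightarrow> form) \<Rightarrow> form" (binder "\<^bold>\<exists>" 10) where
  "f_ex P = (\<lambda>d. FEx (P (\<lambda>d'. d' - Suc d) (Suc d)))"

definition f_not :: "form \<Rightarrow> form" ("\<^bold>\<not> _" [40] 40) where
  "(\<^bold>\<not> P) = (P \<^bold>\<longrightarrow> \<^bold>\<bottom>)"

definition f_iff :: "form \<Rightarrow> form \<Rightarrow> form" (infixr "\<^bold>\<longleftrightarrow>" 25) where
  "(P \<^bold>\<longleftrightarrow> Q) = ((P \<^bold>\<longrightarrow> Q) \<^bold>\<and> (Q \<^bold>\<longrightarrow> P))"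

definition f_ex1 :: "(var \<Rightarrow> form) \<Rightarrow> form" (binder "\<^bold>\<exists>!" 10) where
  "f_ex1 P = (\<^bold>\<exists>x. \<^bold>\<forall>y. P y \<^bold>\<longleftrightarrow> y \<^bold>= x)"

text \<open>
  \<open>at_vars p [x\<^sub>0, \<dots>, x\<^sub>k]\<close> is \<open>p\<close> with its free variables \<open>0, \<dots>, k\<close> replaced by \<open>x\<^sub>0, \<dots>, x\<^sub>k\<close>. Its other
  free variables are parameters, numbered from 0 in the result.
\<close>

definition at_vars :: "fm \<Rightarrow> var list \<Rightarrow> form" where
  "at_vars p xs = (\<lambda>d. ren (\<lambda>n. if n < length xs then (xs ! n) d else n - length xs + d) p)"

text \<open>The universal closures of a formula: any number of quantifiers that binds all its parameters.\<close>

definition closures :: "form \<Rightarrow> fm set" where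
  "closures P = {q. \<exists>n. q = (FAll ^^ n) (P 0) \<and> sentence q}"

subsection \<open>CZF\<close>

inductive bounded_fm :: "fm \<Rightarrow> bool" where
  "bounded_fm Fls"
| "bounded_fm (Mem i j)"
| "bounded_fm (Eq i j)"
| "bounded_fm p \<Longrightarrow> bounded_fm q \<Longrightarrow> bounded_fm (Conj p q)"
| "bounded_fm p \<Longrightarrow> bounded_fm q \<Longrightarrow> bounded_fm (Disj p q)"
| "bounded_fm p \<Longrightarrow> bounded_fm q \<Longrightarrow> bounded_fm (Imp p q)"
| "bounded_fm p \<Longrightarrow> bounded_fm (FAll (Imp (Mem 0 (Suc i)) p))"
| "bounded_fm p \<Longrightarrow> bounded_fm (FEx (Conj (Mem 0 (Suc i)) p))"

definition ax_extensionality :: form where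
  "ax_extensionality = (\<^bold>\<forall>a. \<^bold>\<forall>b. (\<^bold>\<forall>x. x \<^bold>\<in> a \<^bold>\<longleftrightarrow> x \<^bold>\<in> b) \<^bold>\<longrightarrow> a \<^bold>= b)"

definition ax_pairing :: form where
  "ax_pairing = (\<^bold>\<forall>a. \<^bold>\<forall>b. \<^bold>\<exists>c. \<^bold>\<forall>x. x \<^bold>\<in> c \<^bold>\<longleftrightarrow> x \<^bold>= a \<^bold>\<or> x \<^bold>= b)"

definition ax_union :: form where
  "ax_union = (\<^bold>\<forall>a. \<^bold>\<exists>b. \<^bold>\<forall>x. x \<^bold>\<in> b \<^bold>\<longleftrightarrow> (\<^bold>\<exists>y. y \<^bold>\<in> a \<^bold>\<and> x \<^bold>\<in> y))"

definition ax_infinity :: form where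
  "ax_infinity = (\<^bold>\<exists>a. \<^bold>\<forall>x. x \<^bold>\<in> a \<^bold>\<longleftrightarrow>
     (\<^bold>\<forall>z. \<^bold>\<not> z \<^bold>\<in> x) \<^bold>\<or> (\<^bold>\<exists>y. y \<^bold>\<in> a \<^bold>\<and> (\<^bold>\<forall>z. z \<^bold>\<in> x \<^bold>\<longleftrightarrow> z \<^bold>\<in> y \<^bold>\<or> z \<^bold>= y)))"

definition ax_set_induction :: "fm \<Rightarrow> form" where
  "ax_set_induction p =
     ((\<^bold>\<forall>a. (\<^bold>\<forall>x. x \<^bold>\<in> a \<^bold>\<longrightarrow> at_vars p [x]) \<^bold>\<longrightarrow> at_vars p [a]) \<^bold>\<longrightarrow> (\<^bold>\<forall>a. at_vars p [a]))"

definition ax_separation :: "fm \<Rightarrow> form" where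
  "ax_separation p = (\<^bold>\<forall>a. \<^bold>\<exists>b. \<^bold>\<forall>x. x \<^bold>\<in> b \<^bold>\<longleftrightarrow> x \<^bold>\<in> a \<^bold>\<and> at_vars p [x])"

definition multi_image :: "var \<Rightarrow> var \<Rightarrow> (var \<Rightarrow> var \<Rightarrow> form) \<Rightarrow> form" where
  "multi_image a b P =
     ((\<^bold>\<forall>x. x \<^bold>\<in> a \<^bold>\<longrightarrow> (\<^bold>\<exists>y. y \<^bold>\<in> b \<^bold>\<and> P x y)) \<^bold>\<and> (\<^bold>\<forall>y. y \<^bold>\<in> b \<^bold>\<longrightarrow> (\<^bold>\<exists>x. x \<^bold>\<in> a \<^bold>\<and> P x y)))"

definition ax_strong_collection :: "fm \<Rightarrow> form" where
  "ax_strong_collection p = (\<^bold>\<forall>a. (\<^bold>\<forall>x. x \<^bold>\<in> a \<^bold>\<longrightarrow> (\<^bold>\<exists>y. at_vars p [x, y])) \<^bold>\<longrightarrow>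
     (\<^bold>\<exists>b. multi_image a b (\<lambda>x y. at_vars p [x, y])))"

definition ax_subset_collection :: "fm \<Rightarrow> form" where
  "ax_subset_collection p = (\<^bold>\<forall>a. \<^bold>\<forall>b. \<^bold>\<exists>c. \<^bold>\<forall>u. (\<^bold>\<forall>x. x \<^bold>\<in> a \<^bold>\<longrightarrow> (\<^bold>\<exists>y. y \<^bold>\<in> b \<^bold>\<and> at_vars p [x, y, u])) \<^bold>\<longrightarrow>
     (\<^bold>\<exists>d. d \<^bold>\<in> c \<^bold>\<and> multi_image a d (\<lambda>x y. at_vars p [x, y, u])))"

definition CZF :: "fm set" where
  "CZF =
     closures ax_extensionality \<union> closures ax_pairing \<union> closures ax_union \<union> closures ax_infinity \<union>
     (\<Union>p. closures (ax_set_induction p)) \<union>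
     (\<Union>p \<in> Collect bounded_fm. closures (ax_separation p)) \<union>
     (\<Union>p. closures (ax_strong_collection p)) \<union>
     (\<Union>p. closures (ax_subset_collection p))"

definition GUP_CZF :: "fm set" where
  "GUP_CZF = (\<Union>p. closures (\<^bold>\<forall>I. (\<^bold>\<forall>x. \<^bold>\<exists>y. y \<^bold>\<in> I \<^bold>\<and> at_vars p [x, y]) \<^bold>\<longrightarrow> (\<^bold>\<exists>y. y \<^bold>\<in> I \<^bold>\<and> (\<^bold>\<forall>x. at_vars p [x, y]))))"

subsection \<open>Set-presented relations in set theory\<close>

definition f_subset :: "var \<Rightarrow> var \<Rightarrow> form" (infix "\<^bold>\<subseteq>" 50) where
  "(x \<^bold>\<subseteq> y) = (\<^bold>\<forall>z. z \<^bold>\<in> x \<^bold>\<longrightarrow> z \<^bold>\<in> y)"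

definition is_upair :: "var \<Rightarrow> var \<Rightarrow> var \<Rightarrow> form" where
  "is_upair w x y = (\<^bold>\<forall>z. z \<^bold>\<in> w \<^bold>\<longleftrightarrow> z \<^bold>= x \<^bold>\<or> z \<^bold>= y)"

definition is_pair :: "var \<Rightarrow> var \<Rightarrow> var \<Rightarrow> form" where
  "is_pair w x y = (\<^bold>\<forall>z. z \<^bold>\<in> w \<^bold>\<longleftrightarrow> is_upair z x x \<^bold>\<or> is_upair z x y)"

definition maps_to :: "var \<Rightarrow> var \<Rightarrow> var \<Rightarrow> form" where
  "maps_to f x v = (\<^bold>\<exists>p. is_pair p x v \<^bold>\<and> p \<^bold>\<in> f)"

definition is_family :: "var \<Rightarrow> var \<Rightarrow> form" where
  "is_family f D =
     ((\<^bold>\<forall>p. p \<^bold>\<in> f \<^bold>\<longrightarrow> (\<^bold>\<exists>x. \<^bold>\<exists>v. x \<^bold>\<in> D \<^bold>\<and> is_pair p x v)) \<^bold>\<and>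
      (\<^bold>\<forall>x. x \<^bold>\<in> D \<^bold>\<longrightarrow> (\<^bold>\<exists>!v. maps_to f x v)))"

text \<open>
  \<open>C\<close> is curried: it assigns to \<open>x \<in> S\<close> a family indexed by \<open>I(x)\<close>. Below \<open>K\<close> is \<open>I(x)\<close>,
  \<open>D\<close> is \<open>C(x, -)\<close> and \<open>V\<close> is \<open>C(x, i)\<close>.
\<close>

definition set_presented :: "var \<Rightarrow> (var \<Rightarrow> var \<Rightarrow> form) \<Rightarrow> form" where
  "set_presented S R = (\<^bold>\<exists>I. \<^bold>\<exists>C. is_family I S \<^bold>\<and> is_family C S \<^bold>\<and>
     (\<^bold>\<forall>x. x \<^bold>\<in> S \<^bold>\<longrightarrow> (\<^bold>\<forall>K. \<^bold>\<forall>D. maps_to I x K \<^bold>\<and> maps_to C x D \<^bold>\<longrightarrow>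
        is_family D K \<^bold>\<and> (\<^bold>\<forall>i. \<^bold>\<forall>V. i \<^bold>\<in> K \<^bold>\<and> maps_to D i V \<^bold>\<longrightarrow> V \<^bold>\<subseteq> S))) \<^bold>\<and>
     (\<^bold>\<forall>x. x \<^bold>\<in> S \<^bold>\<longrightarrow> (\<^bold>\<forall>U. U \<^bold>\<subseteq> S \<^bold>\<longrightarrow> (R x U \<^bold>\<longleftrightarrow>
        (\<^bold>\<exists>K. \<^bold>\<exists>D. maps_to I x K \<^bold>\<and> maps_to C x D \<^bold>\<and>
           (\<^bold>\<exists>i. i \<^bold>\<in> K \<^bold>\<and> (\<^bold>\<exists>V. maps_to D i V \<^bold>\<and> V \<^bold>\<subseteq> U)))))))"

text \<open>
  The order is any definable relation on the set \<open>S\<close>. A set of pairs \<open>r\<close> is the special case in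
  which \<open>le x y\<close> is \<open>maps_to r x y\<close>, for a definable \<open>r\<close>.
\<close>

definition partial_order :: "var \<Rightarrow> (var \<Rightarrow> var \<Rightarrow> form) \<Rightarrow> form" where
  "partial_order S le =
     ((\<^bold>\<forall>x. x \<^bold>\<in> S \<^bold>\<longrightarrow> le x x) \<^bold>\<and>
      (\<^bold>\<forall>x. x \<^bold>\<in> S \<^bold>\<longrightarrow> (\<^bold>\<forall>y. y \<^bold>\<in> S \<^bold>\<longrightarrow> (\<^bold>\<forall>z. z \<^bold>\<in> S \<^bold>\<longrightarrow> le x y \<^bold>\<and> le y z \<^bold>\<longrightarrow> le x z))) \<^bold>\<and>
      (\<^bold>\<forall>x. x \<^bold>\<in> S \<^bold>\<longrightarrow> (\<^bold>\<forall>y. y \<^bold>\<in> S \<^bold>\<longrightarrow> le x y \<^bold>\<and> le y x \<^bold>\<longrightarrow> x \<^bold>= y)))"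

definition is_least :: "var \<Rightarrow> (var \<Rightarrow> var \<Rightarrow> form) \<Rightarrow> var \<Rightarrow> form" where
  "is_least S le a = (\<^bold>\<forall>y. y \<^bold>\<in> S \<^bold>\<longrightarrow> le a y)"

definition is_stable :: "var \<Rightarrow> (var \<Rightarrow> var \<Rightarrow> form) \<Rightarrow> var \<Rightarrow> form" where
  "is_stable S le a = (\<^bold>\<forall>x. x \<^bold>\<in> S \<^bold>\<longrightarrow> \<^bold>\<not> \<^bold>\<not> le a x \<^bold>\<longrightarrow> le a x)"

definition R\<^sub>c :: "var \<Rightarrow> (var \<Rightarrow> var \<Rightarrow> form) \<Rightarrow> var \<Rightarrow> var \<Rightarrow> form" where
  "R\<^sub>c S le x U = (\<^bold>\<forall>y. y \<^bold>\<in> S \<^bold>\<longrightarrow> (\<^bold>\<forall>u. u \<^bold>\<in> U \<^bold>\<longrightarrow> le u y) \<^bold>\<longrightarrow> le x y)"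


section \<open>Constructive type theory\<close>

subsection \<open>Martin-Loef's logical framework\<close>

text \<open>
  Constructive type theory is presented in Martin-Loef's logical framework: there is a type
  \<open>TSet\<close> of sets, every set \<open>a\<close> has a type \<open>TEl a\<close> of elements, and \<open>TFun A B\<close> is the type of
  functions from \<open>A\<close> to the family \<open>B\<close>, in which one variable is bound. Propositions are sets.
  The constants of a theory are typed, and its computation rules are given, by axioms.
\<close>

datatype ctt_const =
    cN0 | cCase0
  | cN1 | cStar | cCase1
  | cN2 | cTrue2 | cFalse2 | cCase2
  | cNat | cZero | cSucc | cNatrec
  | cList | cNil | cCons | cListrec
  | cPi | cLambda | cAp
  | cSigma | cPair | cSplit
  | cSum | cInl | cInr | cWhen
  | cId | cRefl | cJ
  | cW | cSup | cWrec
  | cU | cT | cN0u | cN1u | cN2u | cNatu | cListu | cPiu | cSigmau | cSumu | cIdu | cWu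

datatype 'c const =
    Ctt ctt_const
  | Gup_elem | Gup_proof \<comment> \<open>used only by the uniformity principle\<close>
  | Ext 'c \<comment> \<open>further constants available to extensions\<close>

datatype 'c tm =
    Var nat
  | Const "'c const"
  | App "'c tm" "'c tm"
  | Lam "'c tm"

datatype 'c ty =
    TSet
  | TEl "'c tm"
  | TFun "'c ty" "'c ty"

primrec ren_tm :: "(nat \<Rightarrow> nat) \<Rightarrow> 'c tm \<Rightarrow> 'c tm" where
  "ren_tm r (Var n) = Var (r n)"
| "ren_tm r (Const c) = Const c"
| "ren_tm r (App f a) = App (ren_tm r f) (ren_tm r a)"
| "ren_tm r (Lam b) = Lam (ren_tm (up r) b)"

primrec ren_ty :: "(nat \<Rightarrow> nat) \<Rightarrow> 'c ty \<Rightarrow> 'c ty" where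
  "ren_ty r TSet = TSet"
| "ren_ty r (TEl a) = TEl (ren_tm r a)"
| "ren_ty r (TFun A B) = TFun (ren_ty r A) (ren_ty (up r) B)"

definition up_sub :: "(nat \<Rightarrow> 'c tm) \<Rightarrow> nat \<Rightarrow> 'c tm" where
  "up_sub s = case_nat (Var 0) (\<lambda>n. ren_tm Suc (s n))"

primrec sub_tm :: "(nat \<Rightarrow> 'c tm) \<Rightarrow> 'c tm \<Rightarrow> 'c tm" where
  "sub_tm s (Var n) = s n"
| "sub_tm s (Const c) = Const c"
| "sub_tm s (App f a) = App (sub_tm s f) (sub_tm s a)"
| "sub_tm s (Lam b) = Lam (sub_tm (up_sub s) b)"

primrec sub_ty :: "(nat \<Rightarrow> 'c tm) \<Rightarrow> 'c ty \<Rightarrow> 'c ty" where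
  "sub_ty s TSet = TSet"
| "sub_ty s (TEl a) = TEl (sub_tm s a)"
| "sub_ty s (TFun A B) = TFun (sub_ty s A) (sub_ty (up_sub s) B)"

definition inst_tm :: "'c tm \<Rightarrow> 'c tm \<Rightarrow> 'c tm" where
  "inst_tm a b = sub_tm (case_nat a Var) b"

definition inst_ty :: "'c tm \<Rightarrow> 'c ty \<Rightarrow> 'c ty" where
  "inst_ty a B = sub_ty (case_nat a Var) B"

text \<open>The head of a context is the type of the variable with index 0.\<close>

type_synonym 'c ctx = "'c ty list"

definition var_ty :: "'c ctx \<Rightarrow> nat \<Rightarrow> 'c ty" where
  "var_ty G i = ren_ty (\<lambda>n. n + Suc i) (G ! i)"

datatype 'c jdg =
    IsCtx
  | IsTy "'c ty"
  | EqTy "'c ty" "'c ty"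
  | HasTy "'c tm" "'c ty"
  | EqTm "'c tm" "'c tm" "'c ty"

primrec sub_jdg :: "(nat \<Rightarrow> 'c tm) \<Rightarrow> 'c jdg \<Rightarrow> 'c jdg" where
  "sub_jdg s IsCtx = IsCtx"
| "sub_jdg s (IsTy A) = IsTy (sub_ty s A)"
| "sub_jdg s (EqTy A B) = EqTy (sub_ty s A) (sub_ty s B)"
| "sub_jdg s (HasTy a A) = HasTy (sub_tm s a) (sub_ty s A)"
| "sub_jdg s (EqTm a b A) = EqTm (sub_tm s a) (sub_tm s b) (sub_ty s A)"

text \<open>
  A theory is a set of hypothetical judgements taken as axioms. The rule \<open>subst\<close> is simultaneous
  substitution of terms in context \<open>G\<close> for all variables of \<open>D\<close>; it includes weakening, and
  makes an axiom with a nonempty context an inference rule.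
\<close>

inductive derives :: "('c ctx \<times> 'c jdg) set \<Rightarrow> 'c ctx \<Rightarrow> 'c jdg \<Rightarrow> bool" for Th where
  ax: "(G, j) \<in> Th \<Longrightarrow> derives Th G j"
| subst: "derives Th D j \<Longrightarrow> derives Th G IsCtx \<Longrightarrow>
    (\<And>i. i < length D \<Longrightarrow> derives Th G (HasTy (s i) (sub_ty s (var_ty D i)))) \<Longrightarrow>
    derives Th G (sub_jdg s j)"
| ctx_empty: "derives Th [] IsCtx"
| ctx_ext: "derives Th G IsCtx \<Longrightarrow> derives Th G (IsTy A) \<Longrightarrow> derives Th (A # G) IsCtx"
| var: "derives Th G IsCtx \<Longrightarrow> i < length G \<Longrightarrow> derives Th G (HasTy (Var i) (var_ty G i))"
| set_form: "derives Th G IsCtx \<Longrightarrow> derives Th G (IsTy TSet)"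
| el_form: "derives Th G (HasTy a TSet) \<Longrightarrow> derives Th G (IsTy (TEl a))"
| el_cong: "derives Th G (EqTm a b TSet) \<Longrightarrow> derives Th G (EqTy (TEl a) (TEl b))"
| fun_form: "derives Th G (IsTy A) \<Longrightarrow> derives Th (A # G) (IsTy B) \<Longrightarrow> derives Th G (IsTy (TFun A B))"
| fun_cong: "derives Th G (EqTy A A') \<Longrightarrow> derives Th (A # G) (EqTy B B') \<Longrightarrow>
    derives Th G (EqTy (TFun A B) (TFun A' B'))"
| ty_refl: "derives Th G (IsTy A) \<Longrightarrow> derives Th G (EqTy A A)"
| ty_sym: "derives Th G (EqTy A B) \<Longrightarrow> derives Th G (EqTy B A)"
| ty_trans: "derives Th G (EqTy A B) \<Longrightarrow> derives Th G (EqTy B C) \<Longrightarrow> derives Th G (EqTy A C)"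
| tm_refl: "derives Th G (HasTy a A) \<Longrightarrow> derives Th G (EqTm a a A)"
| tm_sym: "derives Th G (EqTm a b A) \<Longrightarrow> derives Th G (EqTm b a A)"
| tm_trans: "derives Th G (EqTm a b A) \<Longrightarrow> derives Th G (EqTm b c A) \<Longrightarrow> derives Th G (EqTm a c A)"
| conv: "derives Th G (HasTy a A) \<Longrightarrow> derives Th G (EqTy A B) \<Longrightarrow> derives Th G (HasTy a B)"
| conv_eq: "derives Th G (EqTm a b A) \<Longrightarrow> derives Th G (EqTy A B) \<Longrightarrow> derives Th G (EqTm a b B)"
| lam: "derives Th G (IsTy A) \<Longrightarrow> derives Th (A # G) (HasTy b B) \<Longrightarrow>
    derives Th G (HasTy (Lam b) (TFun A B))"
| lam_cong: "derives Th G (IsTy A) \<Longrightarrow> derives Th (A # G) (EqTm b b' B) \<Longrightarrow>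
    derives Th G (EqTm (Lam b) (Lam b') (TFun A B))"
| app: "derives Th G (HasTy f (TFun A B)) \<Longrightarrow> derives Th G (HasTy a A) \<Longrightarrow>
    derives Th G (HasTy (App f a) (inst_ty a B))"
| app_cong: "derives Th G (EqTm f f' (TFun A B)) \<Longrightarrow> derives Th G (EqTm a a' A) \<Longrightarrow>
    derives Th G (EqTm (App f a) (App f' a') (inst_ty a B))"
| beta: "derives Th (A # G) (HasTy b B) \<Longrightarrow> derives Th G (HasTy a A) \<Longrightarrow>
    derives Th G (EqTm (App (Lam b) a) (inst_tm a b) (inst_ty a B))"
| eta: "derives Th G (HasTy f (TFun A B)) \<Longrightarrow>
    derives Th G (EqTm (Lam (App (ren_tm Suc f) (Var 0))) f (TFun A B))"

subsection \<open>Terms, types and judgements with named bound variables\<close>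

text \<open>As for formulas, these await the number of variables in whose scope they stand.\<close>

type_synonym 'c term' = "nat \<Rightarrow> 'c tm"
type_synonym 'c type' = "nat \<Rightarrow> 'c ty"
type_synonym 'c hyp_jdg = "nat \<Rightarrow> 'c ctx \<Rightarrow> 'c ctx \<times> 'c jdg"

definition K :: "ctt_const \<Rightarrow> 'c term'" where
  "K c = (\<lambda>d. Const (Ctt c))"

definition t_app :: "'c term' \<Rightarrow> 'c term' \<Rightarrow> 'c term'" (infixl "\<cdot>" 90) where
  "f \<cdot> a = (\<lambda>d. App (f d) (a d))"

definition t_lam :: "('c term' \<Rightarrow> 'c term') \<Rightarrow> 'c term'" (binder "\<^bold>\<lambda>" 10) where
  "t_lam b = (\<lambda>d. Lam (b (\<lambda>d'. Var (d' - Suc d)) (Suc d)))"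

definition SET :: "'c type'" where
  "SET = (\<lambda>d. TSet)"

definition EL :: "'c term' \<Rightarrow> 'c type'" where
  "EL a = (\<lambda>d. TEl (a d))"

definition t_dfun :: "'c type' \<Rightarrow> ('c term' \<Rightarrow> 'c type') \<Rightarrow> 'c type'" (infixr "\<Rrightarrow>" 55) where
  "A \<Rrightarrow> B = (\<lambda>d. TFun (A d) (B (\<lambda>d'. Var (d' - Suc d)) (Suc d)))"

abbreviation t_fun :: "'c type' \<Rightarrow> 'c type' \<Rightarrow> 'c type'" (infixr "\<rightarrow>" 55) where
  "A \<rightarrow> B \<equiv> A \<Rrightarrow> (\<lambda>_. B)"

definition j_typing :: "'c term' \<Rightarrow> 'c type' \<Rightarrow> 'c hyp_jdg" (infix "\<Ztypecolon>" 50) where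
  "(a \<Ztypecolon> A) = (\<lambda>d G. (G, HasTy (a d) (A d)))"

definition j_eq :: "'c term' \<Rightarrow> 'c term' \<Rightarrow> 'c type' \<Rightarrow> 'c hyp_jdg" ("_ \<doteq> _ \<Ztypecolon> _" [51, 51, 51] 50) where
  "(a \<doteq> b \<Ztypecolon> A) = (\<lambda>d G. (G, EqTm (a d) (b d) (A d)))"

definition j_hyp :: "'c type' \<Rightarrow> ('c term' \<Rightarrow> 'c hyp_jdg) \<Rightarrow> 'c hyp_jdg" (infixr "\<rhd>" 45) where
  "(A \<rhd> j) = (\<lambda>d G. j (\<lambda>d'. Var (d' - Suc d)) (Suc d) (A d # G))"

text \<open>A term of the empty context, placed in scope of further variables.\<close>

definition weaken :: "'c tm \<Rightarrow> 'c term'" where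
  "weaken a = (\<lambda>d. ren_tm (\<lambda>n. n + d) a)"

subsection \<open>CTT\<close>

definition ctt_typings :: "'c hyp_jdg set" where
  "ctt_typings = {
    K cN0 \<Ztypecolon> SET,
    K cCase0 \<Ztypecolon> (EL (K cN0) \<rightarrow> SET) \<Rrightarrow> (\<lambda>C. EL (K cN0) \<Rrightarrow> (\<lambda>c. EL (C \<cdot> c))),

    K cN1 \<Ztypecolon> SET,
    K cStar \<Ztypecolon> EL (K cN1),
    K cCase1 \<Ztypecolon> (EL (K cN1) \<rightarrow> SET) \<Rrightarrow> (\<lambda>C. EL (C \<cdot> K cStar) \<rightarrow> EL (K cN1) \<Rrightarrow> (\<lambda>c. EL (C \<cdot> c))),

    K cN2 \<Ztypecolon> SET,
    K cTrue2 \<Ztypecolon> EL (K cN2),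
    K cFalse2 \<Ztypecolon> EL (K cN2),
    K cCase2 \<Ztypecolon> (EL (K cN2) \<rightarrow> SET) \<Rrightarrow> (\<lambda>C. EL (C \<cdot> K cTrue2) \<rightarrow> EL (C \<cdot> K cFalse2) \<rightarrow>
      EL (K cN2) \<Rrightarrow> (\<lambda>c. EL (C \<cdot> c))),

    K cNat \<Ztypecolon> SET,
    K cZero \<Ztypecolon> EL (K cNat),
    K cSucc \<Ztypecolon> EL (K cNat) \<rightarrow> EL (K cNat),
    K cNatrec \<Ztypecolon> (EL (K cNat) \<rightarrow> SET) \<Rrightarrow> (\<lambda>C. EL (C \<cdot> K cZero) \<rightarrow>
      (EL (K cNat) \<Rrightarrow> (\<lambda>n. EL (C \<cdot> n) \<rightarrow> EL (C \<cdot> (K cSucc \<cdot> n)))) \<rightarrow>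
      EL (K cNat) \<Rrightarrow> (\<lambda>n. EL (C \<cdot> n))),

    K cList \<Ztypecolon> SET \<rightarrow> SET,
    K cNil \<Ztypecolon> SET \<Rrightarrow> (\<lambda>A. EL (K cList \<cdot> A)),
    K cCons \<Ztypecolon> SET \<Rrightarrow> (\<lambda>A. EL A \<rightarrow> EL (K cList \<cdot> A) \<rightarrow> EL (K cList \<cdot> A)),
    K cListrec \<Ztypecolon> SET \<Rrightarrow> (\<lambda>A. (EL (K cList \<cdot> A) \<rightarrow> SET) \<Rrightarrow> (\<lambda>C.
      EL (C \<cdot> (K cNil \<cdot> A)) \<rightarrow>
      (EL A \<Rrightarrow> (\<lambda>x. EL (K cList \<cdot> A) \<Rrightarrow> (\<lambda>l. EL (C \<cdot> l) \<rightarrow> EL (C \<cdot> (K cCons \<cdot> A \<cdot> x \<cdot> l))))) \<rightarrow>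
      EL (K cList \<cdot> A) \<Rrightarrow> (\<lambda>l. EL (C \<cdot> l)))),

    K cPi \<Ztypecolon> SET \<Rrightarrow> (\<lambda>A. (EL A \<rightarrow> SET) \<rightarrow> SET),
    K cLambda \<Ztypecolon> SET \<Rrightarrow> (\<lambda>A. (EL A \<rightarrow> SET) \<Rrightarrow> (\<lambda>B. (EL A \<Rrightarrow> (\<lambda>x. EL (B \<cdot> x))) \<rightarrow> EL (K cPi \<cdot> A \<cdot> B))),
    K cAp \<Ztypecolon> SET \<Rrightarrow> (\<lambda>A. (EL A \<rightarrow> SET) \<Rrightarrow> (\<lambda>B. EL (K cPi \<cdot> A \<cdot> B) \<rightarrow> EL A \<Rrightarrow> (\<lambda>x. EL (B \<cdot> x)))),

    K cSigma \<Ztypecolon> SET \<Rrightarrow> (\<lambda>A. (EL A \<rightarrow> SET) \<rightarrow> SET),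
    K cPair \<Ztypecolon> SET \<Rrightarrow> (\<lambda>A. (EL A \<rightarrow> SET) \<Rrightarrow> (\<lambda>B. EL A \<Rrightarrow> (\<lambda>x. EL (B \<cdot> x) \<rightarrow> EL (K cSigma \<cdot> A \<cdot> B)))),
    K cSplit \<Ztypecolon> SET \<Rrightarrow> (\<lambda>A. (EL A \<rightarrow> SET) \<Rrightarrow> (\<lambda>B. (EL (K cSigma \<cdot> A \<cdot> B) \<rightarrow> SET) \<Rrightarrow> (\<lambda>C.
      (EL A \<Rrightarrow> (\<lambda>x. EL (B \<cdot> x) \<Rrightarrow> (\<lambda>y. EL (C \<cdot> (K cPair \<cdot> A \<cdot> B \<cdot> x \<cdot> y))))) \<rightarrow>
      EL (K cSigma \<cdot> A \<cdot> B) \<Rrightarrow> (\<lambda>c. EL (C \<cdot> c))))),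

    K cSum \<Ztypecolon> SET \<rightarrow> SET \<rightarrow> SET,
    K cInl \<Ztypecolon> SET \<Rrightarrow> (\<lambda>A. SET \<Rrightarrow> (\<lambda>B. EL A \<rightarrow> EL (K cSum \<cdot> A \<cdot> B))),
    K cInr \<Ztypecolon> SET \<Rrightarrow> (\<lambda>A. SET \<Rrightarrow> (\<lambda>B. EL B \<rightarrow> EL (K cSum \<cdot> A \<cdot> B))),
    K cWhen \<Ztypecolon> SET \<Rrightarrow> (\<lambda>A. SET \<Rrightarrow> (\<lambda>B. (EL (K cSum \<cdot> A \<cdot> B) \<rightarrow> SET) \<Rrightarrow> (\<lambda>C.
      (EL A \<Rrightarrow> (\<lambda>x. EL (C \<cdot> (K cInl \<cdot> A \<cdot> B \<cdot> x)))) \<rightarrow>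
      (EL B \<Rrightarrow> (\<lambda>y. EL (C \<cdot> (K cInr \<cdot> A \<cdot> B \<cdot> y)))) \<rightarrow>
      EL (K cSum \<cdot> A \<cdot> B) \<Rrightarrow> (\<lambda>c. EL (C \<cdot> c))))),

    K cId \<Ztypecolon> SET \<Rrightarrow> (\<lambda>A. EL A \<rightarrow> EL A \<rightarrow> SET),
    K cRefl \<Ztypecolon> SET \<Rrightarrow> (\<lambda>A. EL A \<Rrightarrow> (\<lambda>x. EL (K cId \<cdot> A \<cdot> x \<cdot> x))),
    K cJ \<Ztypecolon> SET \<Rrightarrow> (\<lambda>A. (EL A \<Rrightarrow> (\<lambda>x. EL A \<Rrightarrow> (\<lambda>y. EL (K cId \<cdot> A \<cdot> x \<cdot> y) \<rightarrow> SET))) \<Rrightarrow> (\<lambda>C.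
      (EL A \<Rrightarrow> (\<lambda>x. EL (C \<cdot> x \<cdot> x \<cdot> (K cRefl \<cdot> A \<cdot> x)))) \<rightarrow>
      EL A \<Rrightarrow> (\<lambda>x. EL A \<Rrightarrow> (\<lambda>y. EL (K cId \<cdot> A \<cdot> x \<cdot> y) \<Rrightarrow> (\<lambda>c. EL (C \<cdot> x \<cdot> y \<cdot> c)))))),

    K cW \<Ztypecolon> SET \<Rrightarrow> (\<lambda>A. (EL A \<rightarrow> SET) \<rightarrow> SET),
    K cSup \<Ztypecolon> SET \<Rrightarrow> (\<lambda>A. (EL A \<rightarrow> SET) \<Rrightarrow> (\<lambda>B. EL A \<Rrightarrow> (\<lambda>x.
      (EL (B \<cdot> x) \<rightarrow> EL (K cW \<cdot> A \<cdot> B)) \<rightarrow> EL (K cW \<cdot> A \<cdot> B)))),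
    K cWrec \<Ztypecolon> SET \<Rrightarrow> (\<lambda>A. (EL A \<rightarrow> SET) \<Rrightarrow> (\<lambda>B. (EL (K cW \<cdot> A \<cdot> B) \<rightarrow> SET) \<Rrightarrow> (\<lambda>C.
      (EL A \<Rrightarrow> (\<lambda>x. (EL (B \<cdot> x) \<rightarrow> EL (K cW \<cdot> A \<cdot> B)) \<Rrightarrow> (\<lambda>f.
         (EL (B \<cdot> x) \<Rrightarrow> (\<lambda>v. EL (C \<cdot> (f \<cdot> v)))) \<rightarrow> EL (C \<cdot> (K cSup \<cdot> A \<cdot> B \<cdot> x \<cdot> f))))) \<rightarrow>
      EL (K cW \<cdot> A \<cdot> B) \<Rrightarrow> (\<lambda>w. EL (C \<cdot> w))))),

    K cU \<Ztypecolon> SET,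
    K cT \<Ztypecolon> EL (K cU) \<rightarrow> SET,
    K cN0u \<Ztypecolon> EL (K cU),
    K cN1u \<Ztypecolon> EL (K cU),
    K cN2u \<Ztypecolon> EL (K cU),
    K cNatu \<Ztypecolon> EL (K cU),
    K cListu \<Ztypecolon> EL (K cU) \<rightarrow> EL (K cU),
    K cPiu \<Ztypecolon> EL (K cU) \<Rrightarrow> (\<lambda>a. (EL (K cT \<cdot> a) \<rightarrow> EL (K cU)) \<rightarrow> EL (K cU)),
    K cSigmau \<Ztypecolon> EL (K cU) \<Rrightarrow> (\<lambda>a. (EL (K cT \<cdot> a) \<rightarrow> EL (K cU)) \<rightarrow> EL (K cU)),
    K cSumu \<Ztypecolon> EL (K cU) \<rightarrow> EL (K cU) \<rightarrow> EL (K cU),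
    K cIdu \<Ztypecolon> EL (K cU) \<Rrightarrow> (\<lambda>a. EL (K cT \<cdot> a) \<rightarrow> EL (K cT \<cdot> a) \<rightarrow> EL (K cU)),
    K cWu \<Ztypecolon> EL (K cU) \<Rrightarrow> (\<lambda>a. (EL (K cT \<cdot> a) \<rightarrow> EL (K cU)) \<rightarrow> EL (K cU))}"

definition ctt_equations :: "'c hyp_jdg set" where
  "ctt_equations = {
    (EL (K cN1) \<rightarrow> SET) \<rhd> (\<lambda>C. EL (C \<cdot> K cStar) \<rhd> (\<lambda>e.
      K cCase1 \<cdot> C \<cdot> e \<cdot> K cStar \<doteq> e \<Ztypecolon> EL (C \<cdot> K cStar))),

    (EL (K cN2) \<rightarrow> SET) \<rhd> (\<lambda>C. EL (C \<cdot> K cTrue2) \<rhd> (\<lambda>e. EL (C \<cdot> K cFalse2) \<rhd> (\<lambda>g.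
      K cCase2 \<cdot> C \<cdot> e \<cdot> g \<cdot> K cTrue2 \<doteq> e \<Ztypecolon> EL (C \<cdot> K cTrue2)))),
    (EL (K cN2) \<rightarrow> SET) \<rhd> (\<lambda>C. EL (C \<cdot> K cTrue2) \<rhd> (\<lambda>e. EL (C \<cdot> K cFalse2) \<rhd> (\<lambda>g.
      K cCase2 \<cdot> C \<cdot> e \<cdot> g \<cdot> K cFalse2 \<doteq> g \<Ztypecolon> EL (C \<cdot> K cFalse2)))),

    (EL (K cNat) \<rightarrow> SET) \<rhd> (\<lambda>C. EL (C \<cdot> K cZero) \<rhd> (\<lambda>e.
      (EL (K cNat) \<Rrightarrow> (\<lambda>n. EL (C \<cdot> n) \<rightarrow> EL (C \<cdot> (K cSucc \<cdot> n)))) \<rhd> (\<lambda>g.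
      K cNatrec \<cdot> C \<cdot> e \<cdot> g \<cdot> K cZero \<doteq> e \<Ztypecolon> EL (C \<cdot> K cZero)))),
    (EL (K cNat) \<rightarrow> SET) \<rhd> (\<lambda>C. EL (C \<cdot> K cZero) \<rhd> (\<lambda>e.
      (EL (K cNat) \<Rrightarrow> (\<lambda>n. EL (C \<cdot> n) \<rightarrow> EL (C \<cdot> (K cSucc \<cdot> n)))) \<rhd> (\<lambda>g. EL (K cNat) \<rhd> (\<lambda>n.
      K cNatrec \<cdot> C \<cdot> e \<cdot> g \<cdot> (K cSucc \<cdot> n) \<doteq> g \<cdot> n \<cdot> (K cNatrec \<cdot> C \<cdot> e \<cdot> g \<cdot> n)
        \<Ztypecolon> EL (C \<cdot> (K cSucc \<cdot> n)))))),

    SET \<rhd> (\<lambda>A. (EL (K cList \<cdot> A) \<rightarrow> SET) \<rhd> (\<lambda>C. EL (C \<cdot> (K cNil \<cdot> A)) \<rhd> (\<lambda>e.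
      (EL A \<Rrightarrow> (\<lambda>x. EL (K cList \<cdot> A) \<Rrightarrow> (\<lambda>l. EL (C \<cdot> l) \<rightarrow> EL (C \<cdot> (K cCons \<cdot> A \<cdot> x \<cdot> l))))) \<rhd> (\<lambda>g.
      K cListrec \<cdot> A \<cdot> C \<cdot> e \<cdot> g \<cdot> (K cNil \<cdot> A) \<doteq> e \<Ztypecolon> EL (C \<cdot> (K cNil \<cdot> A)))))),
    SET \<rhd> (\<lambda>A. (EL (K cList \<cdot> A) \<rightarrow> SET) \<rhd> (\<lambda>C. EL (C \<cdot> (K cNil \<cdot> A)) \<rhd> (\<lambda>e.
      (EL A \<Rrightarrow> (\<lambda>x. EL (K cList \<cdot> A) \<Rrightarrow> (\<lambda>l. EL (C \<cdot> l) \<rightarrow> EL (C \<cdot> (K cCons \<cdot> A \<cdot> x \<cdot> l))))) \<rhd> (\<lambda>g.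
      EL A \<rhd> (\<lambda>x. EL (K cList \<cdot> A) \<rhd> (\<lambda>l.
      K cListrec \<cdot> A \<cdot> C \<cdot> e \<cdot> g \<cdot> (K cCons \<cdot> A \<cdot> x \<cdot> l) \<doteq> g \<cdot> x \<cdot> l \<cdot> (K cListrec \<cdot> A \<cdot> C \<cdot> e \<cdot> g \<cdot> l)
        \<Ztypecolon> EL (C \<cdot> (K cCons \<cdot> A \<cdot> x \<cdot> l)))))))),

    SET \<rhd> (\<lambda>A. (EL A \<rightarrow> SET) \<rhd> (\<lambda>B. (EL A \<Rrightarrow> (\<lambda>x. EL (B \<cdot> x))) \<rhd> (\<lambda>f. EL A \<rhd> (\<lambda>a.
      K cAp \<cdot> A \<cdot> B \<cdot> (K cLambda \<cdot> A \<cdot> B \<cdot> f) \<cdot> a \<doteq> f \<cdot> a \<Ztypecolon> EL (B \<cdot> a))))),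

    SET \<rhd> (\<lambda>A. (EL A \<rightarrow> SET) \<rhd> (\<lambda>B. (EL (K cSigma \<cdot> A \<cdot> B) \<rightarrow> SET) \<rhd> (\<lambda>C.
      (EL A \<Rrightarrow> (\<lambda>x. EL (B \<cdot> x) \<Rrightarrow> (\<lambda>y. EL (C \<cdot> (K cPair \<cdot> A \<cdot> B \<cdot> x \<cdot> y))))) \<rhd> (\<lambda>g.
      EL A \<rhd> (\<lambda>x. EL (B \<cdot> x) \<rhd> (\<lambda>y.
      K cSplit \<cdot> A \<cdot> B \<cdot> C \<cdot> g \<cdot> (K cPair \<cdot> A \<cdot> B \<cdot> x \<cdot> y) \<doteq> g \<cdot> x \<cdot> y
        \<Ztypecolon> EL (C \<cdot> (K cPair \<cdot> A \<cdot> B \<cdot> x \<cdot> y)))))))),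

    SET \<rhd> (\<lambda>A. SET \<rhd> (\<lambda>B. (EL (K cSum \<cdot> A \<cdot> B) \<rightarrow> SET) \<rhd> (\<lambda>C.
      (EL A \<Rrightarrow> (\<lambda>x. EL (C \<cdot> (K cInl \<cdot> A \<cdot> B \<cdot> x)))) \<rhd> (\<lambda>e.
      (EL B \<Rrightarrow> (\<lambda>y. EL (C \<cdot> (K cInr \<cdot> A \<cdot> B \<cdot> y)))) \<rhd> (\<lambda>g. EL A \<rhd> (\<lambda>x.
      K cWhen \<cdot> A \<cdot> B \<cdot> C \<cdot> e \<cdot> g \<cdot> (K cInl \<cdot> A \<cdot> B \<cdot> x) \<doteq> e \<cdot> x \<Ztypecolon> EL (C \<cdot> (K cInl \<cdot> A \<cdot> B \<cdot> x)))))))),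
    SET \<rhd> (\<lambda>A. SET \<rhd> (\<lambda>B. (EL (K cSum \<cdot> A \<cdot> B) \<rightarrow> SET) \<rhd> (\<lambda>C.
      (EL A \<Rrightarrow> (\<lambda>x. EL (C \<cdot> (K cInl \<cdot> A \<cdot> B \<cdot> x)))) \<rhd> (\<lambda>e.
      (EL B \<Rrightarrow> (\<lambda>y. EL (C \<cdot> (K cInr \<cdot> A \<cdot> B \<cdot> y)))) \<rhd> (\<lambda>g. EL B \<rhd> (\<lambda>y.
      K cWhen \<cdot> A \<cdot> B \<cdot> C \<cdot> e \<cdot> g \<cdot> (K cInr \<cdot> A \<cdot> B \<cdot> y) \<doteq> g \<cdot> y \<Ztypecolon> EL (C \<cdot> (K cInr \<cdot> A \<cdot> B \<cdot> y)))))))),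

    SET \<rhd> (\<lambda>A. (EL A \<Rrightarrow> (\<lambda>x. EL A \<Rrightarrow> (\<lambda>y. EL (K cId \<cdot> A \<cdot> x \<cdot> y) \<rightarrow> SET))) \<rhd> (\<lambda>C.
      (EL A \<Rrightarrow> (\<lambda>x. EL (C \<cdot> x \<cdot> x \<cdot> (K cRefl \<cdot> A \<cdot> x)))) \<rhd> (\<lambda>g. EL A \<rhd> (\<lambda>x.
      K cJ \<cdot> A \<cdot> C \<cdot> g \<cdot> x \<cdot> x \<cdot> (K cRefl \<cdot> A \<cdot> x) \<doteq> g \<cdot> x \<Ztypecolon> EL (C \<cdot> x \<cdot> x \<cdot> (K cRefl \<cdot> A \<cdot> x)))))),

    SET \<rhd> (\<lambda>A. (EL A \<rightarrow> SET) \<rhd> (\<lambda>B. (EL (K cW \<cdot> A \<cdot> B) \<rightarrow> SET) \<rhd> (\<lambda>C.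
      (EL A \<Rrightarrow> (\<lambda>x. (EL (B \<cdot> x) \<rightarrow> EL (K cW \<cdot> A \<cdot> B)) \<Rrightarrow> (\<lambda>f.
         (EL (B \<cdot> x) \<Rrightarrow> (\<lambda>v. EL (C \<cdot> (f \<cdot> v)))) \<rightarrow> EL (C \<cdot> (K cSup \<cdot> A \<cdot> B \<cdot> x \<cdot> f))))) \<rhd> (\<lambda>g.
      EL A \<rhd> (\<lambda>x. (EL (B \<cdot> x) \<rightarrow> EL (K cW \<cdot> A \<cdot> B)) \<rhd> (\<lambda>f.
      K cWrec \<cdot> A \<cdot> B \<cdot> C \<cdot> g \<cdot> (K cSup \<cdot> A \<cdot> B \<cdot> x \<cdot> f) \<doteq>
        g \<cdot> x \<cdot> f \<cdot> (\<^bold>\<lambda>v. K cWrec \<cdot> A \<cdot> B \<cdot> C \<cdot> g \<cdot> (f \<cdot> v))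
        \<Ztypecolon> EL (C \<cdot> (K cSup \<cdot> A \<cdot> B \<cdot> x \<cdot> f)))))))),

    K cT \<cdot> K cN0u \<doteq> K cN0 \<Ztypecolon> SET,
    K cT \<cdot> K cN1u \<doteq> K cN1 \<Ztypecolon> SET,
    K cT \<cdot> K cN2u \<doteq> K cN2 \<Ztypecolon> SET,
    K cT \<cdot> K cNatu \<doteq> K cNat \<Ztypecolon> SET,
    EL (K cU) \<rhd> (\<lambda>a. K cT \<cdot> (K cListu \<cdot> a) \<doteq> K cList \<cdot> (K cT \<cdot> a) \<Ztypecolon> SET),
    EL (K cU) \<rhd> (\<lambda>a. (EL (K cT \<cdot> a) \<rightarrow> EL (K cU)) \<rhd> (\<lambda>b.
      K cT \<cdot> (K cPiu \<cdot> a \<cdot> b) \<doteq> K cPi \<cdot> (K cT \<cdot> a) \<cdot> (\<^bold>\<lambda>x. K cT \<cdot> (b \<cdot> x)) \<Ztypecolon> SET)),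
    EL (K cU) \<rhd> (\<lambda>a. (EL (K cT \<cdot> a) \<rightarrow> EL (K cU)) \<rhd> (\<lambda>b.
      K cT \<cdot> (K cSigmau \<cdot> a \<cdot> b) \<doteq> K cSigma \<cdot> (K cT \<cdot> a) \<cdot> (\<^bold>\<lambda>x. K cT \<cdot> (b \<cdot> x)) \<Ztypecolon> SET)),
    EL (K cU) \<rhd> (\<lambda>a. EL (K cU) \<rhd> (\<lambda>b.
      K cT \<cdot> (K cSumu \<cdot> a \<cdot> b) \<doteq> K cSum \<cdot> (K cT \<cdot> a) \<cdot> (K cT \<cdot> b) \<Ztypecolon> SET)),
    EL (K cU) \<rhd> (\<lambda>a. EL (K cT \<cdot> a) \<rhd> (\<lambda>x. EL (K cT \<cdot> a) \<rhd> (\<lambda>y.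
      K cT \<cdot> (K cIdu \<cdot> a \<cdot> x \<cdot> y) \<doteq> K cId \<cdot> (K cT \<cdot> a) \<cdot> x \<cdot> y \<Ztypecolon> SET))),
    EL (K cU) \<rhd> (\<lambda>a. (EL (K cT \<cdot> a) \<rightarrow> EL (K cU)) \<rhd> (\<lambda>b.
      K cT \<cdot> (K cWu \<cdot> a \<cdot> b) \<doteq> K cW \<cdot> (K cT \<cdot> a) \<cdot> (\<^bold>\<lambda>x. K cT \<cdot> (b \<cdot> x)) \<Ztypecolon> SET))}"

text \<open>
  Intensional type theory with one universe. Stronger versions, such as those with extensional
  equality sets, an eta rule for \<open>cPi\<close> or further universes, are obtained by adding axioms.
\<close>

definition CTT :: "('c ctx \<times> 'c jdg) set" where
  "CTT = (\<lambda>j. j 0 []) ` (ctt_typings \<union> ctt_equations)"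

text \<open>
  The uniformity principle quantifies over all propositions, so it is not itself a proposition.
  It is added as two constants that take any \<open>I\<close>, \<open>R\<close>, \<open>F\<close> and a proof that \<open>R(P, F(P))\<close> for all \<open>P\<close>
  to an element \<open>i\<close> of \<open>I\<close> and to a proof that \<open>R(P, i)\<close> for all \<open>P\<close>.
\<close>

definition GUP_CTT :: "('c ctx \<times> 'c jdg) set" where
  "GUP_CTT = (\<lambda>j. j 0 []) ` {
    (\<lambda>d. Const Gup_elem) \<Ztypecolon>
      SET \<Rrightarrow> (\<lambda>I. (SET \<rightarrow> EL I \<rightarrow> SET) \<Rrightarrow> (\<lambda>R. (SET \<rightarrow> EL I) \<Rrightarrow> (\<lambda>F.
        (SET \<Rrightarrow> (\<lambda>P. EL (R \<cdot> P \<cdot> (F \<cdot> P)))) \<rightarrow> EL I))),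
    (\<lambda>d. Const Gup_proof) \<Ztypecolon>
      SET \<Rrightarrow> (\<lambda>I. (SET \<rightarrow> EL I \<rightarrow> SET) \<Rrightarrow> (\<lambda>R. (SET \<rightarrow> EL I) \<Rrightarrow> (\<lambda>F.
        (SET \<Rrightarrow> (\<lambda>P. EL (R \<cdot> P \<cdot> (F \<cdot> P)))) \<Rrightarrow> (\<lambda>r.
          SET \<Rrightarrow> (\<lambda>P. EL (R \<cdot> P \<cdot> ((\<lambda>d. Const Gup_elem) \<cdot> I \<cdot> R \<cdot> F \<cdot> r)))))))}"

definition ctt_true :: "('c ctx \<times> 'c jdg) set \<Rightarrow> 'c term' \<Rightarrow> bool" where
  "ctt_true Th P \<longleftrightarrow> (\<exists>t. derives Th [] (HasTy t (TEl (P 0))))"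

definition ctt_consistent :: "('c ctx \<times> 'c jdg) set \<Rightarrow> bool" where
  "ctt_consistent Th \<longleftrightarrow> \<not> ctt_true Th (K cN0)"

subsection \<open>Set-presented relations in type theory\<close>

definition p_all :: "'c term' \<Rightarrow> ('c term' \<Rightarrow> 'c term') \<Rightarrow> 'c term'" where
  "p_all A P = K cPi \<cdot> A \<cdot> (\<^bold>\<lambda>x. P x)"

definition p_ex :: "'c term' \<Rightarrow> ('c term' \<Rightarrow> 'c term') \<Rightarrow> 'c term'" where
  "p_ex A P = K cSigma \<cdot> A \<cdot> (\<^bold>\<lambda>x. P x)"

definition p_imp :: "'c term' \<Rightarrow> 'c term' \<Rightarrow> 'c term'" (infixr "\<supset>" 60) where
  "P \<supset> Q = p_all P (\<lambda>_. Q)"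

definition p_and :: "'c term' \<Rightarrow> 'c term' \<Rightarrow> 'c term'" (infixr "\<otimes>" 65) where
  "P \<otimes> Q = p_ex P (\<lambda>_. Q)"

definition p_not :: "'c term' \<Rightarrow> 'c term'" where
  "p_not P = P \<supset> K cN0"

definition p_iff :: "'c term' \<Rightarrow> 'c term' \<Rightarrow> 'c term'" where
  "p_iff P Q = (P \<supset> Q) \<otimes> (Q \<supset> P)"

text \<open>A subset of \<open>S\<close> is a propositional function on \<open>S\<close>.\<close>

definition ctt_subset :: "'c term' \<Rightarrow> 'c term' \<Rightarrow> 'c term' \<Rightarrow> 'c term'" where
  "ctt_subset S V U = p_all S (\<lambda>u. V \<cdot> u \<supset> U \<cdot> u)"

definition ctt_set_presented ::
  "('c ctx \<times> 'c jdg) set \<Rightarrow> 'c term' \<Rightarrow> ('c term' \<Rightarrow> 'c term' \<Rightarrow> 'c term') \<Rightarrow> bool" where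
  "ctt_set_presented Th S R \<longleftrightarrow> (\<exists>I C t.
     derives Th [] (HasTy I ((EL S \<rightarrow> SET) 0)) \<and>
     derives Th [] (HasTy C ((EL S \<Rrightarrow> (\<lambda>x. EL (weaken I \<cdot> x) \<rightarrow> EL S \<rightarrow> SET)) 0)) \<and>
     derives Th [] (HasTy t ((EL S \<Rrightarrow> (\<lambda>x. (EL S \<rightarrow> SET) \<Rrightarrow> (\<lambda>U.
       EL (p_iff (R x U) (p_ex (weaken I \<cdot> x) (\<lambda>i. ctt_subset S (weaken C \<cdot> x \<cdot> i) U)))))) 0)))"

definition ctt_partial_order :: "'c term' \<Rightarrow> 'c term' \<Rightarrow> 'c term'" where
  "ctt_partial_order S le =
     p_all S (\<lambda>x. le \<cdot> x \<cdot> x) \<otimes>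
     p_all S (\<lambda>x. p_all S (\<lambda>y. p_all S (\<lambda>z. le \<cdot> x \<cdot> y \<otimes> le \<cdot> y \<cdot> z \<supset> le \<cdot> x \<cdot> z))) \<otimes>
     p_all S (\<lambda>x. p_all S (\<lambda>y. le \<cdot> x \<cdot> y \<otimes> le \<cdot> y \<cdot> x \<supset> K cId \<cdot> S \<cdot> x \<cdot> y))"

definition ctt_is_least :: "'c term' \<Rightarrow> 'c term' \<Rightarrow> 'c term' \<Rightarrow> 'c term'" where
  "ctt_is_least S le a = p_all S (\<lambda>y. le \<cdot> a \<cdot> y)"

definition ctt_is_stable :: "'c term' \<Rightarrow> 'c term' \<Rightarrow> 'c term' \<Rightarrow> 'c term'" where
  "ctt_is_stable S le a = p_all S (\<lambda>x. p_not (p_not (le \<cdot> a \<cdot> x)) \<supset> le \<cdot> a \<cdot> x)"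

definition ctt_R\<^sub>c :: "'c term' \<Rightarrow> 'c term' \<Rightarrow> 'c term' \<Rightarrow> 'c term' \<Rightarrow> 'c term'" where
  "ctt_R\<^sub>c S le x U = p_all S (\<lambda>y. p_all S (\<lambda>u. U \<cdot> u \<supset> le \<cdot> u \<cdot> y) \<supset> le \<cdot> x \<cdot> y)"

end

theory Submission
  imports Defs
begin

text \<open>
  Choose \<open>P(x)\<close> such that \<open>\<not>\<not>P(x)\<close> is provable for every \<open>x\<close>, while the uniformity
  principle refutes \<open>\<forall>x. P(x)\<close>, and put \<open>U(x) = {u \<in> S. P(x)}\<close>. Stability of \<open>a\<close> gives
  \<open>R\<^sub>c(a, U(x))\<close>. If \<open>R\<^sub>c\<close> is presented by \<open>I\<close> and \<open>C\<close>, then for every \<open>x\<close> there is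
  \<open>i \<in> I(a)\<close> with \<open>C(a, i) \<subseteq> U(x)\<close>, and by uniformity one \<open>i\<close> serves for all \<open>x\<close>. An element
  of \<open>C(a, i)\<close> would make \<open>P(x)\<close> true for all \<open>x\<close>, so \<open>C(a, i) \<subseteq> \<emptyset>\<close>. Hence
  \<open>R\<^sub>c(a, \<emptyset>)\<close>, which says that \<open>a\<close> is the least element: a contradiction.
\<close>

section \<open>Set theory\<close>

subsection \<open>Eigenvariables and growing contexts\<close>

text \<open>Uniformity needs the shape "some \<open>y\<close> in a fixed set is related to
  \<open>x\<close>", and this fixes the choice of \<open>P\<close>. In set theory
  \<open>P(x)\<close> must also be bounded, since \<open>U(x)\<close> comes from bounded separation:
  it says that \<open>x\<close> is empty iff \<open>y\<close> is not, for some \<open>y\<close> in a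
  set \<open>J\<close> containing an empty and a nonempty set. In type theory every propositional
  function is a subset, \<open>x\<close> ranges over propositions, and \<open>y\<close> ranges over
  the codes of the universe. In both cases a diagonal instance refutes a uniform \<open>y\<close>,
  while the two truth values in the range of \<open>y\<close> give the double negation.

  The condition defining \<open>U(x)\<close> does not mention the element \<open>u\<close>. So
  \<open>C(a, i) \<subseteq> U(x)\<close> says that any element of \<open>C(a, i)\<close> yields
  \<open>P(x)\<close>, and for a uniform \<open>i\<close> one element yields all \<open>P(x)\<close>
  at once. In set theory this restatement also removes the set \<open>U(x)\<close>, which depends on
  \<open>x\<close>, from the relation that uniformity is applied to.

  The type-theoretic principle demands a function from propositions to indices. It is obtained by
  reasoning in a context extended by a propositional variable: there an existential proof projects
  to a term in that variable, and abstraction gives the function.\<close>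

lemma up_simps [simp]:
  "up r 0 = 0" "up r (Suc n) = Suc (r n)" "up r (numeral k) = Suc (r (pred_numeral k))"
  by (simp_all add: up_def numeral_eq_Suc)

lemma up_comp: "up r \<circ> up s = up (r \<circ> s)"
  by (rule ext) (simp add: up_def split: nat.split)

lemma ren_ren [simp]: "ren r (ren s p) = ren (r \<circ> s) p"
  by (induction p arbitrary: r s) (simp_all add: up_comp)

lemma ren_cong: "(\<And>n. n \<in> fv p \<Longrightarrow> r n = s n) \<Longrightarrow> ren r p = ren s p"
proof (induction p arbitrary: r s)
  case (FAll p)
  have "up r n = up s n" if "n \<in> fv p" for n
    using FAll.prems that by (cases n) auto
  with FAll.IH[of "up r" "up s"] show ?case by simp
next
  case (FEx p)
  have "up r n = up s n" if "n \<in> fv p" for n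
    using FEx.prems that by (cases n) auto
  with FEx.IH[of "up r" "up s"] show ?case by simp
next
  case (Conj p q)
  from Conj.IH(1)[of r s] Conj.IH(2)[of r s] Conj.prems show ?case by simp
next
  case (Disj p q)
  from Disj.IH(1)[of r s] Disj.IH(2)[of r s] Disj.prems show ?case by simp
next
  case (Imp p q)
  from Imp.IH(1)[of r s] Imp.IH(2)[of r s] Imp.prems show ?case by simp
qed simp_all

lemma up_id: "up id = id"
  by (rule ext) (simp add: up_def split: nat.split)

lemma ren_id [simp]: "ren id p = p"
proof (induction p)
  case (FAll p)
  then show ?case by (simp only: ren.simps up_id)
next
  case (FEx p)
  then show ?case by (simp only: ren.simps up_id)
qed simp_all

lemma finite_fv [simp]: "finite (fv p)"
proof (induction p)
  case (FAll p)
  then have "finite (Suc -` fv p)" by (simp add: finite_vimageI)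
  then show ?case by (simp add: vimage_def)
next
  case (FEx p)
  then have "finite (Suc -` fv p)" by (simp add: finite_vimageI)
  then show ?case by (simp add: vimage_def)
qed auto

lemma ren_inst: "ren r (inst i p) = inst (r i) (ren (up r) p)"
  unfolding inst_def ren_ren
  by (rule ren_cong) (auto split: nat.split)

lemma image_ren_up: "ren (up r) ` ren Suc ` H = ren Suc ` ren r ` H"
proof -
  have "up r \<circ> Suc = Suc \<circ> r" by auto
  then show ?thesis by (simp add: image_image)
qed

lemma proves_mono: "H \<turnstile> p \<Longrightarrow> H \<subseteq> H' \<Longrightarrow> H' \<turnstile> p"
proof (induction arbitrary: H' rule: proves.induct)
  case (DisjE H p q r)
  from DisjE.prems have "insert p H \<subseteq> insert p H'" "insert q H \<subseteq> insert q H'" by auto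
  then show ?case using DisjE.IH DisjE.prems by (meson proves.DisjE)
next
  case (ImpI p H q)
  from ImpI.prems have "insert p H \<subseteq> insert p H'" by auto
  then show ?case using ImpI.IH by (meson proves.ImpI)
next
  case (AllI H p)
  then show ?case by (meson image_mono proves.AllI)
next
  case (ExE H p r)
  from ExE.prems have "insert p (ren Suc ` H) \<subseteq> insert p (ren Suc ` H')" by auto
  then show ?case using ExE.IH ExE.prems by (meson proves.ExE)
next
  case (EqSubst H i j p)
  then show ?case by (meson proves.EqSubst)
next
  case (AllE H p i)
  then show ?case by (meson proves.AllE)
next
  case (ExI H i p)
  then show ?case by (meson proves.ExI)
next
  case (FlsE H p)
  then show ?case by (meson proves.FlsE)
next
  case (ConjE1 H p q)
  then show ?case by (meson proves.ConjE1)
next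
  case (ConjE2 H p q)
  then show ?case by (meson proves.ConjE2)
next
  case (ImpE H p q)
  then show ?case by (meson proves.ImpE)
qed (auto intro: Hyp ConjI DisjI1 DisjI2 EqRefl)

text \<open>Any renaming is allowed, injective or not. Under a binder it is lifted by
  \<open>up\<close>, which commutes with the shift of the hypotheses in \<open>AllI\<close> and
  \<open>ExE\<close>.\<close>

lemma proves_ren: "H \<turnstile> p \<Longrightarrow> ren r ` H \<turnstile> ren r p"
proof (induction arbitrary: r rule: proves.induct)
  case (DisjE H p q s)
  from DisjE.IH(1)[of r] DisjE.IH(2)[of r] DisjE.IH(3)[of r] show ?case
    by (simp only: ren.simps image_insert) (rule proves.DisjE)
next
  case (ImpI p H q)
  from ImpI.IH[of r] show ?case by (simp add: proves.ImpI)
next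
  case (AllI H p)
  from AllI.IH[of "up r"] show ?case by (simp only: image_ren_up ren.simps proves.AllI)
next
  case (AllE H p i)
  from AllE.IH[of r] show ?case by (simp only: ren_inst ren.simps proves.AllE)
next
  case (ExI H i p)
  from ExI.IH[of r] show ?case by (simp only: ren_inst ren.simps) (rule proves.ExI)
next
  case (ExE H p s)
  have "up r \<circ> Suc = Suc \<circ> r" by auto
  then have eq: "ren (up r) (ren Suc s) = ren Suc (ren r s)" by simp
  from ExE.IH(2)[of "up r"] ExE.IH(1)[of r] show ?case
    by (simp only: image_insert image_ren_up ren.simps eq) (rule proves.ExE)
next
  case (EqSubst H i j p)
  from EqSubst.IH(1)[of r] EqSubst.IH(2)[of r] show ?case
    by (simp only: ren_inst ren.simps) (rule proves.EqSubst)
next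
  case (FlsE H p)
  from FlsE.IH[of r] show ?case by (simp add: proves.FlsE)
next
  case (ConjE1 H p q)
  from ConjE1.IH[of r] show ?case by (simp only: ren.simps) (rule proves.ConjE1)
next
  case (ConjE2 H p q)
  from ConjE2.IH[of r] show ?case by (simp only: ren.simps) (rule proves.ConjE2)
next
  case (ImpE H p q)
  from ImpE.IH(1)[of r] ImpE.IH(2)[of r] show ?case by (simp only: ren.simps) (rule proves.ImpE)
qed (auto intro: Hyp ConjI DisjI1 DisjI2 EqRefl)

text \<open>
  Only contexts with finitely many free variables are used, so that eigenvariables can be replaced
  by arbitrary variables, and contexts may grow as in a Kripke model.
\<close>

definition fin_ctx :: "fm set \<Rightarrow> bool" where
  "fin_ctx H \<longleftrightarrow> finite (\<Union> (fv ` H))"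

lemma fin_ctx_insert [simp]: "fin_ctx (insert p H) \<longleftrightarrow> fin_ctx H"
  by (simp add: fin_ctx_def)

text \<open>The disjunct \<open>infinite X\<close> stands in for a premise \<open>finite X\<close>;
  in the applications \<open>X\<close> consists of free variables of formulas, and
  \<open>finite_fv\<close> removes it.\<close>

lemma fresh_var:
  assumes "fin_ctx H"
  obtains n where "\<And>p. p \<in> H \<Longrightarrow> n \<notin> fv p" "n \<notin> X \<or> infinite X"
proof (cases "finite X")
  case True
  then have "finite (\<Union> (fv ` H) \<union> X)" using assms by (simp add: fin_ctx_def)
  then obtain n where "n \<notin> \<Union> (fv ` H) \<union> X" using ex_new_if_finite infinite_UNIV_nat by blast
  then show thesis using that by blast
next
  case False
  from assms obtain n where "n \<notin> \<Union> (fv ` H)"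
    using ex_new_if_finite infinite_UNIV_nat unfolding fin_ctx_def by blast
  then show thesis using that False by blast
qed

text \<open>This renaming sends \<open>n\<close> to 0 and shifts everything else, so a formula
  without \<open>n\<close> cannot tell it from \<open>Suc\<close>. It turns a derivation about a
  fresh variable \<open>n\<close> into the premise that \<open>AllI\<close> and \<open>ExE\<close>
  ask for, with index 0 as eigenvariable.\<close>

lemma ren_fresh: "n \<notin> fv p \<Longrightarrow> ren (\<lambda>m. if m = n then 0 else Suc m) p = ren Suc p"
  by (rule ren_cong) auto

lemma image_ren_fresh:
  "(\<And>p. p \<in> H \<Longrightarrow> n \<notin> fv p) \<Longrightarrow> ren (\<lambda>m. if m = n then 0 else Suc m) ` H = ren Suc ` H"
  by (rule image_cong) (auto intro: ren_fresh)

lemma ren_inst_fresh: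
  assumes "n \<notin> fv (FAll p)"
  shows "ren (\<lambda>m. if m = n then 0 else Suc m) (inst n p) = p"
proof -
  have "ren (\<lambda>m. if m = n then 0 else Suc m) (inst n p) = ren id p"
    unfolding inst_def ren_ren by (rule ren_cong) (use assms in \<open>auto split: nat.split\<close>)
  then show ?thesis by simp
qed

text \<open>The quantifier over \<open>n\<close> in the premise replaces the eigenvariable: the
  proof picks one fresh \<open>n\<close> and renames it to index 0. Hypotheses therefore need no
  shift when the rule is applied.\<close>

lemma AllI_fresh:
  assumes fin: "fin_ctx H" and p: "\<And>n. H \<turnstile> inst n p"
  shows "H \<turnstile> FAll p"
proof -
  obtain n where n: "\<And>q. q \<in> H \<Longrightarrow> n \<notin> fv q" "n \<notin> fv (FAll p)"
    using fresh_var[OF fin, of "fv (FAll p)"] finite_fv by metis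
  from proves_ren[OF p[of n], of "\<lambda>m. if m = n then 0 else Suc m"]
  show ?thesis by (simp only: image_ren_fresh[OF n(1)] ren_inst_fresh[OF n(2)] proves.AllI)
qed

text \<open>Continuation form of existential elimination: the witness may be any variable and the
  context any larger one, of which the proof uses \<open>insert (inst n p) H\<close> with
  \<open>n\<close> fresh.\<close>

lemma ExE_fresh:
  assumes fin: "fin_ctx H" and ex: "H \<turnstile> FEx p"
    and r: "\<And>n H'. H \<subseteq> H' \<Longrightarrow> fin_ctx H' \<Longrightarrow> H' \<turnstile> inst n p \<Longrightarrow> H' \<turnstile> r"
  shows "H \<turnstile> r"
proof -
  obtain n where n: "\<And>q. q \<in> H \<Longrightarrow> n \<notin> fv q" "n \<notin> fv (FAll p) \<union> fv r"
    using fresh_var[OF fin, of "fv (FAll p) \<union> fv r"] finite_fv by (metis finite_UnI)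
  have "insert (inst n p) H \<turnstile> r"
    using fin by (intro r) (auto intro: proves.Hyp)
  from n(2) have "n \<notin> fv (FAll p)" and "n \<notin> fv r" by auto
  then have "insert p (ren Suc ` H) \<turnstile> ren Suc r"
    using proves_ren[OF \<open>insert (inst n p) H \<turnstile> r\<close>, of "\<lambda>m. if m = n then 0 else Suc m"]
    by (simp only: image_insert image_ren_fresh[OF n(1)] ren_inst_fresh[OF \<open>n \<notin> fv (FAll p)\<close>]
        ren_fresh[OF \<open>n \<notin> fv r\<close>] simp_thms)
  with ex show ?thesis by (rule proves.ExE)
qed

text \<open>The forcing clause for implication in a Kripke model whose worlds are contexts;
  \<open>proves_mono\<close> is its persistence.\<close>

lemma ImpI_ext:
  assumes "fin_ctx H" and "\<And>H'. H \<subseteq> H' \<Longrightarrow> fin_ctx H' \<Longrightarrow> H' \<turnstile> p \<Longrightarrow> H' \<turnstile> q"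
  shows "H \<turnstile> Imp p q"
  using assms(1) by (intro proves.ImpI assms(2)) (auto intro: proves.Hyp)

definition Iff :: "fm \<Rightarrow> fm \<Rightarrow> fm" where
  "Iff p q = Conj (Imp p q) (Imp q p)"

lemma ren_Iff [simp]: "ren r (Iff p q) = Iff (ren r p) (ren r q)"
  by (simp add: Iff_def)

lemma Iff_D1: "H \<turnstile> Iff p q \<Longrightarrow> H \<turnstile> p \<Longrightarrow> H \<turnstile> q"
  and Iff_D2: "H \<turnstile> Iff p q \<Longrightarrow> H \<turnstile> q \<Longrightarrow> H \<turnstile> p"
  unfolding Iff_def by (blast intro: ImpE ConjE1, blast intro: ImpE ConjE2)

text \<open>The renamed instance enters through an equation, because unification cannot recover
  \<open>p\<close> from the normal form of \<open>inst i p\<close>; the equation is left to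
  simplification. The rules below follow the same pattern.\<close>

lemma All_inst: "H \<turnstile> FAll p \<Longrightarrow> inst i p = q \<Longrightarrow> H \<turnstile> q"
  using AllE[of H p i] by simp

lemma Ex_inst: "H \<turnstile> q \<Longrightarrow> inst i p = q \<Longrightarrow> H \<turnstile> FEx p"
  using ExI[of H i p] by simp

lemma Eq_subst: "H \<turnstile> Eq i j \<Longrightarrow> H \<turnstile> q \<Longrightarrow> inst i p = q \<Longrightarrow> inst j p = q' \<Longrightarrow> H \<turnstile> q'"
  using EqSubst[of H i j p] by simp

lemma Eq_sym: "H \<turnstile> Eq i j \<Longrightarrow> H \<turnstile> Eq j i"
  using Eq_subst[of H i j "Eq i i" "Eq 0 (Suc i)" "Eq j i"] EqRefl[of H i] by (simp add: inst_def)

text \<open>The values of \<open>r\<close> below \<open>n\<close> are the chosen instances, hence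
  unconstrained; above \<open>n\<close> the removal of \<open>n\<close> binders dictates
  \<open>k - n\<close>.\<close>

lemma FAll_pow_instance:
  "H \<turnstile> (FAll ^^ n) p \<Longrightarrow> (\<And>k. k \<in> fv p \<Longrightarrow> k \<ge> n \<Longrightarrow> r k = k - n) \<Longrightarrow> H \<turnstile> ren r p"
proof (induction n arbitrary: p r)
  case 0
  then have "ren r p = ren id p" by (intro ren_cong) auto
  with 0 show ?case by simp
next
  case (Suc n)
  \<comment> \<open>The substitution for the outer \<open>n\<close> quantifiers. It omits index 0,
    whose value \<open>r 0\<close> is supplied by the one remaining \<open>AllE\<close>.\<close>
  define s where "s k = (if k < n then r (Suc k) else k - n)" for k
  have "H \<turnstile> (FAll ^^ n) (FAll p)" using Suc.prems(1) by (simp add: funpow_swap1)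
  then have "H \<turnstile> ren s (FAll p)" by (rule Suc.IH) (simp add: s_def)
  then have "H \<turnstile> inst (r 0) (ren (up s) p)" using AllE by simp
  moreover have "inst (r 0) (ren (up s) p) = ren r p"
    unfolding inst_def ren_ren
    by (rule ren_cong) (use Suc.prems(2) in \<open>auto simp: s_def up_def split: nat.split\<close>)
  ultimately show ?case by simp
qed

subsection \<open>Instances of the axioms of set theory\<close>

lemma fv_FAll_pow: "fv ((FAll ^^ n) p) = {k. k + n \<in> fv p}"
  by (induction n) auto

text \<open>With \<open>n\<close> above all parameters of \<open>P 0\<close>, every free variable
  lies below \<open>n\<close>, so the renaming \<open>r\<close> is completely arbitrary.\<close>

lemma closures_instance:
  assumes "closures P \<subseteq> H"
  shows "H \<turnstile> ren r (P 0)"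
proof -
  obtain n where n: "fv (P 0) \<subseteq> {..<n}"
    using finite_nat_set_iff_bounded[of "fv (P 0)"] finite_fv by auto
  then have "(FAll ^^ n) (P 0) \<in> closures P"
    unfolding closures_def by (auto simp: fv_FAll_pow)
  then have "H \<turnstile> (FAll ^^ n) (P 0)" using assms by (auto intro: Hyp)
  then show ?thesis by (rule FAll_pow_instance) (use n in auto)
qed

lemma f_iff_Iff: "(P \<^bold>\<longleftrightarrow> Q) d = Iff (P d) (Q d)"
  by (simp add: f_iff_def f_and_def f_imp_def Iff_def)

lemmas form_simps = f_bot_def f_mem_def f_eq_def f_and_def f_or_def f_imp_def f_all_def f_ex_def
  f_not_def f_iff_Iff

lemma at_vars_1: "at_vars p [x] d = ren (case_nat (x d) (\<lambda>n. n + d)) p"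
  unfolding at_vars_def by (rule ren_cong) (auto split: nat.split)

lemma at_vars_2: "at_vars p [x, y] d = ren (case_nat (x d) (case_nat (y d) (\<lambda>n. n + d))) p"
  unfolding at_vars_def by (rule ren_cong) (auto split: nat.split)

lemma ren_eqI: "(\<And>n. r n = s n) \<Longrightarrow> ren r p = ren s p"
  by (rule ren_cong)

text \<open>The axiom as an elimination rule: the separated set is handed over as a variable
  \<open>b\<close> in a larger context. Index 0 of \<open>p\<close> is the element, and
  \<open>r\<close> gives the values of the parameters.\<close>

lemma separation_rule:
  assumes "CZF \<subseteq> H" "fin_ctx H" "bounded_fm p"
    and b: "\<And>b H'. H \<subseteq> H' \<Longrightarrow> fin_ctx H' \<Longrightarrow>
      (\<And>x. H' \<turnstile> Iff (Mem x b) (Conj (Mem x a) (ren (case_nat x r) p))) \<Longrightarrow> H' \<turnstile> q"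
  shows "H \<turnstile> q"
proof -
  have "closures (ax_separation p) \<subseteq> H" using assms unfolding CZF_def by auto
  from closures_instance[OF this, of r]
  have "H \<turnstile> FAll (FEx (FAll (Iff (Mem 0 (Suc 0)) (Conj (Mem 0 (Suc (Suc 0)))
      (ren (up (up (up r)) \<circ> case_nat 0 (\<lambda>n. Suc (Suc (Suc n)))) p)))))"
    by (simp add: ax_separation_def form_simps at_vars_1 numeral_3_eq_3)
  from AllE[OF this, of a]
  have "H \<turnstile> FEx (FAll (Iff (Mem 0 (Suc 0)) (Conj (Mem 0 (Suc (Suc a)))
      (ren (case_nat 0 (\<lambda>n. Suc (Suc (r n)))) p))))"
    by (simp add: inst_def) (erule back_subst, intro arg_cong[where f = FEx] arg_cong[where f = FAll]
      arg_cong2[where f = Iff] arg_cong2[where f = Conj] refl ren_eqI, simp split: nat.split)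
  then show ?thesis
  proof (rule ExE_fresh[OF \<open>fin_ctx H\<close>])
    fix b H' assume H': "H \<subseteq> H'" "fin_ctx H'"
      and ex: "H' \<turnstile> inst b (FAll (Iff (Mem 0 (Suc 0)) (Conj (Mem 0 (Suc (Suc a)))
        (ren (case_nat 0 (\<lambda>n. Suc (Suc (r n)))) p))))"
    show "H' \<turnstile> q"
    proof (rule b[OF H'])
      fix x
      from ex have "H' \<turnstile> inst x (ren (up (case_nat b id)) (Iff (Mem 0 (Suc 0)) (Conj (Mem 0 (Suc (Suc a)))
        (ren (case_nat 0 (\<lambda>n. Suc (Suc (r n)))) p))))"
        by (intro AllE) (simp add: inst_def)
      also have "inst x (ren (up (case_nat b id)) (Iff (Mem 0 (Suc 0)) (Conj (Mem 0 (Suc (Suc a)))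
        (ren (case_nat 0 (\<lambda>n. Suc (Suc (r n)))) p)))) = Iff (Mem x b) (Conj (Mem x a) (ren (case_nat x r) p))"
        by (simp add: inst_def) (intro arg_cong2[where f = Iff] arg_cong2[where f = Conj] refl ren_eqI,
          simp split: nat.split)
      finally show "H' \<turnstile> \<dots>" .
    qed
  qed
qed

text \<open>Used twice: from an empty set \<open>e\<close> it produces a set \<open>o'\<close>
  containing \<open>e\<close>, and then a set \<open>J\<close> containing \<open>e\<close> and
  \<open>o'\<close>, the two truth values for \<open>Decided\<close>.\<close>

lemma pairing_rule:
  assumes "CZF \<subseteq> H" "fin_ctx H"
    and c: "\<And>c H'. H \<subseteq> H' \<Longrightarrow> fin_ctx H' \<Longrightarrow> H' \<turnstile> Mem a c \<Longrightarrow> H' \<turnstile> Mem b c \<Longrightarrow> H' \<turnstile> q"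
  shows "H \<turnstile> q"
proof -
  have "closures ax_pairing \<subseteq> H" using assms unfolding CZF_def by auto
  from closures_instance[OF this, of id]
  have "H \<turnstile> FAll (FAll (FEx (FAll (Iff (Mem 0 (Suc 0))
      (Disj (Eq 0 (Suc (Suc (Suc 0)))) (Eq 0 (Suc (Suc 0))))))))"
    by (simp add: ax_pairing_def form_simps)
  from AllE[OF this, of a]
  have "H \<turnstile> FAll (FEx (FAll (Iff (Mem 0 (Suc 0))
      (Disj (Eq 0 (Suc (Suc (Suc a)))) (Eq 0 (Suc (Suc 0)))))))"
    by (simp add: inst_def)
  from AllE[OF this, of b]
  have "H \<turnstile> FEx (FAll (Iff (Mem 0 (Suc 0)) (Disj (Eq 0 (Suc (Suc a))) (Eq 0 (Suc (Suc b))))))"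
    by (simp add: inst_def)
  then show ?thesis
  proof (rule ExE_fresh[OF \<open>fin_ctx H\<close>])
    fix c H' assume H': "H \<subseteq> H'" "fin_ctx H'"
      and "H' \<turnstile> inst c (FAll (Iff (Mem 0 (Suc 0)) (Disj (Eq 0 (Suc (Suc a))) (Eq 0 (Suc (Suc b))))))"
    then have "H' \<turnstile> FAll (Iff (Mem 0 (Suc c)) (Disj (Eq 0 (Suc a)) (Eq 0 (Suc b))))"
      by (simp add: inst_def)
    then have *: "H' \<turnstile> Iff (Mem x c) (Disj (Eq x a) (Eq x b))" for x
      by (rule All_inst[where i = x]) (simp add: inst_def)
    show "H' \<turnstile> q"
      by (rule c[OF H' Iff_D2[OF *[of a] DisjI1[OF EqRefl]] Iff_D2[OF *[of b] DisjI2[OF EqRefl]]])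
  qed
qed

text \<open>In \<open>p\<close>, index 0 is the universally quantified set, index 1 the element of
  \<open>I\<close>, and the later indices are parameters valued by \<open>r\<close>. The premise is
  stated for each variable \<open>x\<close>; \<open>AllI_fresh\<close> makes it a quantified
  formula.\<close>

lemma GUP_rule:
  assumes "GUP_CZF \<subseteq> H" "fin_ctx H"
    and all: "\<And>x. H \<turnstile> FEx (Conj (Mem 0 (Suc I)) (ren (case_nat (Suc x) (case_nat 0 (\<lambda>n. Suc (r n)))) p))"
    and b: "\<And>i H'. H \<subseteq> H' \<Longrightarrow> fin_ctx H' \<Longrightarrow> H' \<turnstile> Mem i I \<Longrightarrow>
      (\<And>x. H' \<turnstile> ren (case_nat x (case_nat i r)) p) \<Longrightarrow> H' \<turnstile> q"
  shows "H \<turnstile> q"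
proof -
  let ?A = "\<lambda>i s. Conj (Mem 0 (Suc i)) s"
  have "closures (\<^bold>\<forall>I. (\<^bold>\<forall>x. \<^bold>\<exists>y. y \<^bold>\<in> I \<^bold>\<and> at_vars p [x, y]) \<^bold>\<longrightarrow>
      (\<^bold>\<exists>y. y \<^bold>\<in> I \<^bold>\<and> (\<^bold>\<forall>x. at_vars p [x, y]))) \<subseteq> H"
    using assms(1) unfolding GUP_CZF_def by auto
  from closures_instance[OF this, of r]
  have "H \<turnstile> FAll (Imp
      (FAll (FEx (?A (Suc 0) (ren (up (up (up r)) \<circ> case_nat (Suc 0) (case_nat 0 (\<lambda>n. Suc (Suc (Suc n))))) p))))
      (FEx (?A 0 (FAll (ren (up (up (up r)) \<circ> case_nat 0 (case_nat (Suc 0) (\<lambda>n. Suc (Suc (Suc n))))) p)))))"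
    by (simp add: form_simps at_vars_2 numeral_3_eq_3)
  from AllE[OF this, of I]
  have imp: "H \<turnstile> Imp
      (FAll (FEx (?A (Suc I) (ren (case_nat (Suc 0) (case_nat 0 (\<lambda>n. Suc (Suc (r n))))) p))))
      (FEx (?A I (FAll (ren (case_nat 0 (case_nat (Suc 0) (\<lambda>n. Suc (Suc (r n))))) p))))"
    by (simp add: inst_def) (erule back_subst, intro arg_cong2[where f = Imp]
      arg_cong[where f = FEx] arg_cong[where f = FAll]
      arg_cong2[where f = Conj] refl ren_eqI; simp split: nat.split)
  have "H \<turnstile> FAll (FEx (?A (Suc I) (ren (case_nat (Suc 0) (case_nat 0 (\<lambda>n. Suc (Suc (r n))))) p)))"
  proof (rule AllI_fresh[OF \<open>fin_ctx H\<close>])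
    fix x
    have "inst x (FEx (?A (Suc I) (ren (case_nat (Suc 0) (case_nat 0 (\<lambda>n. Suc (Suc (r n))))) p))) =
      FEx (?A I (ren (case_nat (Suc x) (case_nat 0 (\<lambda>n. Suc (r n)))) p))"
      by (simp add: inst_def) (rule ren_eqI, simp split: nat.split)
    with all[of x] show "H \<turnstile> inst x (FEx (?A (Suc I) (ren (case_nat (Suc 0) (case_nat 0 (\<lambda>n. Suc (Suc (r n))))) p)))"
      by simp
  qed
  from ImpE[OF imp this] show ?thesis
  proof (rule ExE_fresh[OF \<open>fin_ctx H\<close>])
    fix i H' assume H': "H \<subseteq> H'" "fin_ctx H'"
      and "H' \<turnstile> inst i (?A I (FAll (ren (case_nat 0 (case_nat (Suc 0) (\<lambda>n. Suc (Suc (r n))))) p)))"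
    then have *: "H' \<turnstile> Conj (Mem i I) (FAll (ren (up (case_nat i id) \<circ> case_nat 0 (case_nat (Suc 0) (\<lambda>n. Suc (Suc (r n))))) p))"
      by (simp add: inst_def)
    show "H' \<turnstile> q"
    proof (rule b[OF H' ConjE1[OF *]])
      fix x
      show "H' \<turnstile> ren (case_nat x (case_nat i r)) p"
        by (rule All_inst[OF ConjE2[OF *], of x]) (simp add: inst_def, rule ren_eqI, simp split: nat.split)
    qed
  qed
qed

section \<open>Deciding emptiness: doubly negated always, never uniformly\<close>

definition Empty :: "nat \<Rightarrow> fm" where
  "Empty x = FAll (Imp (Mem 0 (Suc x)) Fls)"

lemma ren_Empty [simp]: "ren r (Empty x) = Empty (r x)"
  by (simp add: Empty_def)

lemma bounded_Empty [simp]: "bounded_fm (Empty x)"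
  unfolding Empty_def by (intro bounded_fm.intros)

lemma Empty_D: "H \<turnstile> Empty x \<Longrightarrow> H \<turnstile> Mem z x \<Longrightarrow> H \<turnstile> p"
proof -
  assume "H \<turnstile> Empty x" "H \<turnstile> Mem z x"
  moreover have "H \<turnstile> Imp (Mem z x) Fls"
    by (rule All_inst[OF \<open>H \<turnstile> Empty x\<close>[unfolded Empty_def], of z]) (simp add: inst_def)
  ultimately show ?thesis by (meson ImpE FlsE)
qed

text \<open>
  For \<open>J = {\<emptyset>, {\<emptyset>}}\<close> this is a bounded form of excluded middle for the emptiness of \<open>x\<close>, chosen so
  that putting \<open>x := y\<close> refutes a uniform \<open>y\<close>.
\<close>

definition Decided :: "nat \<Rightarrow> nat \<Rightarrow> fm" where
  "Decided J x = FEx (Conj (Mem 0 (Suc J)) (Iff (Empty (Suc x)) (Imp (Empty 0) Fls)))"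

lemma ren_Decided [simp]: "ren r (Decided J x) = Decided (r J) (r x)"
  by (simp add: Decided_def)

lemma bounded_Decided [simp]: "bounded_fm (Decided J x)"
  unfolding Decided_def Iff_def by (intro bounded_fm.intros bounded_Empty)

text \<open>Uniformity over \<open>J\<close> yields one \<open>i\<close> such that every
  \<open>x\<close> is empty iff \<open>i\<close> is not. The instance \<open>x := i\<close> is an
  equivalence of a formula with its own negation.\<close>

lemma not_all_Decided:
  assumes "GUP_CZF \<subseteq> H" "fin_ctx H" and all: "\<And>x. H \<turnstile> Decided J x"
  shows "H \<turnstile> Fls"
proof (rule GUP_rule[OF assms(1,2), of J id "Iff (Empty 0) (Imp (Empty (Suc 0)) Fls)"])
  show "H \<turnstile> FEx (Conj (Mem 0 (Suc J))
      (ren (case_nat (Suc x) (case_nat 0 (\<lambda>n. Suc (id n)))) (Iff (Empty 0) (Imp (Empty (Suc 0)) Fls))))" for x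
    using all[of x] by (simp add: Decided_def)
next
  fix i H' assume "fin_ctx H'"
    and "\<And>x. H' \<turnstile> ren (case_nat x (case_nat i id)) (Iff (Empty 0) (Imp (Empty (Suc 0)) Fls))"
  from this(2)[of i] have iff: "H' \<turnstile> Iff (Empty i) (Imp (Empty i) Fls)" by simp
  have "H' \<turnstile> Imp (Empty i) Fls"
    using \<open>fin_ctx H'\<close> proves_mono[OF iff] by (intro ImpI_ext) (meson Iff_D1 ImpE)+
  with iff show "H' \<turnstile> Fls" by (meson Iff_D2 ImpE)
qed

text \<open>If \<open>x\<close> were empty, the nonempty \<open>o'\<close> would witness
  \<open>Decided J x\<close>. So \<open>x\<close> is not empty, but then \<open>e\<close> is a
  witness, both sides of the equivalence being false.\<close>

lemma not_not_Decided:
  assumes fin: "fin_ctx H" and e: "H \<turnstile> Mem e J" "H \<turnstile> Empty e"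
    and o: "H \<turnstile> Mem o' J" "H \<turnstile> Mem e o'" and no: "H \<turnstile> Imp (Decided J x) Fls"
  shows "H \<turnstile> Fls"
proof -
  have Decided: "H' \<turnstile> Decided J x" if "H' \<turnstile> Mem y J" "H' \<turnstile> Iff (Empty x) (Imp (Empty y) Fls)" for H' y
    unfolding Decided_def by (rule Ex_inst[OF ConjI[OF that]]) (simp add: inst_def)
  have "H \<turnstile> Imp (Empty x) Fls"
  proof (rule ImpI_ext[OF fin])
    fix H' assume H': "H \<subseteq> H'" "fin_ctx H'" "H' \<turnstile> Empty x"
    have "H' \<turnstile> Imp (Empty o') Fls"
      using H' proves_mono[OF o(2)] by (intro ImpI_ext) (meson Empty_D order_trans)+
    then have "H' \<turnstile> Iff (Empty x) (Imp (Empty o') Fls)"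
      unfolding Iff_def using H'(2) proves_mono[OF \<open>H' \<turnstile> Imp (Empty o') Fls\<close>] proves_mono[OF H'(3)]
      by (intro ConjI) (intro ImpI_ext[of H']; simp)+
    then show "H' \<turnstile> Fls"
      using Decided proves_mono[OF o(1)] proves_mono[OF no] H' by (meson ImpE)
  qed
  then have "H \<turnstile> Iff (Empty x) (Imp (Empty e) Fls)"
    unfolding Iff_def using fin proves_mono[OF e(2)]
    by (intro ConjI) (intro ImpI_ext[OF fin], meson ImpE FlsE proves_mono)+
  then show ?thesis using Decided e(1) no by (meson ImpE)
qed

subsection \<open>Set-presentations as formulas\<close>

text \<open>This and the following definitions restate the named notions as functions of indices.
  Renaming then acts on the arguments alone, and instantiating a quantifier becomes a
  computation.\<close>

definition Maps :: "nat \<Rightarrow> nat \<Rightarrow> nat \<Rightarrow> fm" where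
  "Maps f x v = maps_to (\<lambda>d. d + f) (\<lambda>d. d + x) (\<lambda>d. d + v) 0"

definition Family :: "nat \<Rightarrow> nat \<Rightarrow> fm" where
  "Family f A = is_family (\<lambda>d. d + f) (\<lambda>d. d + A) 0"

text \<open>Every index other than 0 is sent to \<open>j\<close>. For
  \<open>fv \<phi> \<subseteq> {0, 1}\<close> this is the intended substitution, and it commutes
  with renaming for every \<open>\<phi>\<close>.\<close>

definition le_fm :: "fm \<Rightarrow> nat \<Rightarrow> nat \<Rightarrow> fm" where
  "le_fm \<phi> i j = ren (case_nat i (\<lambda>_. j)) \<phi>"

definition Subset :: "nat \<Rightarrow> nat \<Rightarrow> fm" where
  "Subset U S = FAll (Imp (Mem 0 (Suc U)) (Mem 0 (Suc S)))"

definition Rc :: "fm \<Rightarrow> nat \<Rightarrow> nat \<Rightarrow> nat \<Rightarrow> fm" where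
  "Rc \<phi> S x U = FAll (Imp (Mem 0 (Suc S))
     (Imp (FAll (Imp (Mem 0 (Suc (Suc U))) (le_fm \<phi> 0 (Suc 0)))) (le_fm \<phi> (Suc x) 0)))"

text \<open>Here \<open>k\<close> and \<open>D\<close> are to be values of the presenting families
  at a point, whereas \<open>Covers_at\<close> quantifies over those values.\<close>

definition Covers :: "nat \<Rightarrow> nat \<Rightarrow> nat \<Rightarrow> fm" where
  "Covers D k U = FEx (Conj (Mem 0 (Suc k))
     (FEx (Conj (Maps (Suc (Suc D)) (Suc 0) 0) (Subset 0 (Suc (Suc U))))))"

definition Covers_at :: "nat \<Rightarrow> nat \<Rightarrow> nat \<Rightarrow> nat \<Rightarrow> fm" where
  "Covers_at I C x U = FEx (FEx (Conj (Maps (Suc (Suc I)) (Suc (Suc x)) (Suc 0))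
     (Conj (Maps (Suc (Suc C)) (Suc (Suc x)) 0) (Covers 0 (Suc 0) (Suc (Suc U))))))"

definition Families :: "nat \<Rightarrow> nat \<Rightarrow> nat \<Rightarrow> fm" where
  "Families S I C = FAll (Imp (Mem 0 (Suc S)) (FAll (FAll (Imp
     (Conj (Maps (I + 3) 2 1) (Maps (C + 3) 2 0))
     (Conj (Family 0 1) (FAll (FAll (Imp (Conj (Mem 1 3) (Maps 2 1 0)) (Subset 0 (S + 5))))))))))"

definition Presents :: "fm \<Rightarrow> nat \<Rightarrow> nat \<Rightarrow> nat \<Rightarrow> fm" where
  "Presents \<phi> S I C = FAll (Imp (Mem 0 (Suc S)) (FAll (Imp (Subset 0 (Suc (Suc S)))
     (Iff (Rc \<phi> (Suc (Suc S)) (Suc 0) 0) (Covers_at (Suc (Suc I)) (Suc (Suc C)) (Suc 0) 0)))))"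

definition Set_presented :: "fm \<Rightarrow> nat \<Rightarrow> fm" where
  "Set_presented \<phi> S = FEx (FEx (Conj (Family (Suc 0) (Suc (Suc S))) (Conj (Family 0 (Suc (Suc S)))
     (Conj (Families (Suc (Suc S)) (Suc 0) 0) (Presents \<phi> (Suc (Suc S)) (Suc 0) 0)))))"

text \<open>The offset 3 counts the binders for the pair, for its element, and for the element of
  that element.\<close>

lemma Maps_unfold: "Maps f x v = FEx (Conj (FAll (Iff (Mem 0 (Suc 0)) (Disj
    (FAll (Iff (Mem 0 (Suc 0)) (Disj (Eq 0 (x + 3)) (Eq 0 (x + 3)))))
    (FAll (Iff (Mem 0 (Suc 0)) (Disj (Eq 0 (x + 3)) (Eq 0 (v + 3))))))))
    (Mem 0 (Suc f)))"
  by (simp add: Maps_def maps_to_def is_pair_def is_upair_def form_simps eval_nat_numeral)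

lemma ren_Maps [simp]: "ren r (Maps f x v) = Maps (r f) (r x) (r v)"
  by (simp add: Maps_unfold eval_nat_numeral)

text \<open>From depth \<open>d\<close> on, \<open>X\<close> denotes the variable whose index at depth \<open>d\<close> is \<open>x\<close>.\<close>

definition var_at :: "nat \<Rightarrow> nat \<Rightarrow> var \<Rightarrow> bool" where
  "var_at d x X \<longleftrightarrow> (\<forall>k. X (d + k) = x + k)"

lemma var_at_Suc: "var_at d x X \<Longrightarrow> var_at (Suc d) (Suc x) X"
  unfolding var_at_def by (metis add_Suc add_Suc_shift)

lemma var_at_D: "var_at d x X \<Longrightarrow> X d = x"
  unfolding var_at_def by (metis add_0_right)

lemma var_at_bound: "var_at (Suc d) 0 (\<lambda>d'. d' - Suc d)"
  by (simp add: var_at_def)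

lemma var_at_add: "var_at 0 x (\<lambda>d. d + x)"
  by (simp add: var_at_def)

lemmas var_at_Ds = var_at_D var_at_D[OF var_at_Suc] var_at_D[OF var_at_Suc[OF var_at_Suc]]
  var_at_D[OF var_at_Suc[OF var_at_Suc[OF var_at_Suc]]]

lemma maps_to_Maps:
  assumes "var_at d f X" "var_at d x Y" "var_at d v Z"
  shows "maps_to X Y Z d = Maps f x v"
  using assms[THEN var_at_D] assms[THEN var_at_D[OF var_at_Suc]]
    assms[THEN var_at_D[OF var_at_Suc[OF var_at_Suc]]]
    assms[THEN var_at_D[OF var_at_Suc[OF var_at_Suc[OF var_at_Suc]]]]
  by (simp add: Maps_unfold maps_to_def is_pair_def is_upair_def form_simps eval_nat_numeral)

lemma is_family_Family:
  assumes "var_at d f X" "var_at d A Y"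
  shows "is_family X Y d = Family f A"
  using assms[THEN var_at_D] assms[THEN var_at_D[OF var_at_Suc]]
    assms[THEN var_at_D[OF var_at_Suc[OF var_at_Suc]]]
    assms[THEN var_at_D[OF var_at_Suc[OF var_at_Suc[OF var_at_Suc]]]]
    assms[THEN var_at_D[OF var_at_Suc[OF var_at_Suc[OF var_at_Suc[OF var_at_Suc]]]]]
  by (simp add: Family_def is_family_def f_ex1_def maps_to_def is_pair_def is_upair_def form_simps eval_nat_numeral)

lemma ren_Family [simp]: "ren r (Family f A) = Family (r f) (r A)"
  by (simp add: Family_def is_family_def f_ex1_def maps_to_def is_pair_def is_upair_def form_simps eval_nat_numeral)

lemma f_subset_Subset: "var_at d U X \<Longrightarrow> var_at d S Y \<Longrightarrow> (X \<^bold>\<subseteq> Y) d = Subset U S"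
  using var_at_Ds by (simp add: f_subset_def Subset_def form_simps)

lemma ren_Subset [simp]: "ren r (Subset U S) = Subset (r U) (r S)"
  by (simp add: Subset_def)

lemma ren_le_fm [simp]: "ren r (le_fm \<phi> i j) = le_fm \<phi> (r i) (r j)"
  unfolding le_fm_def ren_ren by (rule ren_eqI) (simp split: nat.split)

lemma at_vars_le:
  assumes "fv \<phi> \<subseteq> {0, 1}"
  shows "at_vars \<phi> [x, y] d = le_fm \<phi> (x d) (y d)"
  unfolding at_vars_2 le_fm_def using assms by (intro ren_cong) (auto split: nat.split)

lemma ren_Rc [simp]: "ren r (Rc \<phi> S x U) = Rc \<phi> (r S) (r x) (r U)"
  by (simp add: Rc_def)

lemma R\<^sub>c_Rc:
  assumes "fv \<phi> \<subseteq> {0, 1}" "var_at d s S" "var_at d x X" "var_at d u U"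
  shows "R\<^sub>c S (\<lambda>x y. at_vars \<phi> [x, y]) X U d = Rc \<phi> s x u"
  using assms(2-)[THEN var_at_D[OF var_at_Suc]] assms(2-)[THEN var_at_D[OF var_at_Suc[OF var_at_Suc]]]
  by (simp add: R\<^sub>c_def Rc_def at_vars_le[OF assms(1)] form_simps)

lemma ren_Covers [simp]: "ren r (Covers D k U) = Covers (r D) (r k) (r U)"
  by (simp add: Covers_def)

lemma ren_Covers_at [simp]: "ren r (Covers_at I C x U) = Covers_at (r I) (r C) (r x) (r U)"
  by (simp add: Covers_at_def)

lemma ren_Families [simp]: "ren r (Families S I C) = Families (r S) (r I) (r C)"
  by (simp add: Families_def eval_nat_numeral)

lemma ren_Presents [simp]: "ren r (Presents \<phi> S I C) = Presents \<phi> (r S) (r I) (r C)"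
  by (simp add: Presents_def)

text \<open>Each quantifier crossed shifts the variables in scope by \<open>var_at_Suc\<close> and
  introduces its own by \<open>var_at_bound\<close>; what remains are the translations of the
  constituents.\<close>

lemma set_presented_Set_presented:
  assumes "fv \<phi> \<subseteq> {0, 1}" "var_at d s S"
  shows "set_presented S (R\<^sub>c S (\<lambda>x y. at_vars \<phi> [x, y])) d = Set_presented \<phi> s"
proof -
  note v = var_at_bound var_at_Suc assms(2)
  show ?thesis
    unfolding set_presented_def Set_presented_def Families_def Presents_def Covers_at_def Covers_def form_simps
    by (simp add: maps_to_Maps is_family_Family f_subset_Subset R\<^sub>c_Rc[OF assms(1)] v eval_nat_numeral
       var_at_Ds[OF assms(2)] Iff_def)
qed

section \<open>Introduction and elimination rules for the encoded notions\<close>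

lemma All_ImpD:
  assumes "H \<turnstile> FAll (Imp p q)" "inst x p = p'" "inst x q = q'" "H \<turnstile> p'"
  shows "H \<turnstile> q'"
proof -
  have "H \<turnstile> Imp p' q'"
    by (rule All_inst[OF assms(1), of x]) (use assms(2,3) in \<open>simp add: inst_def\<close>)
  with assms(4) show ?thesis by (rule ImpE[rotated])
qed

lemma All_ImpI:
  assumes "fin_ctx H"
    and "\<And>x H'. H \<subseteq> H' \<Longrightarrow> fin_ctx H' \<Longrightarrow> H' \<turnstile> inst x p \<Longrightarrow> H' \<turnstile> inst x q"
  shows "H \<turnstile> FAll (Imp p q)"
proof (rule AllI_fresh[OF assms(1)])
  fix x
  have "H \<turnstile> Imp (inst x p) (inst x q)" by (rule ImpI_ext[OF assms(1)]) (rule assms(2))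
  then show "H \<turnstile> inst x (Imp p q)" by (simp add: inst_def)
qed

text \<open>The value of a family at \<open>x\<close> is named by a variable \<open>v\<close>
  together with the equivalence contained in unique existence, so that any other value can later be
  identified with \<open>v\<close>.\<close>

lemma family_rule:
  assumes Family: "H \<turnstile> Family f A" and x: "H \<turnstile> Mem x A" and fin: "fin_ctx H"
    and v: "\<And>v H'. H \<subseteq> H' \<Longrightarrow> fin_ctx H' \<Longrightarrow> (\<And>y. H' \<turnstile> Iff (Maps f x y) (Eq y v)) \<Longrightarrow> H' \<turnstile> q"
  shows "H \<turnstile> q"
proof -
  have "H \<turnstile> FAll (Imp (Mem 0 (Suc A)) (FEx (FAll (Iff (Maps (f + 3) 2 0) (Eq 0 1)))))"
    using ConjE2[OF Family[unfolded Family_def is_family_def f_and_def]]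
    by (simp add: f_ex1_def form_simps maps_to_Maps[OF var_at_Suc[OF var_at_Suc[OF var_at_Suc[OF var_at_add]]]
          var_at_Suc[OF var_at_Suc[OF var_at_bound]] var_at_bound] eval_nat_numeral)
  then have "H \<turnstile> FEx (FAll (Iff (Maps (f + 2) (x + 2) 0) (Eq 0 1)))"
    by (rule All_ImpD[OF _ _ _ x]) (simp_all add: inst_def eval_nat_numeral)
  then show ?thesis
  proof (rule ExE_fresh[OF fin])
    fix v H' assume H': "H \<subseteq> H'" "fin_ctx H'" and "H' \<turnstile> inst v (FAll (Iff (Maps (f + 2) (x + 2) 0) (Eq 0 1)))"
    then have "H' \<turnstile> FAll (Iff (Maps (f + 1) (x + 1) 0) (Eq 0 (v + 1)))"
      by (simp add: inst_def eval_nat_numeral)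
    then have "H' \<turnstile> Iff (Maps f x y) (Eq y v)" for y
      by (rule All_inst[of _ _ y]) (simp add: inst_def)
    with H' show "H' \<turnstile> q" by (rule v)
  qed
qed

lemma Eq_of_Maps:
  assumes "\<And>y. H \<turnstile> Iff (Maps f x y) (Eq y v)" "H \<subseteq> H'" "H' \<turnstile> Maps f x y"
  shows "H' \<turnstile> Eq y v"
  using Iff_D1[OF proves_mono[OF assms(1,2)] assms(3)] .

lemma SubsetI:
  assumes "fin_ctx H" "\<And>z H'. H \<subseteq> H' \<Longrightarrow> fin_ctx H' \<Longrightarrow> H' \<turnstile> Mem z U \<Longrightarrow> H' \<turnstile> Mem z S"
  shows "H \<turnstile> Subset U S"
  unfolding Subset_def by (rule All_ImpI[OF assms(1)]) (use assms(2) in \<open>simp add: inst_def\<close>)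

lemma SubsetD:
  assumes "H \<turnstile> Subset U S" "H \<turnstile> Mem z U"
  shows "H \<turnstile> Mem z S"
  by (rule All_ImpD[OF assms(1)[unfolded Subset_def] _ _ assms(2)]) (simp_all add: inst_def)

lemma CoversI:
  assumes "H \<turnstile> Mem i k" "H \<turnstile> Maps D i V" "H \<turnstile> Subset V U"
  shows "H \<turnstile> Covers D k U"
proof -
  have "H \<turnstile> FEx (Conj (Maps (Suc D) (Suc i) 0) (Subset 0 (Suc U)))"
    by (rule Ex_inst[OF ConjI[OF assms(2,3)]]) (simp add: inst_def)
  from ConjI[OF assms(1) this] show ?thesis
    unfolding Covers_def by (rule Ex_inst) (simp add: inst_def)
qed

lemma CoversE:
  assumes "H \<turnstile> Covers D k U" and fin: "fin_ctx H"
    and q: "\<And>i V H'. H \<subseteq> H' \<Longrightarrow> fin_ctx H' \<Longrightarrow> H' \<turnstile> Mem i k \<Longrightarrow> H' \<turnstile> Maps D i V \<Longrightarrow> H' \<turnstile> Subset V U \<Longrightarrow> H' \<turnstile> q"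
  shows "H \<turnstile> q"
proof (rule ExE_fresh[OF fin assms(1)[unfolded Covers_def]])
  fix i H1 assume H1: "H \<subseteq> H1" "fin_ctx H1"
    and "H1 \<turnstile> inst i (Conj (Mem 0 (Suc k)) (FEx (Conj (Maps (Suc (Suc D)) (Suc 0) 0) (Subset 0 (Suc (Suc U))))))"
  then have *: "H1 \<turnstile> Conj (Mem i k) (FEx (Conj (Maps (Suc D) (Suc i) 0) (Subset 0 (Suc U))))"
    by (simp add: inst_def)
  show "H1 \<turnstile> q"
  proof (rule ExE_fresh[OF H1(2) ConjE2[OF *]])
    fix V H2 assume H2: "H1 \<subseteq> H2" "fin_ctx H2" and "H2 \<turnstile> inst V (Conj (Maps (Suc D) (Suc i) 0) (Subset 0 (Suc U)))"
    then have **: "H2 \<turnstile> Conj (Maps D i V) (Subset V U)" by (simp add: inst_def)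
    from H1 H2 have "H \<subseteq> H2" by simp
    then show "H2 \<turnstile> q"
      by (rule q[OF _ H2(2) proves_mono[OF ConjE1[OF *] H2(1)] ConjE1[OF **] ConjE2[OF **]])
  qed
qed

text \<open>\<open>Covers_at\<close> produces its own values of the two families at
  \<open>x\<close>. They equal \<open>k\<close> and \<open>D\<close> by single-valuedness, and two
  substitutions of equals carry the covering over.\<close>

lemma Covers_of_Covers_at:
  assumes k: "\<And>y. H \<turnstile> Iff (Maps I x y) (Eq y k)" and D: "\<And>y. H \<turnstile> Iff (Maps C x y) (Eq y D)"
    and fin: "fin_ctx H" and cov: "H \<turnstile> Covers_at I C x U"
  shows "H \<turnstile> Covers D k U"
proof (rule ExE_fresh[OF fin cov[unfolded Covers_at_def]])
  fix k' H1 assume H1: "H \<subseteq> H1" "fin_ctx H1"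
    and "H1 \<turnstile> inst k' (FEx (Conj (Maps (Suc (Suc I)) (Suc (Suc x)) (Suc 0))
     (Conj (Maps (Suc (Suc C)) (Suc (Suc x)) 0) (Covers 0 (Suc 0) (Suc (Suc U))))))"
  then have *: "H1 \<turnstile> FEx (Conj (Maps (Suc I) (Suc x) (Suc k'))
      (Conj (Maps (Suc C) (Suc x) 0) (Covers 0 (Suc k') (Suc U))))"
    by (simp add: inst_def)
  show "H1 \<turnstile> Covers D k U"
  proof (rule ExE_fresh[OF H1(2) *])
    fix D' H2 assume H2: "H1 \<subseteq> H2" "fin_ctx H2"
      and "H2 \<turnstile> inst D' (Conj (Maps (Suc I) (Suc x) (Suc k')) (Conj (Maps (Suc C) (Suc x) 0) (Covers 0 (Suc k') (Suc U))))"
    then have **: "H2 \<turnstile> Conj (Maps I x k') (Conj (Maps C x D') (Covers D' k' U))" by (simp add: inst_def)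
    from H1 H2 have sub: "H \<subseteq> H2" by simp
    have "H2 \<turnstile> Covers D' k U"
      \<comment> \<open>The template has index 0 at the place where \<open>k'\<close> is exchanged
        for \<open>k\<close>; the other arguments are shifted past it.\<close>
      by (rule Eq_subst[OF Eq_of_Maps[OF k sub ConjE1[OF **]] ConjE2[OF ConjE2[OF **]], of "Covers (Suc D') 0 (Suc U)"])
        (simp_all add: inst_def)
    then show "H2 \<turnstile> Covers D k U"
      by (rule Eq_subst[OF Eq_of_Maps[OF D sub ConjE1[OF ConjE2[OF **]]], of _ "Covers 0 (Suc k) (Suc U)"])
        (simp_all add: inst_def)
  qed
qed

lemma Covers_at_of_Covers:
  assumes "H \<turnstile> Maps I x k" "H \<turnstile> Maps C x D" "H \<turnstile> Covers D k U"
  shows "H \<turnstile> Covers_at I C x U"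
proof -
  have "H \<turnstile> FEx (Conj (Maps (Suc I) (Suc x) (Suc k)) (Conj (Maps (Suc C) (Suc x) 0) (Covers 0 (Suc k) (Suc U))))"
    by (rule Ex_inst[OF ConjI[OF assms(1) ConjI[OF assms(2,3)]]]) (simp add: inst_def)
  then show ?thesis unfolding Covers_at_def by (rule Ex_inst) (simp add: inst_def)
qed

lemma RcD:
  assumes "H \<turnstile> Rc \<phi> S x U" and fin: "fin_ctx H" and y: "H \<turnstile> Mem y S"
    and u: "\<And>u H'. H \<subseteq> H' \<Longrightarrow> fin_ctx H' \<Longrightarrow> H' \<turnstile> Mem u U \<Longrightarrow> H' \<turnstile> le_fm \<phi> u y"
  shows "H \<turnstile> le_fm \<phi> x y"
proof -
  have "H \<turnstile> Imp (FAll (Imp (Mem 0 (Suc U)) (le_fm \<phi> 0 (Suc y)))) (le_fm \<phi> x y)"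
    by (rule All_ImpD[OF assms(1)[unfolded Rc_def] _ _ y]) (simp_all add: inst_def)
  moreover have "H \<turnstile> FAll (Imp (Mem 0 (Suc U)) (le_fm \<phi> 0 (Suc y)))"
    by (rule All_ImpI[OF fin]) (use u in \<open>simp add: inst_def\<close>)
  ultimately show ?thesis by (rule ImpE)
qed

text \<open>The inner hypothesis, that \<open>y\<close> bounds \<open>U\<close>, arrives as a rule
  valid in all larger contexts, so it can be used under further assumptions.\<close>

lemma RcI:
  assumes fin: "fin_ctx H"
    and y: "\<And>y H'. H \<subseteq> H' \<Longrightarrow> fin_ctx H' \<Longrightarrow> H' \<turnstile> Mem y S \<Longrightarrow>
      (\<And>u H''. H' \<subseteq> H'' \<Longrightarrow> H'' \<turnstile> Mem u U \<Longrightarrow> H'' \<turnstile> le_fm \<phi> u y) \<Longrightarrow> H' \<turnstile> le_fm \<phi> x y"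
  shows "H \<turnstile> Rc \<phi> S x U"
  unfolding Rc_def
proof (rule All_ImpI[OF fin])
  fix y H1 assume H1: "H \<subseteq> H1" "fin_ctx H1" and "H1 \<turnstile> inst y (Mem 0 (Suc S))"
  then have yS: "H1 \<turnstile> Mem y S" by (simp add: inst_def)
  have "H1 \<turnstile> Imp (FAll (Imp (Mem 0 (Suc U)) (le_fm \<phi> 0 (Suc y)))) (le_fm \<phi> x y)"
  proof (rule ImpI_ext[OF H1(2)])
    fix H2 assume H2: "H1 \<subseteq> H2" "fin_ctx H2" and all: "H2 \<turnstile> FAll (Imp (Mem 0 (Suc U)) (le_fm \<phi> 0 (Suc y)))"
    from H1 H2 have sub: "H \<subseteq> H2" by simp
    show "H2 \<turnstile> le_fm \<phi> x y"
    proof (rule y[OF sub H2(2) proves_mono[OF yS H2(1)]])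
      fix u H3 assume "H2 \<subseteq> H3" "H3 \<turnstile> Mem u U"
      then show "H3 \<turnstile> le_fm \<phi> u y"
        by (rule_tac All_ImpD[OF proves_mono[OF all], of _ u "Mem u U"]) (simp_all add: inst_def)
    qed
  qed
  then show "H1 \<turnstile> inst y (Imp (FAll (Imp (Mem 0 (Suc (Suc U))) (le_fm \<phi> 0 (Suc 0)))) (le_fm \<phi> (Suc x) 0))"
    by (simp add: inst_def)
qed

subsection \<open>The uniformity argument in set theory\<close>

text \<open>The values \<open>k\<close> of \<open>I\<close> and \<open>D\<close> of \<open>C\<close>
  at \<open>a\<close> are fixed here. The equivalence \<open>pres\<close> is required in every
  larger context because the subsets it is applied to include one that separation supplies only
  after the context has grown.\<close>

lemma uniformity_contradiction:
  assumes CZF: "CZF \<subseteq> H" and GUP: "GUP_CZF \<subseteq> H" and fin: "fin_ctx H"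
    and J: "H \<turnstile> Mem e J" "H \<turnstile> Empty e" "H \<turnstile> Mem o' J" "H \<turnstile> Mem e o'"
    and least: "H \<turnstile> Imp (FAll (Imp (Mem 0 (Suc S)) (le_fm \<phi> (Suc a) 0))) Fls"
    and stable: "H \<turnstile> FAll (Imp (Mem 0 (Suc S)) (Imp (Imp (Imp (le_fm \<phi> (Suc a) 0) Fls) Fls) (le_fm \<phi> (Suc a) 0)))"
    and a: "H \<turnstile> Mem a S"
    and Family: "H \<turnstile> Family D k"
    and pres: "\<And>U H'. H \<subseteq> H' \<Longrightarrow> fin_ctx H' \<Longrightarrow> H' \<turnstile> Subset U S \<Longrightarrow> H' \<turnstile> Iff (Rc \<phi> S a U) (Covers D k U)"
  shows "H \<turnstile> Fls"
proof -
  \<comment> \<open>The subset depends on \<open>x\<close>, so it may not occur in the relation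
    given to uniformity. Its inclusion is expressed by "an element of \<open>V\<close> yields
    \<open>Decided J x\<close>", under the binders for \<open>i\<close>, \<open>V\<close> and the
    element.\<close>
  have covers: "H \<turnstile> FEx (Conj (Mem 0 (Suc k)) (FEx (Conj (Maps (Suc (Suc D)) (Suc 0) 0)
      (FAll (Imp (Mem 0 (Suc 0)) (Decided (J + 3) (x + 3)))))))" for x
  proof (rule separation_rule[OF CZF fin, of "Decided (Suc 0) (Suc (Suc 0))" S "case_nat J (\<lambda>_. x)"])
    show "bounded_fm (Decided (Suc 0) (Suc (Suc 0)))" by simp
    fix U H1 assume H1: "H \<subseteq> H1" "fin_ctx H1"
      and "\<And>u. H1 \<turnstile> Iff (Mem u U) (Conj (Mem u S) (ren (case_nat u (case_nat J (\<lambda>_. x))) (Decided (Suc 0) (Suc (Suc 0)))))"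
    then have U: "H1 \<turnstile> Iff (Mem u U) (Conj (Mem u S) (Decided J x))" for u by simp
    have sub: "H1 \<turnstile> Subset U S"
      by (rule SubsetI[OF H1(2)]) (rule ConjE1[OF Iff_D1[OF proves_mono[OF U]]])
    have "H1 \<turnstile> Rc \<phi> S a U"
    proof (rule RcI[OF H1(2)])
      fix y H2 assume H2: "H1 \<subseteq> H2" "fin_ctx H2" and y: "H2 \<turnstile> Mem y S"
        and le: "\<And>u H''. H2 \<subseteq> H'' \<Longrightarrow> H'' \<turnstile> Mem u U \<Longrightarrow> H'' \<turnstile> le_fm \<phi> u y"
      have H: "H \<subseteq> H2" using H1 H2 by simp
      have "H2 \<turnstile> Imp (Imp (Imp (le_fm \<phi> a y) Fls) Fls) (le_fm \<phi> a y)"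
        by (rule All_ImpD[OF proves_mono[OF stable H] _ _ y]) (simp_all add: inst_def)
      \<comment> \<open>If \<open>a\<close> were not below \<open>y\<close>, then
        \<open>Decided J x\<close> would be refuted, since it puts \<open>a\<close> into
        \<open>U\<close>, which \<open>y\<close> bounds. That contradicts
        \<open>not_not_Decided\<close>.\<close>
      moreover have "H2 \<turnstile> Imp (Imp (le_fm \<phi> a y) Fls) Fls"
      proof (rule ImpI_ext[OF H2(2)])
        fix H3 assume H3: "H2 \<subseteq> H3" "fin_ctx H3" and no: "H3 \<turnstile> Imp (le_fm \<phi> a y) Fls"
        have "H3 \<turnstile> Imp (Decided J x) Fls"
        proof (rule ImpI_ext[OF H3(2)])
          fix H4 assume H4: "H3 \<subseteq> H4" "fin_ctx H4" and dec: "H4 \<turnstile> Decided J x"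
          have "H4 \<turnstile> Mem a U"
            using H1 H2 H3 H4 by (intro Iff_D2[OF proves_mono[OF U]] ConjI dec proves_mono[OF a]) auto
          then have "H4 \<turnstile> le_fm \<phi> a y" using H3 H4 by (intro le) auto
          with proves_mono[OF no H4(1)] show "H4 \<turnstile> Fls" by (rule ImpE)
        qed
        then show "H3 \<turnstile> Fls"
          using H H3 by (intro not_not_Decided[of H3 e J o' x] proves_mono[OF J(1)] proves_mono[OF J(2)]
            proves_mono[OF J(3)] proves_mono[OF J(4)]) auto
      qed
      ultimately show "H2 \<turnstile> le_fm \<phi> a y" by (rule ImpE)
    qed
    then have "H1 \<turnstile> Covers D k U" by (rule Iff_D1[OF pres[OF H1 sub]])
    then show "H1 \<turnstile> FEx (Conj (Mem 0 (Suc k)) (FEx (Conj (Maps (Suc (Suc D)) (Suc 0) 0)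
      (FAll (Imp (Mem 0 (Suc 0)) (Decided (J + 3) (x + 3)))))))"
    proof (rule CoversE[OF _ H1(2)])
      fix i V H2 assume H2: "H1 \<subseteq> H2" "fin_ctx H2" and i: "H2 \<turnstile> Mem i k" "H2 \<turnstile> Maps D i V" "H2 \<turnstile> Subset V U"
      have "H2 \<turnstile> FAll (Imp (Mem 0 (Suc V)) (Decided (J + 1) (x + 1)))"
      proof (rule All_ImpI[OF H2(2)])
        fix z H3 assume H3: "H2 \<subseteq> H3" "fin_ctx H3" and "H3 \<turnstile> inst z (Mem 0 (Suc V))"
        then have "H3 \<turnstile> Mem z U" using SubsetD[OF proves_mono[OF i(3) H3(1)]] by (simp add: inst_def)
        moreover have "H1 \<subseteq> H3" using H2 H3 by simp
        ultimately have "H3 \<turnstile> Decided J x" using ConjE2[OF Iff_D1[OF proves_mono[OF U]]] by blast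
        then show "H3 \<turnstile> inst z (Decided (J + 1) (x + 1))" by (simp add: inst_def)
      qed
      from ConjI[OF i(2) this]
      have "H2 \<turnstile> FEx (Conj (Maps (Suc D) (Suc i) 0) (FAll (Imp (Mem 0 (Suc 0)) (Decided (J + 2) (x + 2)))))"
        by (rule Ex_inst) (simp add: inst_def eval_nat_numeral)
      from ConjI[OF i(1) this] show "H2 \<turnstile> FEx (Conj (Mem 0 (Suc k)) (FEx (Conj (Maps (Suc (Suc D)) (Suc 0) 0)
          (FAll (Imp (Mem 0 (Suc 0)) (Decided (J + 3) (x + 3)))))))"
        by (rule Ex_inst) (simp add: inst_def eval_nat_numeral)
    qed
  qed
  \<comment> \<open>As a relation its indices are \<open>x\<close>, \<open>i\<close>,
    \<open>D\<close>, \<open>J\<close> in this order. Below the binder for \<open>V\<close> this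
    makes \<open>Maps 3 2 0\<close> refer to \<open>D\<close>, \<open>i\<close>, \<open>V\<close>;
    below the next binder \<open>5\<close> and \<open>2\<close> are \<open>J\<close> and
    \<open>x\<close>.\<close>
  let ?p = "FEx (Conj (Maps 3 2 0) (FAll (Imp (Mem 0 1) (Decided 5 2))))"
  show ?thesis
  proof (rule GUP_rule[OF GUP fin, of k "case_nat D (\<lambda>_. J)" ?p])
    show "H \<turnstile> FEx (Conj (Mem 0 (Suc k)) (ren (case_nat (Suc x) (case_nat 0 (\<lambda>n. Suc (case n of 0 \<Rightarrow> D | Suc _ \<Rightarrow> J)))) ?p))" for x
      using covers[of x] by (simp add: eval_nat_numeral)
  next
    fix i H1 assume H1: "H \<subseteq> H1" "fin_ctx H1" and i: "H1 \<turnstile> Mem i k"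
      and "\<And>x. H1 \<turnstile> ren (case_nat x (case_nat i (case_nat D (\<lambda>_. J)))) ?p"
    then have unif: "H1 \<turnstile> FEx (Conj (Maps (Suc D) (Suc i) 0) (FAll (Imp (Mem 0 (Suc 0)) (Decided (Suc (Suc J)) (Suc (Suc x))))))" for x
      by (simp add: eval_nat_numeral)
    show "H1 \<turnstile> Fls"
    proof (rule family_rule[OF proves_mono[OF Family H1(1)] i H1(2)])
      fix V H2 assume H2: "H1 \<subseteq> H2" "fin_ctx H2" and V: "\<And>y. H2 \<turnstile> Iff (Maps D i y) (Eq y V)"
      have H: "H \<subseteq> H2" using H1 H2 by simp
      have "H2 \<turnstile> Subset V e"
      proof (rule SubsetI[OF H2(2)])
        fix z H3 assume H3: "H2 \<subseteq> H3" "fin_ctx H3" and z: "H3 \<turnstile> Mem z V"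
        \<comment> \<open>For each \<open>x\<close> the uniform statement yields its own value
          \<open>W\<close> of \<open>D\<close> at \<open>i\<close>. It equals \<open>V\<close>, so
          the same element \<open>z\<close> serves for all \<open>x\<close>.\<close>
        have "H3 \<turnstile> Decided J x" for x
        proof (rule ExE_fresh[OF H3(2) proves_mono[OF unif[of x]]])
          show "H1 \<subseteq> H3" using H2 H3 by simp
          fix W H4 assume H4: "H3 \<subseteq> H4" "fin_ctx H4"
            and "H4 \<turnstile> inst W (Conj (Maps (Suc D) (Suc i) 0) (FAll (Imp (Mem 0 (Suc 0)) (Decided (Suc (Suc J)) (Suc (Suc x))))))"
          then have W: "H4 \<turnstile> Conj (Maps D i W) (FAll (Imp (Mem 0 (Suc W)) (Decided (Suc J) (Suc x))))"
            by (simp add: inst_def)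
          have "H4 \<turnstile> Eq W V" using H3 H4 by (intro Eq_of_Maps[OF V _ ConjE1[OF W]]) auto
          then have "H4 \<turnstile> Mem z W"
            by (rule Eq_subst[OF Eq_sym proves_mono[OF z H4(1)], of _ _ "Mem (Suc z) 0"]) (simp_all add: inst_def)
          then show "H4 \<turnstile> Decided J x"
            by (rule All_ImpD[OF ConjE2[OF W], rotated 2]) (simp_all add: inst_def)
        qed
        moreover have "GUP_CZF \<subseteq> H3" using GUP H H3 by simp
        ultimately have "H3 \<turnstile> Fls" using H3(2) by (intro not_all_Decided)
        then show "H3 \<turnstile> Mem z e" by (rule FlsE)
      qed
      then have "H2 \<turnstile> Covers D k e"
        by (rule CoversI[OF proves_mono[OF i H2(1)] Iff_D2[OF V EqRefl]])
      moreover have "H2 \<turnstile> Subset e S"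
      proof (rule SubsetI[OF H2(2)])
        fix z H3 assume "H2 \<subseteq> H3" and z: "H3 \<turnstile> Mem z e"
        then have "H \<subseteq> H3" using H by simp
        from Empty_D[OF proves_mono[OF J(2) this] z] show "H3 \<turnstile> Mem z S" .
      qed
      ultimately have Rc: "H2 \<turnstile> Rc \<phi> S a e" using Iff_D2[OF pres[OF H H2(2)]] by blast
      have "H2 \<turnstile> FAll (Imp (Mem 0 (Suc S)) (le_fm \<phi> (Suc a) 0))"
      proof (rule All_ImpI[OF H2(2)])
        fix y H3 assume H3: "H2 \<subseteq> H3" "fin_ctx H3" and "H3 \<turnstile> inst y (Mem 0 (Suc S))"
        then have y: "H3 \<turnstile> Mem y S" by (simp add: inst_def)
        have "H3 \<turnstile> le_fm \<phi> a y"
        proof (rule RcD[OF proves_mono[OF Rc H3(1)] H3(2) y])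
          fix u H4 assume "H3 \<subseteq> H4" and u: "H4 \<turnstile> Mem u e"
          then have "H \<subseteq> H4" using H H3 by simp
          from Empty_D[OF proves_mono[OF J(2) this] u] show "H4 \<turnstile> le_fm \<phi> u y" .
        qed
        then show "H3 \<turnstile> inst y (le_fm \<phi> (Suc a) 0)" by (simp add: inst_def)
      qed
      with proves_mono[OF least H] show "H2 \<turnstile> Fls" by (rule ImpE)
    qed
  qed
qed

lemma at_vars_closed:
  assumes "fv \<sigma> \<subseteq> {0}"
  shows "at_vars \<sigma> [x] d = ren (\<lambda>_. x d) \<sigma>"
  unfolding at_vars_1 using assms by (intro ren_cong) (auto split: nat.split)

lemma sentence_GUP_CZF: "p \<in> GUP_CZF \<Longrightarrow> sentence p"
  by (auto simp: GUP_CZF_def closures_def)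

text \<open>The presentation is localised at \<open>a\<close>: the values of both families there are
  named, and the equivalence is rewritten in terms of these names. An empty set and the truth values
  are then added, each in a larger context.\<close>

lemma Set_presented_contradiction:
  assumes CZF: "CZF \<subseteq> H" and GUP: "GUP_CZF \<subseteq> H" and fin: "fin_ctx H"
    and least: "H \<turnstile> Imp (FAll (Imp (Mem 0 (Suc S)) (le_fm \<phi> (Suc a) 0))) Fls"
    and stable: "H \<turnstile> FAll (Imp (Mem 0 (Suc S)) (Imp (Imp (Imp (le_fm \<phi> (Suc a) 0) Fls) Fls) (le_fm \<phi> (Suc a) 0)))"
    and a: "H \<turnstile> Mem a S" and pres: "H \<turnstile> Set_presented \<phi> S"
  shows "H \<turnstile> Fls"
proof (rule ExE_fresh[OF fin pres[unfolded Set_presented_def]])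
  fix I H1 assume H1: "H \<subseteq> H1" "fin_ctx H1"
    and "H1 \<turnstile> inst I (FEx (Conj (Family (Suc 0) (Suc (Suc S))) (Conj (Family 0 (Suc (Suc S)))
     (Conj (Families (Suc (Suc S)) (Suc 0) 0) (Presents \<phi> (Suc (Suc S)) (Suc 0) 0)))))"
  then have *: "H1 \<turnstile> FEx (Conj (Family (Suc I) (Suc S)) (Conj (Family 0 (Suc S))
     (Conj (Families (Suc S) (Suc I) 0) (Presents \<phi> (Suc S) (Suc I) 0))))"
    by (simp add: inst_def)
  show "H1 \<turnstile> Fls"
  proof (rule ExE_fresh[OF H1(2) *])
    fix C H2 assume H2: "H1 \<subseteq> H2" "fin_ctx H2"
      and "H2 \<turnstile> inst C (Conj (Family (Suc I) (Suc S)) (Conj (Family 0 (Suc S))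
     (Conj (Families (Suc S) (Suc I) 0) (Presents \<phi> (Suc S) (Suc I) 0))))"
    then have **: "H2 \<turnstile> Conj (Family I S) (Conj (Family C S) (Conj (Families S I C) (Presents \<phi> S I C)))"
      by (simp add: inst_def)
    have sub2: "H \<subseteq> H2" using H1 H2 by simp
    show "H2 \<turnstile> Fls"
    proof (rule family_rule[OF ConjE1[OF **] proves_mono[OF a sub2] H2(2)])
      fix k H3 assume H3: "H2 \<subseteq> H3" "fin_ctx H3" and k: "\<And>y. H3 \<turnstile> Iff (Maps I a y) (Eq y k)"
      have sub3: "H \<subseteq> H3" using sub2 H3 by simp
      show "H3 \<turnstile> Fls"
      proof (rule family_rule[OF proves_mono[OF ConjE1[OF ConjE2[OF **]] H3(1)] proves_mono[OF a sub3] H3(2)])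
        fix D H4 assume H4: "H3 \<subseteq> H4" "fin_ctx H4" and D: "\<And>y. H4 \<turnstile> Iff (Maps C a y) (Eq y D)"
        have sub4: "H \<subseteq> H4" using sub3 H4 by simp
        have "H2 \<subseteq> H4" using H3 H4 by simp
        note typ_pres = proves_mono[OF ConjE2[OF ConjE2[OF **]] this]
        have Maps: "H4 \<turnstile> Conj (Maps I a k) (Maps C a D)"
          by (rule ConjI[OF Iff_D2[OF proves_mono[OF k H4(1)] EqRefl] Iff_D2[OF D EqRefl]])
        have "H4 \<turnstile> FAll (FAll (Imp
             (Conj (Maps (I + 2) (a + 2) 1) (Maps (C + 2) (a + 2) 0))
             (Conj (Family 0 1) (FAll (FAll (Imp (Conj (Mem 1 3) (Maps 2 1 0)) (Subset 0 (S + 4))))))))"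
          by (rule All_ImpD[OF ConjE1[OF typ_pres, unfolded Families_def] _ _ proves_mono[OF a sub4]])
            (simp_all add: inst_def eval_nat_numeral)
        then have "H4 \<turnstile> FAll (Imp
             (Conj (Maps (I + 1) (a + 1) (k + 1)) (Maps (C + 1) (a + 1) 0))
             (Conj (Family 0 (k + 1)) (FAll (FAll (Imp (Conj (Mem 1 (k + 3)) (Maps 2 1 0)) (Subset 0 (S + 3)))))))"
          by (rule All_inst[of _ _ k]) (simp add: inst_def eval_nat_numeral)
        then have "H4 \<turnstile> Conj (Family D k) (FAll (FAll (Imp (Conj (Mem 1 (k + 2)) (Maps (D + 2) 1 0)) (Subset 0 (S + 2)))))"
          by (rule All_ImpD[OF _ _ _ Maps]) (simp_all add: inst_def eval_nat_numeral)
        then have Family: "H4 \<turnstile> Family D k" by (rule ConjE1)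
        have "H4 \<turnstile> FAll (Imp (Subset 0 (Suc S)) (Iff (Rc \<phi> (Suc S) (Suc a) 0) (Covers_at (Suc I) (Suc C) (Suc a) 0)))"
          by (rule All_ImpD[OF ConjE2[OF typ_pres, unfolded Presents_def] _ _ proves_mono[OF a sub4]])
            (simp_all add: inst_def)
        then have pres: "H4 \<turnstile> Imp (Subset U S) (Iff (Rc \<phi> S a U) (Covers_at I C a U))" for U
          by (rule All_inst[of _ _ U]) (simp add: inst_def)
        have pres': "H' \<turnstile> Iff (Rc \<phi> S a U) (Covers D k U)"
          if H': "H4 \<subseteq> H'" "fin_ctx H'" and U: "H' \<turnstile> Subset U S" for U H'
        proof -
          have iff: "H' \<turnstile> Iff (Rc \<phi> S a U) (Covers_at I C a U)"
            by (rule ImpE[OF proves_mono[OF pres H'(1)] U])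
          have sub: "H3 \<subseteq> H'" using H4 H' by simp
          show ?thesis
            unfolding Iff_def
          proof (intro ConjI ImpI_ext[OF H'(2)])
            fix H'' assume H'': "H' \<subseteq> H''" "fin_ctx H''" and Rc: "H'' \<turnstile> Rc \<phi> S a U"
            have s: "H3 \<subseteq> H''" "H4 \<subseteq> H''" using sub H' H'' by auto
            show "H'' \<turnstile> Covers D k U"
              by (rule Covers_of_Covers_at[OF proves_mono[OF k s(1)] proves_mono[OF D s(2)] H''(2)
                  Iff_D1[OF proves_mono[OF iff H''(1)] Rc]])
          next
            fix H'' assume H'': "H' \<subseteq> H''" "fin_ctx H''" and cov: "H'' \<turnstile> Covers D k U"
            have s: "H4 \<subseteq> H''" using H' H'' by auto
            show "H'' \<turnstile> Rc \<phi> S a U"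
              by (rule Iff_D2[OF proves_mono[OF iff H''(1)] Covers_at_of_Covers[OF proves_mono[OF ConjE1[OF Maps] s]
                  proves_mono[OF ConjE2[OF Maps] s] cov]])
          qed
        qed
        have C4: "CZF \<subseteq> H4" using CZF sub4 by simp
        show "H4 \<turnstile> Fls"
        \<comment> \<open>Separating \<open>S\<close> by falsity gives an empty set, which is also
          the empty subset of \<open>S\<close> used at the end of the argument.\<close>
        proof (rule separation_rule[OF C4 H4(2), of Fls S id])
          show "bounded_fm Fls" by (rule bounded_fm.intros)
          fix e H5 assume H5: "H4 \<subseteq> H5" "fin_ctx H5"
            and e: "\<And>x. H5 \<turnstile> Iff (Mem x e) (Conj (Mem x S) (ren (case_nat x id) Fls))"
          have C5: "CZF \<subseteq> H5" using C4 H5 by simp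
          have empty: "H5 \<turnstile> Empty e"
            unfolding Empty_def
          proof (rule All_ImpI[OF H5(2)])
            fix z H' assume "H5 \<subseteq> H'" and "H' \<turnstile> inst z (Mem 0 (Suc e))"
            then have "H' \<turnstile> ren (case_nat z id) Fls"
              by (intro ConjE2[OF Iff_D1[OF proves_mono[OF e]]]) (simp_all add: inst_def)
            then show "H' \<turnstile> inst z Fls" by (simp add: inst_def)
          qed
          show "H5 \<turnstile> Fls"
          proof (rule pairing_rule[OF C5 H5(2), of e e])
            fix o' H6 assume H6: "H5 \<subseteq> H6" "fin_ctx H6" and o': "H6 \<turnstile> Mem e o'"
            have C6: "CZF \<subseteq> H6" using C5 H6 by simp
            show "H6 \<turnstile> Fls"
            proof (rule pairing_rule[OF C6 H6(2), of e o'])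
              fix J H7 assume H7: "H6 \<subseteq> H7" "fin_ctx H7" and J: "H7 \<turnstile> Mem e J" "H7 \<turnstile> Mem o' J"
              have s: "H \<subseteq> H7" "H4 \<subseteq> H7" "H5 \<subseteq> H7" using sub4 H5 H6 H7 by auto
              have "CZF \<subseteq> H7" "GUP_CZF \<subseteq> H7" using CZF GUP s by auto
              then show "H7 \<turnstile> Fls"
              proof (rule uniformity_contradiction[OF _ _ H7(2) J(1) proves_mono[OF empty s(3)] J(2)
                    proves_mono[OF o' H7(1)] proves_mono[OF least s(1)] proves_mono[OF stable s(1)]
                    proves_mono[OF a s(1)] proves_mono[OF Family s(2)]])
                fix U H' assume "H7 \<subseteq> H'" "fin_ctx H'" "H' \<turnstile> Subset U S"
                then show "H' \<turnstile> Iff (Rc \<phi> S a U) (Covers D k U)" using s(2) by (intro pres') auto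
              qed
            qed
          qed
        qed
      qed
    qed
  qed
qed

theorem CZF_not_set_presented:
  fixes \<phi> :: fm
  defines "le \<equiv> \<lambda>x y. at_vars \<phi> [x, y]"
  assumes Th: "CZF \<subseteq> Th" "\<forall>p\<in>Th. sentence p" "\<not> (Th \<union> GUP_CZF \<turnstile> Fls)"
    and \<sigma>: "fv \<sigma> \<subseteq> {0}" and \<phi>: "fv \<phi> \<subseteq> {0, 1}"
    and ex1: "Th \<turnstile> (\<^bold>\<exists>!S. at_vars \<sigma> [S]) 0"
    and ex_a: "Th \<turnstile> (\<^bold>\<forall>S. at_vars \<sigma> [S] \<^bold>\<longrightarrow>
      (\<^bold>\<exists>a. a \<^bold>\<in> S \<^bold>\<and> \<^bold>\<not> is_least S le a \<^bold>\<and> is_stable S le a)) 0"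
  shows "\<not> (Th \<turnstile> (\<^bold>\<forall>S. at_vars \<sigma> [S] \<^bold>\<longrightarrow> set_presented S (R\<^sub>c S le)) 0)"
proof
  assume pres: "Th \<turnstile> (\<^bold>\<forall>S. at_vars \<sigma> [S] \<^bold>\<longrightarrow> set_presented S (R\<^sub>c S le)) 0"
  let ?H = "Th \<union> GUP_CZF"
  let ?s = "\<lambda>i. ren (\<lambda>_. i) \<sigma>"
  \<comment> \<open>All hypotheses are sentences, so even an infinite theory has no free variables
    and fresh variables exist.\<close>
  have "fv p = {}" if "p \<in> ?H" for p using that Th(2) sentence_GUP_CZF by auto
  then have "\<Union> (fv ` ?H) = {}" by blast
  then have fin: "fin_ctx ?H" by (simp add: fin_ctx_def)
  have "?H \<turnstile> FEx (FAll (Iff (?s 0) (Eq 0 1)))"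
    using proves_mono[OF ex1, of ?H] by (simp add: f_ex1_def form_simps at_vars_closed[OF \<sigma>])
  then have "?H \<turnstile> Fls"
  proof (rule ExE_fresh[OF fin])
    fix S H1 assume H1: "?H \<subseteq> H1" "fin_ctx H1" and "H1 \<turnstile> inst S (FAll (Iff (?s 0) (Eq 0 1)))"
    then have "H1 \<turnstile> FAll (Iff (?s 0) (Eq 0 (Suc S)))" by (simp add: inst_def comp_def)
    \<comment> \<open>The witness put into its own defining equivalence satisfies
      \<open>\<sigma>\<close>, because it equals itself.\<close>
    then have "H1 \<turnstile> Iff (?s S) (Eq S S)" by (rule All_inst[of _ _ S]) (simp add: inst_def comp_def)
    then have s: "H1 \<turnstile> ?s S" using EqRefl by (rule Iff_D2)
    have sub: "Th \<subseteq> H1" using H1 by simp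
    have "H1 \<turnstile> FAll (Imp (?s 0) (FEx (Conj (Mem 0 (Suc 0)) (Conj
        (Imp (FAll (Imp (Mem 0 (Suc (Suc 0))) (le_fm \<phi> (Suc 0) 0))) Fls)
        (FAll (Imp (Mem 0 (Suc (Suc 0))) (Imp (Imp (Imp (le_fm \<phi> (Suc 0) 0) Fls) Fls) (le_fm \<phi> (Suc 0) 0))))))))"
      using proves_mono[OF ex_a sub]
      by (simp add: le_def is_least_def is_stable_def form_simps at_vars_closed[OF \<sigma>] at_vars_le[OF \<phi>] eval_nat_numeral)
    then have ex: "H1 \<turnstile> FEx (Conj (Mem 0 (Suc S)) (Conj
        (Imp (FAll (Imp (Mem 0 (Suc (Suc S))) (le_fm \<phi> (Suc 0) 0))) Fls)
        (FAll (Imp (Mem 0 (Suc (Suc S))) (Imp (Imp (Imp (le_fm \<phi> (Suc 0) 0) Fls) Fls) (le_fm \<phi> (Suc 0) 0))))))"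
      by (rule All_ImpD[OF _ _ _ s]) (simp_all add: inst_def comp_def)
    have "H1 \<turnstile> FAll (Imp (?s 0) (Set_presented \<phi> 0))"
      using proves_mono[OF pres sub] unfolding le_def
      by (simp add: form_simps at_vars_closed[OF \<sigma>] set_presented_Set_presented[OF \<phi> var_at_bound])
    then have setpres: "H1 \<turnstile> Set_presented \<phi> S"
      by (rule All_ImpD[OF _ _ _ s]) (simp_all add: inst_def comp_def Set_presented_def)
    from H1(2) ex show "H1 \<turnstile> Fls"
    proof (rule ExE_fresh)
      fix a H2 assume H2: "H1 \<subseteq> H2" "fin_ctx H2"
        and "H2 \<turnstile> inst a (Conj (Mem 0 (Suc S)) (Conj
        (Imp (FAll (Imp (Mem 0 (Suc (Suc S))) (le_fm \<phi> (Suc 0) 0))) Fls)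
        (FAll (Imp (Mem 0 (Suc (Suc S))) (Imp (Imp (Imp (le_fm \<phi> (Suc 0) 0) Fls) Fls) (le_fm \<phi> (Suc 0) 0))))))"
      then have a: "H2 \<turnstile> Conj (Mem a S) (Conj
        (Imp (FAll (Imp (Mem 0 (Suc S)) (le_fm \<phi> (Suc a) 0))) Fls)
        (FAll (Imp (Mem 0 (Suc S)) (Imp (Imp (Imp (le_fm \<phi> (Suc a) 0) Fls) Fls) (le_fm \<phi> (Suc a) 0)))))"
        by (simp add: inst_def)
      have "CZF \<subseteq> H2" "GUP_CZF \<subseteq> H2" using H1 H2 Th by auto
      then show "H2 \<turnstile> Fls"
        by (rule Set_presented_contradiction[OF _ _ H2(2) ConjE1[OF ConjE2[OF a]] ConjE2[OF ConjE2[OF a]]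
            ConjE1[OF a] proves_mono[OF setpres H2(1)]])
    qed
  qed
  with Th(3) show False ..
qed

section \<open>Type theory\<close>

subsection \<open>Renaming and substitution\<close>

lemma up_sub_simps [simp]:
  "up_sub s 0 = Var 0" "up_sub s (Suc n) = ren_tm Suc (s n)"
  "up_sub s (numeral k) = ren_tm Suc (s (pred_numeral k))"
  by (simp_all add: up_sub_def numeral_eq_Suc)

lemma ren_ren_tm: "ren_tm r (ren_tm s t) = ren_tm (r \<circ> s) t"
  by (induction t arbitrary: r s) (simp_all add: up_comp)

lemma up_sub_comp_up: "up_sub s \<circ> up r = up_sub (s \<circ> r)"
  by (rule ext) (simp add: up_def up_sub_def split: nat.split)

lemma sub_ren_tm: "sub_tm s (ren_tm r t) = sub_tm (s \<circ> r) t"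
  by (induction t arbitrary: r s) (simp_all add: up_sub_comp_up)

lemma ren_up_Suc_tm [simp]: "ren_tm (up r) (ren_tm Suc t) = ren_tm Suc (ren_tm r t)"
proof -
  have "up r \<circ> Suc = Suc \<circ> r" by auto
  then show ?thesis by (simp add: ren_ren_tm)
qed

lemma ren_sub_tm: "ren_tm r (sub_tm s t) = sub_tm (\<lambda>n. ren_tm r (s n)) t"
proof (induction t arbitrary: r s)
  case (Lam b)
  have "(\<lambda>n. ren_tm (up r) (up_sub s n)) = up_sub (\<lambda>n. ren_tm r (s n))"
    by (rule ext) (simp add: up_sub_def split: nat.split)
  then show ?case using Lam by simp
qed simp_all

lemma up_sub_Var [simp]: "up_sub Var = Var"
  by (rule ext) (simp add: up_sub_def split: nat.split)

lemma sub_Var_tm [simp]: "sub_tm Var t = t"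
  by (induction t) (simp_all add: up_sub_Var)

lemma sub_up_Suc_tm [simp]: "sub_tm (up_sub s) (ren_tm Suc t) = ren_tm Suc (sub_tm s t)"
  by (simp add: sub_ren_tm ren_sub_tm comp_def)

lemma sub_case_Suc_tm [simp]: "sub_tm (case_nat a s) (ren_tm Suc t) = sub_tm s t"
  by (simp add: sub_ren_tm comp_def)

lemma up_sub_Var_comp: "up_sub (\<lambda>n. Var (r n)) = (\<lambda>n. Var (up r n))"
  by (rule ext) (simp add: up_sub_def up_def split: nat.split)

lemma sub_Var_Suc_tm: "sub_tm (\<lambda>n. Var (r n)) t = ren_tm r t"
  by (induction t arbitrary: r) (simp_all add: up_sub_Var_comp)

lemma sub_Var_ty: "sub_ty (\<lambda>n. Var (r n)) A = ren_ty r A"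
  by (induction A arbitrary: r) (simp_all add: up_sub_Var_comp sub_Var_Suc_tm)

lemma ren_ren_ty: "ren_ty r (ren_ty s A) = ren_ty (r \<circ> s) A"
  by (induction A arbitrary: r s) (simp_all add: up_comp ren_ren_tm)

lemma sub_ren_ty: "sub_ty s (ren_ty r A) = sub_ty (s \<circ> r) A"
  by (induction A arbitrary: r s) (simp_all add: up_sub_comp_up sub_ren_tm)

lemma ren_up_Suc_ty [simp]: "ren_ty (up r) (ren_ty Suc A) = ren_ty Suc (ren_ty r A)"
proof -
  have "up r \<circ> Suc = Suc \<circ> r" by auto
  then show ?thesis by (simp add: ren_ren_ty)
qed

lemma sub_case_Suc_ty [simp]: "sub_ty (case_nat a s) (ren_ty Suc A) = sub_ty s A"
  by (simp add: sub_ren_ty comp_def)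

lemma sub_ty_Var [simp]: "sub_ty Var A = A"
  by (induction A) (simp_all add: up_sub_Var)

lemma var_ty_0 [simp]: "var_ty (A # G) 0 = ren_ty Suc A"
  by (simp add: var_ty_def)

lemma var_ty_Suc [simp]: "var_ty (A # G) (Suc i) = ren_ty Suc (var_ty G i)"
  by (simp add: var_ty_def ren_ren_ty comp_def)

lemma inst_tm_ren_Suc [simp]: "inst_tm a (ren_tm Suc t) = t"
  by (simp add: inst_tm_def)

lemma inst_tm_Var_0 [simp]: "inst_tm (Var 0) (ren_tm (up Suc) t) = (t :: 'c tm)"
proof -
  have "case_nat (Var 0) Var \<circ> up Suc = (Var :: nat \<Rightarrow> 'c tm)"
    by (rule ext) (simp add: up_def split: nat.split)
  then show ?thesis by (simp add: inst_tm_def sub_ren_tm)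
qed

primrec ren_jdg :: "(nat \<Rightarrow> nat) \<Rightarrow> 'c jdg \<Rightarrow> 'c jdg" where
  "ren_jdg r IsCtx = IsCtx"
| "ren_jdg r (IsTy A) = IsTy (ren_ty r A)"
| "ren_jdg r (EqTy A B) = EqTy (ren_ty r A) (ren_ty r B)"
| "ren_jdg r (HasTy a A) = HasTy (ren_tm r a) (ren_ty r A)"
| "ren_jdg r (EqTm a b A) = EqTm (ren_tm r a) (ren_tm r b) (ren_ty r A)"

lemma sub_jdg_Var: "sub_jdg (\<lambda>n. Var (r n)) j = ren_jdg r j"
  by (cases j) (simp_all add: sub_Var_ty sub_Var_Suc_tm)

text \<open>A renaming is a substitution by variables, hence an instance of the rule
  \<open>subst\<close>; no induction on derivations takes place.\<close>

lemma derives_ren: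
  assumes "derives Th D j" "derives Th G IsCtx"
    and "\<And>i. i < length D \<Longrightarrow> r i < length G \<and> var_ty G (r i) = ren_ty r (var_ty D i)"
  shows "derives Th G (ren_jdg r j)"
proof -
  have "derives Th G (HasTy (Var (r i)) (sub_ty (\<lambda>n. Var (r n)) (var_ty D i)))" if "i < length D" for i
    using derives.var[OF assms(2), of "r i"] assms(3)[OF that] by (simp add: sub_Var_ty)
  from derives.subst[OF assms(1,2) this] show ?thesis by (simp add: sub_jdg_Var)
qed

section \<open>Logical connectives as de Bruijn terms\<close>

abbreviation cst :: "ctt_const \<Rightarrow> 'c tm" where "cst c \<equiv> Const (Ctt c)"

abbreviation app2 :: "'c tm \<Rightarrow> 'c tm \<Rightarrow> 'c tm \<Rightarrow> 'c tm" where
  "app2 f a b \<equiv> App (App f a) b"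

definition PI :: "'c tm \<Rightarrow> 'c tm \<Rightarrow> 'c tm" where
  "PI A B = app2 (cst cPi) A (Lam B)"

definition SG :: "'c tm \<Rightarrow> 'c tm \<Rightarrow> 'c tm" where
  "SG A B = app2 (cst cSigma) A (Lam B)"

definition IMP :: "'c tm \<Rightarrow> 'c tm \<Rightarrow> 'c tm" where
  "IMP A B = PI A (ren_tm Suc B)"

definition AND :: "'c tm \<Rightarrow> 'c tm \<Rightarrow> 'c tm" where
  "AND A B = SG A (ren_tm Suc B)"

definition NOT :: "'c tm \<Rightarrow> 'c tm" where
  "NOT A = IMP A (cst cN0)"

definition IFF :: "'c tm \<Rightarrow> 'c tm \<Rightarrow> 'c tm" where
  "IFF A B = AND (IMP A B) (IMP B A)"

lemma ren_connectives [simp]: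
  "ren_tm r (PI A B) = PI (ren_tm r A) (ren_tm (up r) B)"
  "ren_tm r (SG A B) = SG (ren_tm r A) (ren_tm (up r) B)"
  "ren_tm r (IMP A B) = IMP (ren_tm r A) (ren_tm r B)"
  "ren_tm r (AND A B) = AND (ren_tm r A) (ren_tm r B)"
  "ren_tm r (NOT A) = NOT (ren_tm r A)"
  "ren_tm r (IFF A B) = IFF (ren_tm r A) (ren_tm r B)"
  by (simp_all add: PI_def SG_def IMP_def AND_def NOT_def IFF_def)

lemma sub_connectives [simp]:
  "sub_tm s (PI A B) = PI (sub_tm s A) (sub_tm (up_sub s) B)"
  "sub_tm s (SG A B) = SG (sub_tm s A) (sub_tm (up_sub s) B)"
  "sub_tm s (IMP A B) = IMP (sub_tm s A) (sub_tm s B)"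
  "sub_tm s (AND A B) = AND (sub_tm s A) (sub_tm s B)"
  "sub_tm s (NOT A) = NOT (sub_tm s A)"
  "sub_tm s (IFF A B) = IFF (sub_tm s A) (sub_tm s B)"
  by (simp_all add: PI_def SG_def IMP_def AND_def NOT_def IFF_def)

lemmas term_simps = t_app_def t_lam_def t_dfun_def SET_def EL_def K_def j_typing_def j_eq_def
  j_hyp_def eval_nat_numeral

subsection \<open>Derived rules of type theory\<close>

text \<open>The derived rules hold over every set of axioms containing \<open>CTT\<close>, and so
  also after the uniformity constants have been added.\<close>

locale ctt =
  fixes Th :: "('c ctx \<times> 'c jdg) set"
  assumes CTT: "CTT \<subseteq> Th"
begin

abbreviation has :: "'c ctx \<Rightarrow> 'c tm \<Rightarrow> 'c ty \<Rightarrow> bool" where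
  "has G a A \<equiv> derives Th G (HasTy a A)"

abbreviation ctx :: "'c ctx \<Rightarrow> bool" where
  "ctx G \<equiv> derives Th G IsCtx"

text \<open>Truth of a proposition with its proof term hidden. The explicit terms return only where
  an index has to be projected or abstracted.\<close>

definition inh :: "'c ctx \<Rightarrow> 'c tm \<Rightarrow> bool" where
  "inh G A \<longleftrightarrow> (\<exists>t. has G t (TEl A))"

abbreviation fam :: "'c ctx \<Rightarrow> 'c tm \<Rightarrow> 'c tm \<Rightarrow> bool" where
  "fam G A F \<equiv> has G F (TFun (TEl A) TSet)"

lemma ctx_set: "ctx G \<Longrightarrow> ctx (TSet # G)"
  by (intro derives.ctx_ext derives.set_form)

lemma ctx_el: "ctx G \<Longrightarrow> has G A TSet \<Longrightarrow> ctx (TEl A # G)"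
  by (intro derives.ctx_ext derives.el_form)

lemma weak:
  assumes "ctx (A # G)" "derives Th G j"
  shows "derives Th (A # G) (ren_jdg Suc j)"
  by (rule derives_ren[OF assms(2,1)]) simp

lemmas weak_tm = weak[where j = "HasTy a A" for a A, simplified]

text \<open>Inserts \<open>A\<close> beneath the topmost variable. This moves a judgement about a
  variable proposition into a context with more hypotheses while the proposition stays on
  top.\<close>

lemma weak1:
  assumes "ctx (ren_ty Suc C # A # G)" "derives Th (C # G) j"
  shows "derives Th (ren_ty Suc C # A # G) (ren_jdg (up Suc) j)"
proof (rule derives_ren[OF assms(2,1)])
  fix i assume "i < length (C # G)"
  then show "up Suc i < length (ren_ty Suc C # A # G) \<and>
      var_ty (ren_ty Suc C # A # G) (up Suc i) = ren_ty (up Suc) (var_ty (C # G) i)"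
    by (cases i) auto
qed

lemma inh_weak: "ctx (A # G) \<Longrightarrow> inh G B \<Longrightarrow> inh (A # G) (ren_tm Suc B)"
  unfolding inh_def using weak_tm by fastforce

lemma var_0: "ctx (A # G) \<Longrightarrow> has (A # G) (Var 0) (ren_ty Suc A)"
  using derives.var[of Th "A # G" 0] by simp

lemma inh_var_0: "ctx (TEl A # G) \<Longrightarrow> inh (TEl A # G) (ren_tm Suc A)"
  using var_0 unfolding inh_def by fastforce

lemma set_var_0: "ctx (TSet # G) \<Longrightarrow> has (TSet # G) (Var 0) TSet"
  using var_0 by fastforce

text \<open>The axiom has the empty context, so \<open>subst\<close> asks for no terms and its
  substitution can be \<open>undefined\<close>; closedness of \<open>j\<close> makes the result
  \<open>j\<close> again.\<close>

lemma closed_ax: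
  assumes "([], j) \<in> Th" "ctx G" "\<And>s. sub_jdg s j = j"
  shows "derives Th G j"
  using derives.subst[OF derives.ax[OF assms(1)] assms(2), of undefined] assms(3) by simp

lemma axioms: "\<forall>j \<in> ctt_typings. j 0 [] \<in> Th" "\<forall>j \<in> ctt_equations. j 0 [] \<in> Th"
  using CTT unfolding CTT_def by blast+

lemmas typing_axioms = axioms(1)[simplified ctt_typings_def term_simps, simplified,
  unfolded eval_nat_numeral BitM.simps One_nat_def]

lemma const_tys:
  assumes "ctx G"
  shows "has G (cst cN0) TSet"
    and "has G (cst cN1) TSet"
    and "has G (cst cStar) (TEl (cst cN1))"
    and "has G (cst cU) TSet"
    and "has G (cst cT) (TFun (TEl (cst cU)) TSet)"
    and "has G (cst cN0u) (TEl (cst cU))"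
    and "has G (cst cN1u) (TEl (cst cU))"
    and "has G (cst cCase0) (TFun (TFun (TEl (cst cN0)) TSet) (TFun (TEl (cst cN0)) (TEl (App (Var (Suc 0)) (Var 0)))))"
    and "has G (cst cPi) (TFun TSet (TFun (TFun (TEl (Var 0)) TSet) TSet))"
    and "has G (cst cSigma) (TFun TSet (TFun (TFun (TEl (Var 0)) TSet) TSet))"
    and "has G (cst cLambda) (TFun TSet (TFun (TFun (TEl (Var 0)) TSet)
      (TFun (TFun (TEl (Var (Suc 0))) (TEl (App (Var (Suc 0)) (Var 0))))
        (TEl (app2 (cst cPi) (Var (Suc (Suc 0))) (Var (Suc 0)))))))"
    and "has G (cst cAp) (TFun TSet (TFun (TFun (TEl (Var 0)) TSet)
      (TFun (TEl (app2 (cst cPi) (Var (Suc 0)) (Var 0)))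
        (TFun (TEl (Var (Suc (Suc 0)))) (TEl (App (Var (Suc (Suc 0))) (Var 0)))))))"
    and "has G (cst cPair) (TFun TSet (TFun (TFun (TEl (Var 0)) TSet)
      (TFun (TEl (Var (Suc 0))) (TFun (TEl (App (Var (Suc 0)) (Var 0)))
        (TEl (app2 (cst cSigma) (Var (Suc (Suc (Suc 0)))) (Var (Suc (Suc 0)))))))))"
    and "has G (cst cSplit) (TFun TSet (TFun (TFun (TEl (Var 0)) TSet)
      (TFun (TFun (TEl (app2 (cst cSigma) (Var (Suc 0)) (Var 0))) TSet)
      (TFun (TFun (TEl (Var (Suc (Suc 0)))) (TFun (TEl (App (Var (Suc (Suc 0))) (Var 0)))
          (TEl (App (Var (Suc (Suc 0))) (App (App (app2 (cst cPair) (Var (Suc (Suc (Suc (Suc 0))))) (Var (Suc (Suc (Suc 0))))) (Var (Suc 0))) (Var 0))))))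
      (TFun (TEl (app2 (cst cSigma) (Var (Suc (Suc (Suc 0)))) (Var (Suc (Suc 0)))))
        (TEl (App (Var (Suc (Suc 0))) (Var 0))))))))"
  by (rule closed_ax[OF _ assms], simp add: typing_axioms, simp)+

lemma T_N0u: "ctx G \<Longrightarrow> derives Th G (EqTm (App (cst cT) (cst cN0u)) (cst cN0) TSet)"
  and T_N1u: "ctx G \<Longrightarrow> derives Th G (EqTm (App (cst cT) (cst cN1u)) (cst cN1) TSet)"
  using axioms(2)[simplified ctt_equations_def term_simps, simplified] by (auto intro!: closed_ax)

text \<open>The axiom lives in a context of six variables, the last of which has index 0. One use of
  \<open>subst\<close> fills them all, which is why \<open>?s\<close> lists the terms from
  \<open>y\<close> back to \<open>A\<close>.\<close>

lemma split_eq: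
  fixes A F C g x y :: "'c tm"
  assumes "ctx G" "has G A TSet" "fam G A F" "fam G (app2 (cst cSigma) A F) C"
    and "has G g (TFun (TEl A) (TFun (TEl (App (ren_tm Suc F) (Var 0)))
          (TEl (App (ren_tm Suc (ren_tm Suc C)) (App (App (app2 (cst cPair) (ren_tm Suc (ren_tm Suc A)) (ren_tm Suc (ren_tm Suc F))) (Var (Suc 0))) (Var 0))))))"
    and "has G x (TEl A)" "has G y (TEl (App F x))"
  shows "derives Th G (EqTm (App (app2 (app2 (cst cSplit) A F) C g) (app2 (app2 (cst cPair) A F) x y)) (app2 g x y)
    (TEl (App C (app2 (app2 (cst cPair) A F) x y))))"
proof -
  let ?s = "case_nat y (case_nat x (case_nat g (case_nat C (case_nat F (case_nat A Var)))))"
  obtain D j where ax: "(D, j) \<in> Th"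
    and D: "D = [TEl (App (Var (Suc (Suc (Suc 0)))) (Var 0)), TEl (Var (Suc (Suc (Suc 0)))),
      TFun (TEl (Var (Suc (Suc 0)))) (TFun (TEl (App (Var (Suc (Suc 0))) (Var 0)))
          (TEl (App (Var (Suc (Suc 0))) (App (App (app2 (cst cPair) (Var (Suc (Suc (Suc (Suc 0))))) (Var (Suc (Suc (Suc 0))))) (Var (Suc 0))) (Var 0))))),
      TFun (TEl (app2 (cst cSigma) (Var (Suc 0)) (Var 0))) TSet, TFun (TEl (Var 0)) TSet, TSet]"
    and j: "sub_jdg ?s j = EqTm (App (app2 (app2 (cst cSplit) A F) C g) (app2 (app2 (cst cPair) A F) x y)) (app2 g x y)
    (TEl (App C (app2 (app2 (cst cPair) A F) x y)))"
    using axioms(2)[simplified ctt_equations_def term_simps, simplified] by (auto simp: eval_nat_numeral)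
  have "has G (?s i) (sub_ty ?s (var_ty D i))" if "i < length D" for i
  proof -
    from that consider "i = 0" | "i = Suc 0" | "i = Suc (Suc 0)" | "i = Suc (Suc (Suc 0))"
      | "i = Suc (Suc (Suc (Suc 0)))" | "i = Suc (Suc (Suc (Suc (Suc 0))))"
      by (auto simp: D less_Suc_eq)
    then show ?thesis by cases (use assms in \<open>simp_all add: D\<close>)
  qed
  from derives.subst[OF derives.ax[OF ax] assms(1) this] show ?thesis by (simp only: j)
qed

section \<open>Introduction and elimination rules for the connectives\<close>

lemma app_ty: "has G f (TFun A B) \<Longrightarrow> has G a A \<Longrightarrow> inst_ty a B = B' \<Longrightarrow> has G (App f a) B'"
  using derives.app by blast

lemma fam_app: "fam G A F \<Longrightarrow> has G a (TEl A) \<Longrightarrow> has G (App F a) TSet"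
  by (erule app_ty) (simp_all add: inst_ty_def)

lemma fam_Lam: "has G A TSet \<Longrightarrow> has (TEl A # G) B TSet \<Longrightarrow> fam G A (Lam B)"
  by (intro derives.lam derives.el_form)

text \<open>Families are passed to constants as abstractions, so \<open>App (Lam B) a\<close> and
  \<open>inst_tm a B\<close> are equal by a judgement rather than identical; this is the conversion
  between the two.\<close>

lemma beta_el:
  assumes "has (TEl A # G) B TSet" "has G a (TEl A)"
  shows "derives Th G (EqTy (TEl (App (Lam B) a)) (TEl (inst_tm a B)))"
  using derives.beta[OF assms] by (intro derives.el_cong) (simp add: inst_ty_def)

lemma beta_var:
  assumes "ctx G" "has G A TSet" "has (TEl A # G) B TSet"
  shows "derives Th (TEl A # G) (EqTy (TEl (App (ren_tm Suc (Lam B)) (Var 0))) (TEl B))"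
proof -
  have c: "ctx (TEl A # G)" by (rule ctx_el[OF assms(1,2)])
  have "has (TEl A # G) (ren_tm Suc A) TSet" using weak_tm[OF c assms(2)] by simp
  then have c2: "ctx (TEl (ren_tm Suc A) # TEl A # G)" by (rule ctx_el[OF c])
  have "has (TEl (ren_tm Suc A) # TEl A # G) (ren_tm (up Suc) B) TSet"
    using weak1[of "TEl A" "TEl A" G "HasTy B TSet"] c2 assms(3) by simp
  from beta_el[OF this, of "Var 0"] var_0[OF c] show ?thesis by simp
qed

lemma Pi_form:
  assumes "ctx G" "has G A TSet" "fam G A F"
  shows "has G (app2 (cst cPi) A F) TSet"
proof -
  have "has G (App (cst cPi) A) (TFun (TFun (TEl A) TSet) TSet)"
    by (rule app_ty[OF const_tys(9) assms(2)]) (simp_all add: inst_ty_def assms)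
  then show ?thesis by (rule app_ty[OF _ assms(3)]) (simp add: inst_ty_def)
qed

lemma Sigma_form:
  assumes "ctx G" "has G A TSet" "fam G A F"
  shows "has G (app2 (cst cSigma) A F) TSet"
proof -
  have "has G (App (cst cSigma) A) (TFun (TFun (TEl A) TSet) TSet)"
    by (rule app_ty[OF const_tys(10) assms(2)]) (simp_all add: inst_ty_def assms)
  then show ?thesis by (rule app_ty[OF _ assms(3)]) (simp add: inst_ty_def)
qed

lemma PI_form: "ctx G \<Longrightarrow> has G A TSet \<Longrightarrow> has (TEl A # G) B TSet \<Longrightarrow> has G (PI A B) TSet"
  unfolding PI_def by (intro Pi_form fam_Lam)

lemma SG_form: "ctx G \<Longrightarrow> has G A TSet \<Longrightarrow> has (TEl A # G) B TSet \<Longrightarrow> has G (SG A B) TSet"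
  unfolding SG_def by (intro Sigma_form fam_Lam)

lemma set_weak: "ctx (A # G) \<Longrightarrow> has G B TSet \<Longrightarrow> has (A # G) (ren_tm Suc B) TSet"
  using weak_tm by fastforce

lemma IMP_form: "ctx G \<Longrightarrow> has G A TSet \<Longrightarrow> has G B TSet \<Longrightarrow> has G (IMP A B) TSet"
  unfolding IMP_def by (intro PI_form set_weak ctx_el)

lemma AND_form: "ctx G \<Longrightarrow> has G A TSet \<Longrightarrow> has G B TSet \<Longrightarrow> has G (AND A B) TSet"
  unfolding AND_def by (intro SG_form set_weak ctx_el)

lemma NOT_form: "ctx G \<Longrightarrow> has G A TSet \<Longrightarrow> has G (NOT A) TSet"
  unfolding NOT_def by (intro IMP_form const_tys)

lemma IFF_form: "ctx G \<Longrightarrow> has G A TSet \<Longrightarrow> has G B TSet \<Longrightarrow> has G (IFF A B) TSet"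
  unfolding IFF_def by (intro AND_form IMP_form)

text \<open>\<open>cLambda\<close> takes its arguments one at a time, each partial application being
  given its type explicitly. \<open>beta_var\<close> adapts the body to the family in the form that
  the constant expects.\<close>

lemma PI_intro:
  assumes "ctx G" and A: "has G A TSet" and B: "has (TEl A # G) B TSet" and "inh (TEl A # G) B"
  shows "inh G (PI A B)"
proof -
  from assms(4) obtain b where b: "has (TEl A # G) b (TEl B)" unfolding inh_def by blast
  have fam: "fam G A (Lam B)" by (rule fam_Lam[OF A B])
  have "has (TEl A # G) b (TEl (App (ren_tm Suc (Lam B)) (Var 0)))"
    by (rule derives.conv[OF b derives.ty_sym[OF beta_var[OF assms(1) A B]]])
  then have *: "has G (Lam b) (TFun (TEl A) (TEl (App (ren_tm Suc (Lam B)) (Var 0))))"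
    by (rule derives.lam[OF derives.el_form[OF A]])
  have "has G (App (cst cLambda) A) (TFun (TFun (TEl A) TSet) (TFun (TFun (TEl (ren_tm Suc A)) (TEl (App (Var (Suc 0)) (Var 0))))
        (TEl (app2 (cst cPi) (ren_tm Suc (ren_tm Suc A)) (Var (Suc 0))))))"
    by (rule app_ty[OF const_tys(11) A]) (simp_all add: inst_ty_def assms)
  then have "has G (app2 (cst cLambda) A (Lam B)) (TFun (TFun (TEl A) (TEl (App (ren_tm Suc (Lam B)) (Var 0))))
        (TEl (app2 (cst cPi) (ren_tm Suc A) (ren_tm Suc (Lam B)))))"
    by (rule app_ty[OF _ fam]) (simp add: inst_ty_def)
  then have "has G (App (app2 (cst cLambda) A (Lam B)) (Lam b)) (TEl (PI A B))"
    by (rule app_ty[OF _ *]) (simp add: inst_ty_def PI_def flip: ren_tm.simps)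
  then show ?thesis unfolding inh_def by blast
qed

lemma PI_elim:
  assumes "ctx G" and A: "has G A TSet" and B: "has (TEl A # G) B TSet"
    and "inh G (PI A B)" and a: "has G a (TEl A)"
  shows "inh G (inst_tm a B)"
proof -
  from assms(4) obtain f where f: "has G f (TEl (app2 (cst cPi) A (Lam B)))" unfolding inh_def PI_def by blast
  have fam: "fam G A (Lam B)" by (rule fam_Lam[OF A B])
  have "has G (App (cst cAp) A) (TFun (TFun (TEl A) TSet)
      (TFun (TEl (app2 (cst cPi) (ren_tm Suc A) (Var 0)))
        (TFun (TEl (ren_tm Suc (ren_tm Suc A))) (TEl (App (Var (Suc (Suc 0))) (Var 0))))))"
    by (rule app_ty[OF const_tys(12) A]) (simp_all add: inst_ty_def assms)
  then have "has G (app2 (cst cAp) A (Lam B)) (TFun (TEl (app2 (cst cPi) A (Lam B)))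
        (TFun (TEl (ren_tm Suc A)) (TEl (App (ren_tm Suc (ren_tm Suc (Lam B))) (Var 0)))))"
    by (rule app_ty[OF _ fam]) (simp add: inst_ty_def)
  then have "has G (App (app2 (cst cAp) A (Lam B)) f) (TFun (TEl A) (TEl (App (ren_tm Suc (Lam B)) (Var 0))))"
    by (rule app_ty[OF _ f]) (simp add: inst_ty_def del: ren_tm.simps)
  then have "has G (App (App (app2 (cst cAp) A (Lam B)) f) a) (TEl (App (Lam B) a))"
    by (rule app_ty[OF _ a]) (simp add: inst_ty_def del: ren_tm.simps)
  from derives.conv[OF this beta_el[OF B a]] show ?thesis unfolding inh_def by blast
qed

lemma pair_ty:
  assumes "ctx G" "has G A TSet" "fam G A F"
  shows "has G (app2 (cst cPair) A F) (TFun (TEl A) (TFun (TEl (App (ren_tm Suc F) (Var 0)))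
        (TEl (app2 (cst cSigma) (ren_tm Suc (ren_tm Suc A)) (ren_tm Suc (ren_tm Suc F))))))"
proof -
  have "has G (App (cst cPair) A) (TFun (TFun (TEl A) TSet)
      (TFun (TEl (ren_tm Suc A)) (TFun (TEl (App (Var (Suc 0)) (Var 0)))
        (TEl (app2 (cst cSigma) (ren_tm Suc (ren_tm Suc (ren_tm Suc A))) (Var (Suc (Suc 0))))))))"
    by (rule app_ty[OF const_tys(13) assms(2)]) (simp_all add: inst_ty_def assms)
  then show ?thesis by (rule app_ty[OF _ assms(3)]) (simp add: inst_ty_def)
qed

lemma pair_app:
  assumes "ctx G" "has G A TSet" "fam G A F" and a: "has G a (TEl A)" and b: "has G b (TEl (App F a))"
  shows "has G (app2 (app2 (cst cPair) A F) a b) (TEl (app2 (cst cSigma) A F))"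
proof -
  have "has G (App (app2 (cst cPair) A F) a) (TFun (TEl (App F a)) (TEl (app2 (cst cSigma) (ren_tm Suc A) (ren_tm Suc F))))"
    by (rule app_ty[OF pair_ty[OF assms(1-3)] a]) (simp add: inst_ty_def)
  then show ?thesis by (rule app_ty[OF _ b]) (simp add: inst_ty_def)
qed

lemma SG_intro:
  assumes "ctx G" and A: "has G A TSet" and B: "has (TEl A # G) B TSet"
    and a: "has G a (TEl A)" and "inh G (inst_tm a B)"
  shows "inh G (SG A B)"
proof -
  from assms(5) obtain b where "has G b (TEl (inst_tm a B))" unfolding inh_def by blast
  then have "has G b (TEl (App (Lam B) a))" using derives.ty_sym[OF beta_el[OF B a]] by (rule derives.conv)
  from pair_app[OF assms(1) A fam_Lam[OF A B] a this] show ?thesis unfolding inh_def SG_def by blast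
qed

lemma split_ty:
  assumes "ctx G" "has G A TSet" "fam G A F" and C: "fam G (app2 (cst cSigma) A F) C"
    and g: "has G g (TFun (TEl A) (TFun (TEl (App (ren_tm Suc F) (Var 0)))
          (TEl (App (ren_tm Suc (ren_tm Suc C)) (App (App (app2 (cst cPair) (ren_tm Suc (ren_tm Suc A)) (ren_tm Suc (ren_tm Suc F))) (Var (Suc 0))) (Var 0))))))"
    and p: "has G p (TEl (app2 (cst cSigma) A F))"
  shows "has G (App (app2 (app2 (cst cSplit) A F) C g) p) (TEl (App C p))"
proof -
  have "has G (App (cst cSplit) A) (TFun (TFun (TEl A) TSet)
      (TFun (TFun (TEl (app2 (cst cSigma) (ren_tm Suc A) (Var 0))) TSet)
      (TFun (TFun (TEl (ren_tm Suc (ren_tm Suc A))) (TFun (TEl (App (Var (Suc (Suc 0))) (Var 0)))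
          (TEl (App (Var (Suc (Suc 0))) (App (App (app2 (cst cPair) (ren_tm Suc (ren_tm Suc (ren_tm Suc (ren_tm Suc A)))) (Var (Suc (Suc (Suc 0))))) (Var (Suc 0))) (Var 0))))))
      (TFun (TEl (app2 (cst cSigma) (ren_tm Suc (ren_tm Suc (ren_tm Suc A))) (Var (Suc (Suc 0)))))
        (TEl (App (Var (Suc (Suc 0))) (Var 0)))))))"
    by (rule app_ty[OF const_tys(14) assms(2)]) (simp_all add: inst_ty_def assms)
  then have "has G (app2 (cst cSplit) A F)
      (TFun (TFun (TEl (app2 (cst cSigma) A F)) TSet)
      (TFun (TFun (TEl (ren_tm Suc A)) (TFun (TEl (App (ren_tm Suc (ren_tm Suc F)) (Var 0)))
          (TEl (App (Var (Suc (Suc 0))) (App (App (app2 (cst cPair) (ren_tm Suc (ren_tm Suc (ren_tm Suc A))) (ren_tm Suc (ren_tm Suc (ren_tm Suc F)))) (Var (Suc 0))) (Var 0))))))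
      (TFun (TEl (app2 (cst cSigma) (ren_tm Suc (ren_tm Suc A)) (ren_tm Suc (ren_tm Suc F))))
        (TEl (App (Var (Suc (Suc 0))) (Var 0))))))"
    by (rule app_ty[OF _ assms(3)]) (simp add: inst_ty_def)
  then have "has G (App (app2 (cst cSplit) A F) C)
      (TFun (TFun (TEl A) (TFun (TEl (App (ren_tm Suc F) (Var 0)))
          (TEl (App (ren_tm Suc (ren_tm Suc C)) (App (App (app2 (cst cPair) (ren_tm Suc (ren_tm Suc A)) (ren_tm Suc (ren_tm Suc F))) (Var (Suc 0))) (Var 0))))))
      (TFun (TEl (app2 (cst cSigma) (ren_tm Suc A) (ren_tm Suc F)))
        (TEl (App (ren_tm Suc (ren_tm Suc C)) (Var 0)))))"
    by (rule app_ty[OF _ C]) (simp add: inst_ty_def)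
  then have "has G (app2 (app2 (cst cSplit) A F) C g)
      (TFun (TEl (app2 (cst cSigma) A F)) (TEl (App (ren_tm Suc C) (Var 0))))"
    by (rule app_ty[OF _ g]) (simp add: inst_ty_def)
  then show ?thesis by (rule app_ty[OF _ p]) (simp add: inst_ty_def)
qed

definition fst_tm :: "'c tm \<Rightarrow> 'c tm \<Rightarrow> 'c tm \<Rightarrow> 'c tm" where
  "fst_tm A F p = App (app2 (app2 (cst cSplit) A F) (Lam (ren_tm Suc A)) (Lam (Lam (Var (Suc 0))))) p"

text \<open>The equation on pairs is needed as well as the typing: the type of the second projection
  mentions the first.\<close>

lemma fst_tm:
  assumes "ctx G" and A: "has G A TSet" and F: "fam G A F"
  shows fst_tm_ty: "has G p (TEl (app2 (cst cSigma) A F)) \<Longrightarrow> has G (fst_tm A F p) (TEl A)"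
    and fst_tm_eq: "has G x (TEl A) \<Longrightarrow> has G y (TEl (App F x)) \<Longrightarrow>
      derives Th G (EqTm (fst_tm A F (app2 (app2 (cst cPair) A F) x y)) x (TEl A))"
proof -
  let ?S = "app2 (cst cSigma) A F" and ?C = "Lam (ren_tm Suc A)" and ?g = "Lam (Lam (Var (Suc 0)))"
  have S: "has G ?S TSet" by (rule Sigma_form[OF assms])
  have cS: "ctx (TEl ?S # G)" by (rule ctx_el[OF assms(1) S])
  have A_S: "has (TEl ?S # G) (ren_tm Suc A) TSet" by (rule set_weak[OF cS A])
  have C: "fam G ?S ?C" by (rule fam_Lam[OF S A_S])
  let ?G1 = "TEl A # G"
  have c1: "ctx ?G1" by (rule ctx_el[OF assms(1) A])
  have F1: "fam ?G1 (ren_tm Suc A) (ren_tm Suc F)" using weak_tm[OF c1 F] by simp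
  have A1: "has ?G1 (ren_tm Suc A) TSet" by (rule set_weak[OF c1 A])
  have v1: "has ?G1 (Var 0) (TEl (ren_tm Suc A))" using var_0[OF c1] by simp
  have B: "has ?G1 (App (ren_tm Suc F) (Var 0)) TSet" by (rule fam_app[OF F1 v1])
  let ?G2 = "TEl (App (ren_tm Suc F) (Var 0)) # ?G1"
  let ?A2 = "ren_tm Suc (ren_tm Suc A)" and ?F2 = "ren_tm Suc (ren_tm Suc F)"
  have c2: "ctx ?G2" by (rule ctx_el[OF c1 B])
  have F2: "fam ?G2 ?A2 ?F2" using weak_tm[OF c2 F1] by simp
  have A2: "has ?G2 ?A2 TSet" by (rule set_weak[OF c2 A1])
  have x2: "has ?G2 (Var (Suc 0)) (TEl ?A2)" using weak_tm[OF c2 v1] by simp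
  have y2: "has ?G2 (Var 0) (TEl (App ?F2 (Var (Suc 0))))" using var_0[OF c2] by simp
  have pr: "has ?G2 (app2 (app2 (cst cPair) ?A2 ?F2) (Var (Suc 0)) (Var 0)) (TEl (app2 (cst cSigma) ?A2 ?F2))"
    by (rule pair_app[OF c2 A2 F2 x2 y2])
  have S2: "has ?G2 (app2 (cst cSigma) ?A2 ?F2) TSet" by (rule Sigma_form[OF c2 A2 F2])
  have "has (TEl (app2 (cst cSigma) ?A2 ?F2) # ?G2) (ren_tm Suc ?A2) TSet"
    by (rule set_weak[OF ctx_el[OF c2 S2] A2])
  from derives.ty_sym[OF beta_el[OF this pr]]
  have "has ?G2 (Var (Suc 0)) (TEl (App (Lam (ren_tm Suc ?A2)) (app2 (app2 (cst cPair) ?A2 ?F2) (Var (Suc 0)) (Var 0))))"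
    by (intro derives.conv[OF x2]) simp
  then have g: "has G ?g (TFun (TEl A) (TFun (TEl (App (ren_tm Suc F) (Var 0)))
          (TEl (App (ren_tm Suc (ren_tm Suc ?C)) (App (App (app2 (cst cPair) ?A2 ?F2) (Var (Suc 0))) (Var 0))))))"
    using A B by (intro derives.lam derives.el_form) simp_all
  have beta: "derives Th G (EqTy (TEl (App ?C p)) (TEl A))" if "has G p (TEl ?S)" for p
    using beta_el[OF A_S that] by simp
  show "has G (fst_tm A F p) (TEl A)" if "has G p (TEl ?S)"
    unfolding fst_tm_def by (rule derives.conv[OF split_ty[OF assms C g that] beta[OF that]])
  show "derives Th G (EqTm (fst_tm A F (app2 (app2 (cst cPair) A F) x y)) x (TEl A))"
    if x: "has G x (TEl A)" and y: "has G y (TEl (App F x))"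
  proof -
    have "derives Th G (EqTm (fst_tm A F (app2 (app2 (cst cPair) A F) x y)) (app2 ?g x y) (TEl A))"
      unfolding fst_tm_def
      by (rule derives.conv_eq[OF split_eq[OF assms C g x y] beta[OF pair_app[OF assms x y]]])
    moreover have "has ?G1 (Lam (Var (Suc 0))) (TFun (TEl (App (ren_tm Suc F) (Var 0))) (TEl ?A2))"
      by (rule derives.lam[OF derives.el_form[OF B] x2])
    from derives.beta[OF this x]
    have "derives Th G (EqTm (App ?g x) (Lam (ren_tm Suc x)) (TFun (TEl (App F x)) (TEl (ren_tm Suc A))))"
      by (simp add: inst_tm_def inst_ty_def)
    from derives.app_cong[OF this derives.tm_refl[OF y]]
    have "derives Th G (EqTm (app2 ?g x y) (App (Lam (ren_tm Suc x)) y) (TEl A))"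
      by (simp add: inst_ty_def)
    moreover have cy: "ctx (TEl (App F x) # G)" by (rule ctx_el[OF assms(1) fam_app[OF F x]])
    have "has (TEl (App F x) # G) (ren_tm Suc x) (TEl (ren_tm Suc A))" using weak_tm[OF cy x] by simp
    from derives.beta[OF this y]
    have "derives Th G (EqTm (App (Lam (ren_tm Suc x)) y) x (TEl A))" by (simp add: inst_ty_def)
    ultimately show ?thesis by (meson derives.tm_trans)
  qed
qed

text \<open>Both projections are terms of the same context. In a context with a propositional
  variable the first one is a choice of index depending on the proposition, as the uniformity
  principle demands.\<close>

lemma Sigma_elim:
  assumes "ctx G" and A: "has G A TSet" and F: "fam G A F" and p: "has G p (TEl (app2 (cst cSigma) A F))"
  obtains a b where "has G a (TEl A)" "has G b (TEl (App F a))"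
proof -
  \<comment> \<open>The motive for the second projection is the family \<open>F\<close> at the first
    projection of the argument.\<close>
  let ?S = "app2 (cst cSigma) A F" and ?B = "App (ren_tm Suc F) (fst_tm (ren_tm Suc A) (ren_tm Suc F) (Var 0))"
  let ?C = "Lam ?B" and ?g = "Lam (Lam (Var 0))"
  have S: "has G ?S TSet" by (rule Sigma_form[OF assms(1-3)])
  have cS: "ctx (TEl ?S # G)" by (rule ctx_el[OF assms(1) S])
  have A_S: "has (TEl ?S # G) (ren_tm Suc A) TSet" by (rule set_weak[OF cS A])
  have F_S: "fam (TEl ?S # G) (ren_tm Suc A) (ren_tm Suc F)" using weak_tm[OF cS F] by simp
  have B_S: "has (TEl ?S # G) ?B TSet"
    by (rule fam_app[OF F_S fst_tm_ty[OF cS A_S F_S]]) (use var_0[OF cS] in simp)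
  have C: "fam G ?S ?C" by (rule fam_Lam[OF S B_S])
  let ?G1 = "TEl A # G"
  have c1: "ctx ?G1" by (rule ctx_el[OF assms(1) A])
  have F1: "fam ?G1 (ren_tm Suc A) (ren_tm Suc F)" using weak_tm[OF c1 F] by simp
  have A1: "has ?G1 (ren_tm Suc A) TSet" by (rule set_weak[OF c1 A])
  have C1: "fam ?G1 (ren_tm Suc ?S) (ren_tm Suc ?C)" using weak_tm[OF c1 C] by simp
  have v1: "has ?G1 (Var 0) (TEl (ren_tm Suc A))" using var_0[OF c1] by simp
  have B: "has ?G1 (App (ren_tm Suc F) (Var 0)) TSet" by (rule fam_app[OF F1 v1])
  let ?G2 = "TEl (App (ren_tm Suc F) (Var 0)) # ?G1"
  let ?A2 = "ren_tm Suc (ren_tm Suc A)" and ?F2 = "ren_tm Suc (ren_tm Suc F)"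
  let ?p2 = "app2 (app2 (cst cPair) ?A2 ?F2) (Var (Suc 0)) (Var 0)"
  have c2: "ctx ?G2" by (rule ctx_el[OF c1 B])
  have F2: "fam ?G2 ?A2 ?F2" using weak_tm[OF c2 F1] by simp
  have A2: "has ?G2 ?A2 TSet" by (rule set_weak[OF c2 A1])
  have x2: "has ?G2 (Var (Suc 0)) (TEl ?A2)" using weak_tm[OF c2 v1] by simp
  have y2: "has ?G2 (Var 0) (TEl (App ?F2 (Var (Suc 0))))" using var_0[OF c2] by simp
  have pr: "has ?G2 ?p2 (TEl (app2 (cst cSigma) ?A2 ?F2))"
    by (rule pair_app[OF c2 A2 F2 x2 y2])
  let ?S2 = "app2 (cst cSigma) ?A2 ?F2"
  have S2: "has ?G2 ?S2 TSet" by (rule Sigma_form[OF c2 A2 F2])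
  have cS2: "ctx (TEl ?S2 # ?G2)" by (rule ctx_el[OF c2 S2])
  have A_S2: "has (TEl ?S2 # ?G2) (ren_tm Suc ?A2) TSet" by (rule set_weak[OF cS2 A2])
  have F_S2: "fam (TEl ?S2 # ?G2) (ren_tm Suc ?A2) (ren_tm Suc ?F2)" using weak_tm[OF cS2 F2] by simp
  have "has (TEl ?S2 # ?G2) (App (ren_tm Suc ?F2) (fst_tm (ren_tm Suc ?A2) (ren_tm Suc ?F2) (Var 0))) TSet"
    by (rule fam_app[OF F_S2 fst_tm_ty[OF cS2 A_S2 F_S2]]) (use var_0[OF cS2] in simp)
  from beta_el[OF this pr]
  have beta2: "derives Th ?G2 (EqTy (TEl (App (ren_tm Suc (ren_tm Suc ?C)) ?p2)) (TEl (App ?F2 (fst_tm ?A2 ?F2 ?p2))))"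
    by (simp add: inst_tm_def fst_tm_def)
  \<comment> \<open>On a pair the motive reduces to \<open>F\<close> at the first component, so the
    abstraction returning the second component has the required type.\<close>
  have "derives Th ?G2 (EqTm (App ?F2 (fst_tm ?A2 ?F2 ?p2)) (App ?F2 (Var (Suc 0))) TSet)"
    using derives.app_cong[OF derives.tm_refl[OF F2] fst_tm_eq[OF c2 A2 F2 x2 y2]] by (simp add: inst_ty_def)
  from derives.conv[OF y2 derives.ty_sym[OF derives.ty_trans[OF beta2 derives.el_cong[OF this]]]]
  have "has ?G2 (Var 0) (TEl (App (ren_tm Suc (ren_tm Suc ?C)) ?p2))"
    .
  then have g: "has G ?g (TFun (TEl A) (TFun (TEl (App (ren_tm Suc F) (Var 0)))
          (TEl (App (ren_tm Suc (ren_tm Suc ?C)) (App (App (app2 (cst cPair) ?A2 ?F2) (Var (Suc 0))) (Var 0))))))"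
    using A B by (intro derives.lam derives.el_form) simp_all
  have "derives Th G (EqTy (TEl (App ?C p)) (TEl (App F (fst_tm A F p))))"
    using beta_el[OF B_S p] by (simp add: inst_tm_def fst_tm_def)
  from derives.conv[OF split_ty[OF assms(1-3) C g p] this] fst_tm_ty[OF assms(1-4)] that
  show thesis by blast
qed

lemma SG_elim:
  assumes "ctx G" and A: "has G A TSet" and B: "has (TEl A # G) B TSet" and "inh G (SG A B)"
  obtains a b where "has G a (TEl A)" "has G b (TEl (inst_tm a B))"
proof -
  from assms(4) obtain p where "has G p (TEl (app2 (cst cSigma) A (Lam B)))" unfolding inh_def SG_def by blast
  then obtain a b where a: "has G a (TEl A)" and b: "has G b (TEl (App (Lam B) a))"
    using Sigma_elim[OF assms(1) A fam_Lam[OF A B]] by blast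
  from derives.conv[OF b beta_el[OF B a]] a that show thesis by blast
qed

lemma IMP_intro:
  "ctx G \<Longrightarrow> has G A TSet \<Longrightarrow> has G B TSet \<Longrightarrow> inh (TEl A # G) (ren_tm Suc B) \<Longrightarrow> inh G (IMP A B)"
  unfolding IMP_def by (intro PI_intro set_weak ctx_el)

lemma IMP_elim:
  assumes "ctx G" "has G A TSet" "has G B TSet" "inh G (IMP A B)" "inh G A"
  shows "inh G B"
proof -
  from assms(5) obtain a where "has G a (TEl A)" unfolding inh_def by blast
  from PI_elim[OF assms(1,2) set_weak[OF ctx_el[OF assms(1,2)] assms(3)] assms(4)[unfolded IMP_def] this]
  show ?thesis by simp
qed

lemma AND_intro:
  assumes "ctx G" "has G A TSet" "has G B TSet" "inh G A" "inh G B"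
  shows "inh G (AND A B)"
proof -
  from assms(4) obtain a where "has G a (TEl A)" unfolding inh_def by blast
  from SG_intro[OF assms(1,2) set_weak[OF ctx_el[OF assms(1,2)] assms(3)] this] assms(5)
  show ?thesis unfolding AND_def by simp
qed

lemma AND_elim:
  assumes "ctx G" "has G A TSet" "has G B TSet" "inh G (AND A B)"
  shows "inh G A" "inh G B"
proof -
  obtain a b where "has G a (TEl A)" "has G b (TEl (inst_tm a (ren_tm Suc B)))"
    using SG_elim[OF assms(1,2) set_weak[OF ctx_el[OF assms(1,2)] assms(3)] assms(4)[unfolded AND_def]] by blast
  then show "inh G A" "inh G B" unfolding inh_def by auto
qed

lemma NOT_intro: "ctx G \<Longrightarrow> has G A TSet \<Longrightarrow> inh (TEl A # G) (cst cN0) \<Longrightarrow> inh G (NOT A)"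
  unfolding NOT_def by (rule IMP_intro) (simp_all add: const_tys)

lemma NOT_elim: "ctx G \<Longrightarrow> has G A TSet \<Longrightarrow> inh G (NOT A) \<Longrightarrow> inh G A \<Longrightarrow> inh G (cst cN0)"
  unfolding NOT_def using IMP_elim const_tys(1) by blast

lemma IFF_elim:
  assumes "ctx G" "has G A TSet" "has G B TSet" "inh G (IFF A B)"
  shows "inh G A \<longleftrightarrow> inh G B"
  using AND_elim[OF assms(1) IMP_form[OF assms(1-3)] IMP_form[OF assms(1,3,2)] assms(4)[unfolded IFF_def]]
    IMP_elim assms by blast

lemma N0_elim:
  assumes "ctx G" "has G A TSet" "inh G (cst cN0)"
  shows "inh G A"
proof -
  from assms(3) obtain c where c: "has G c (TEl (cst cN0))" unfolding inh_def by blast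
  have A: "has (TEl (cst cN0) # G) (ren_tm Suc A) TSet"
    by (rule set_weak[OF ctx_el[OF assms(1) const_tys(1)[OF assms(1)]] assms(2)])
  have "has G (App (cst cCase0) (Lam (ren_tm Suc A)))
      (TFun (TEl (cst cN0)) (TEl (App (ren_tm Suc (Lam (ren_tm Suc A))) (Var 0))))"
    by (rule app_ty[OF const_tys(8) fam_Lam[OF const_tys(1) A]]) (simp_all add: inst_ty_def assms)
  then have "has G (App (App (cst cCase0) (Lam (ren_tm Suc A))) c) (TEl (App (Lam (ren_tm Suc A)) c))"
    by (rule app_ty[OF _ c]) (simp add: inst_ty_def del: ren_tm.simps)
  from derives.conv[OF this beta_el[OF A c]] show ?thesis unfolding inh_def by auto
qed

end

abbreviation sh :: "'c tm \<Rightarrow> 'c tm" where "sh \<equiv> ren_tm Suc"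

text \<open>
  Excluded middle for \<open>Q\<close>, in the form that \<open>Q\<close> is equivalent to a small proposition: taking
  \<open>Q\<close> to be the negation of \<open>cT\<close> at a uniform code \<open>u\<close> refutes it.
\<close>

definition DEC :: "'c tm \<Rightarrow> 'c tm" where
  "DEC Q = SG (cst cU) (IFF (sh Q) (App (cst cT) (Var 0)))"

definition RC :: "'c tm \<Rightarrow> 'c tm \<Rightarrow> 'c tm \<Rightarrow> 'c tm \<Rightarrow> 'c tm" where
  "RC S l x U = PI S (IMP (PI (sh S) (IMP (App (sh (sh U)) (Var 0)) (app2 (sh (sh l)) (Var 0) (Var (Suc 0)))))
     (app2 (sh l) (sh x) (Var 0)))"

definition SUBS :: "'c tm \<Rightarrow> 'c tm \<Rightarrow> 'c tm \<Rightarrow> 'c tm" where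
  "SUBS S V U = PI S (IMP (App (sh V) (Var 0)) (App (sh U) (Var 0)))"

lemma ren_defs [simp]:
  "ren_tm r (DEC Q) = DEC (ren_tm r Q)"
  "ren_tm r (RC S l x U) = RC (ren_tm r S) (ren_tm r l) (ren_tm r x) (ren_tm r U)"
  "ren_tm r (SUBS S V U) = SUBS (ren_tm r S) (ren_tm r V) (ren_tm r U)"
  by (simp_all add: DEC_def RC_def SUBS_def)

lemma sub_defs [simp]:
  "sub_tm s (DEC Q) = DEC (sub_tm s Q)"
  "sub_tm s (RC S l x U) = RC (sub_tm s S) (sub_tm s l) (sub_tm s x) (sub_tm s U)"
  "sub_tm s (SUBS S V U) = SUBS (sub_tm s S) (sub_tm s V) (sub_tm s U)"
  by (simp_all add: DEC_def RC_def SUBS_def)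

context ctt
begin

lemma inhI: "has G t (TEl A) \<Longrightarrow> inh G A"
  unfolding inh_def by blast

lemma T_ty: "ctx G \<Longrightarrow> has G u (TEl (cst cU)) \<Longrightarrow> has G (App (cst cT) u) TSet"
  by (rule fam_app[OF const_tys(5)])

lemma U_ctx: "ctx G \<Longrightarrow> ctx (TEl (cst cU) # G)"
  by (intro ctx_el const_tys)

lemma U_var: "ctx G \<Longrightarrow> has (TEl (cst cU) # G) (Var 0) (TEl (cst cU))"
  using var_0[OF U_ctx] by simp

lemma DEC_body: "ctx G \<Longrightarrow> has G Q TSet \<Longrightarrow> has (TEl (cst cU) # G) (IFF (sh Q) (App (cst cT) (Var 0))) TSet"
  by (intro IFF_form T_ty set_weak U_ctx U_var)

lemma DEC_form: "ctx G \<Longrightarrow> has G Q TSet \<Longrightarrow> has G (DEC Q) TSet"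
  unfolding DEC_def by (intro SG_form DEC_body const_tys)

lemma inh_T_N0u: "ctx G \<Longrightarrow> inh G (App (cst cT) (cst cN0u)) \<Longrightarrow> inh G (cst cN0)"
  using derives.conv[OF _ derives.el_cong[OF T_N0u]] unfolding inh_def by blast

lemma inh_T_N1u: "ctx G \<Longrightarrow> inh G (App (cst cT) (cst cN1u))"
  by (rule inhI[OF derives.conv[OF const_tys(3) derives.ty_sym[OF derives.el_cong[OF T_N1u]]]])

text \<open>If \<open>Q\<close> holds, the code of \<open>cN1\<close> decides it, so
  \<open>Q\<close> is refuted; but a refuted \<open>Q\<close> is decided by the code of
  \<open>cN0\<close>.\<close>

lemma not_not_DEC:
  assumes c: "ctx G" and Q: "has G Q TSet" and no: "inh G (NOT (DEC Q))"
  shows "inh G (cst cN0)"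
proof -
  have DEC: "inh H (DEC X)"
    if c: "ctx H" and X: "has H X TSet" and u: "has H u (TEl (cst cU))"
      and 1: "inh (TEl X # H) (App (cst cT) (sh u))" and 2: "inh (TEl (App (cst cT) u) # H) (sh X)" for H X u
  proof -
    note T = T_ty[OF c u]
    have "inh H (IFF X (App (cst cT) u))"
      unfolding IFF_def by (intro AND_intro IMP_intro IMP_form c X T) (use 1 2 in simp_all)
    then show ?thesis unfolding DEC_def
      by (intro SG_intro[OF c const_tys(4)[OF c] DEC_body[OF c X] u]) (simp add: inst_tm_def)
  qed
  have c1: "ctx (TEl Q # G)" by (rule ctx_el[OF c Q])
  note Q1 = set_weak[OF c1 Q]
  note c2 = ctx_el[OF c1 Q1]
  have "inh (TEl Q # G) (cst cN0)"
  proof (rule NOT_elim[OF c1 DEC_form[OF c1 Q1]])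
    show "inh (TEl Q # G) (NOT (DEC (sh Q)))" using inh_weak[OF c1 no] by simp
    have "inh (TEl (App (cst cT) (cst cN1u)) # TEl Q # G) (sh (sh Q))"
      by (rule inh_weak[OF ctx_el[OF c1 T_ty[OF c1 const_tys(7)[OF c1]]] inh_var_0[OF c1]])
    then show "inh (TEl Q # G) (DEC (sh Q))"
      using inh_T_N1u[OF c2] by (intro DEC[OF c1 Q1 const_tys(7)[OF c1]]) simp_all
  qed
  then have nQ: "inh G (NOT Q)" by (rule NOT_intro[OF c Q])
  have "inh G (DEC Q)"
  proof (rule DEC[OF c Q const_tys(6)[OF c]])
    note T1 = T_ty[OF c1 const_tys(6)[OF c1]]
    have "inh (TEl Q # G) (cst cN0)"
      using inh_weak[OF c1 nQ] inh_var_0[OF c1] by (intro NOT_elim[OF c1 Q1]) simp_all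
    from N0_elim[OF c1 T1 this] show "inh (TEl Q # G) (App (cst cT) (sh (cst cN0u)))" by simp
    have cT: "ctx (TEl (App (cst cT) (cst cN0u)) # G)"
      by (rule ctx_el[OF c T_ty[OF c const_tys(6)[OF c]]])
    show "inh (TEl (App (cst cT) (cst cN0u)) # G) (sh Q)"
      using inh_var_0[OF cT] by (intro N0_elim[OF cT set_weak[OF cT Q]] inh_T_N0u[OF cT]) simp
  qed
  then show ?thesis by (rule NOT_elim[OF c DEC_form[OF c Q] no])
qed

end

subsection \<open>Uniformity in type theory\<close>

locale ctt_gup = ctt Th for Th :: "('c ctx \<times> 'c jdg) set" +
  assumes GUP: "GUP_CTT \<subseteq> Th"
begin

lemma gup_tys:
  assumes "ctx G"
  shows "has G (Const Gup_elem) (TFun TSet (TFun (TFun TSet (TFun (TEl (Var (Suc 0))) TSet))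
      (TFun (TFun TSet (TEl (Var (Suc (Suc 0)))))
        (TFun (TFun TSet (TEl (app2 (Var (Suc (Suc 0))) (Var 0) (App (Var (Suc 0)) (Var 0)))))
          (TEl (Var (Suc (Suc (Suc 0)))))))))"
    and "has G (Const Gup_proof) (TFun TSet (TFun (TFun TSet (TFun (TEl (Var (Suc 0))) TSet))
      (TFun (TFun TSet (TEl (Var (Suc (Suc 0)))))
        (TFun (TFun TSet (TEl (app2 (Var (Suc (Suc 0))) (Var 0) (App (Var (Suc 0)) (Var 0)))))
          (TFun TSet (TEl (app2 (Var (Suc (Suc (Suc 0)))) (Var 0)
            (app2 (app2 (Const Gup_elem) (Var (Suc (Suc (Suc (Suc 0))))) (Var (Suc (Suc (Suc 0)))))
              (Var (Suc (Suc 0))) (Var (Suc 0))))))))))"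
  by (rule closed_ax[OF _ assms], rule subsetD[OF GUP], simp add: GUP_CTT_def term_simps, simp)+

lemma gup_apply:
  assumes c: "ctx G" and A: "has G A TSet" and R: "has G R (TFun TSet (TFun (TEl (sh A)) TSet))"
    and F: "has G F (TFun TSet (TEl (sh A)))"
    and r: "has G r (TFun TSet (TEl (app2 (sh R) (Var 0) (App (sh F) (Var 0)))))"
  defines "i \<equiv> app2 (app2 (Const Gup_elem) A R) F r"
  shows "has G i (TEl A)"
    and "has G (app2 (app2 (Const Gup_proof) A R) F r) (TFun TSet (TEl (app2 (sh R) (Var 0) (sh i))))"
proof -
  have "has G (App (Const Gup_elem) A) (TFun (TFun TSet (TFun (TEl (sh A)) TSet))
      (TFun (TFun TSet (TEl (sh (sh A))))
        (TFun (TFun TSet (TEl (app2 (Var (Suc (Suc 0))) (Var 0) (App (Var (Suc 0)) (Var 0)))))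
          (TEl (sh (sh (sh A)))))))"
    by (rule app_ty[OF gup_tys(1)[OF c] A]) (simp add: inst_ty_def)
  then have "has G (app2 (Const Gup_elem) A R) (TFun (TFun TSet (TEl (sh A)))
        (TFun (TFun TSet (TEl (app2 (sh (sh R)) (Var 0) (App (Var (Suc 0)) (Var 0)))))
          (TEl (sh (sh A)))))"
    by (rule app_ty[OF _ R]) (simp add: inst_ty_def)
  then have "has G (App (app2 (Const Gup_elem) A R) F)
        (TFun (TFun TSet (TEl (app2 (sh R) (Var 0) (App (sh F) (Var 0)))))
          (TEl (sh A)))"
    by (rule app_ty[OF _ F]) (simp add: inst_ty_def)
  then show "has G i (TEl A)"
    unfolding i_def by (rule app_ty[OF _ r]) (simp add: inst_ty_def)
  have "has G (App (Const Gup_proof) A) (TFun (TFun TSet (TFun (TEl (sh A)) TSet))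
      (TFun (TFun TSet (TEl (sh (sh A))))
        (TFun (TFun TSet (TEl (app2 (Var (Suc (Suc 0))) (Var 0) (App (Var (Suc 0)) (Var 0)))))
          (TFun TSet (TEl (app2 (Var (Suc (Suc (Suc 0)))) (Var 0)
            (app2 (app2 (Const Gup_elem) (sh (sh (sh (sh A)))) (Var (Suc (Suc (Suc 0)))))
              (Var (Suc (Suc 0))) (Var (Suc 0)))))))))"
    by (rule app_ty[OF gup_tys(2)[OF c] A]) (simp add: inst_ty_def)
  then have "has G (app2 (Const Gup_proof) A R) (TFun (TFun TSet (TEl (sh A)))
        (TFun (TFun TSet (TEl (app2 (sh (sh R)) (Var 0) (App (Var (Suc 0)) (Var 0)))))
          (TFun TSet (TEl (app2 (sh (sh (sh R))) (Var 0)
            (app2 (app2 (Const Gup_elem) (sh (sh (sh A))) (sh (sh (sh R))))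
              (Var (Suc (Suc 0))) (Var (Suc 0))))))))"
    by (rule app_ty[OF _ R]) (simp add: inst_ty_def)
  then have "has G (App (app2 (Const Gup_proof) A R) F)
        (TFun (TFun TSet (TEl (app2 (sh R) (Var 0) (App (sh F) (Var 0)))))
          (TFun TSet (TEl (app2 (sh (sh R)) (Var 0)
            (app2 (app2 (Const Gup_elem) (sh (sh A)) (sh (sh R))) (sh (sh F)) (Var (Suc 0)))))))"
    by (rule app_ty[OF _ F]) (simp add: inst_ty_def)
  then show "has G (app2 (app2 (Const Gup_proof) A R) F r) (TFun TSet (TEl (app2 (sh R) (Var 0) (sh i))))"
    unfolding i_def by (rule app_ty[OF _ r]) (simp add: inst_ty_def)
qed

lemma inst_ty_Var_0 [simp]: "inst_ty (Var 0) (ren_ty (up Suc) A) = (A :: 'c ty)"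
proof -
  have "case_nat (Var 0) Var \<circ> up Suc = (Var :: nat \<Rightarrow> 'c tm)"
    by (rule ext) (simp add: up_def split: nat.split)
  then show ?thesis by (simp add: inst_ty_def sub_ren_ty)
qed

lemma Lam_shift_app:
  assumes c: "ctx (TSet # G)" and b: "has (TSet # G) b B"
  shows "derives Th (TSet # G) (EqTm (App (sh (Lam b)) (Var 0)) b B)"
proof -
  have "has (TSet # TSet # G) (ren_tm (up Suc) b) (ren_ty (up Suc) B)"
    using weak1[of TSet TSet G "HasTy b B"] ctx_set[OF c] b by simp
  from derives.beta[OF this, of "Var 0"] set_var_0[OF c] show ?thesis by simp
qed

text \<open>The principle in open form: \<open>B\<close>, \<open>a\<close> and \<open>b\<close>
  contain a propositional variable, and abstracting them gives the relation, the function and the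
  proof that the constants take. In the conclusion the variable no longer occurs in the index, which
  is a shifted \<open>i\<close>.\<close>

lemma uniformity:
  assumes c: "ctx G" and A: "has G A TSet" and B: "has (TEl (sh A) # TSet # G) B TSet"
    and a: "has (TSet # G) a (TEl (sh A))" and b: "has (TSet # G) b (TEl (inst_tm a B))"
  obtains i t where "has G i (TEl A)" "has (TSet # G) t (TEl (inst_tm (sh i) B))"
proof -
  note c1 = ctx_set[OF c]
  note A1 = set_weak[OF c1 A]
  let ?R = "Lam (Lam B)" and ?F = "Lam a"
  have LB: "fam (TSet # G) (sh A) (Lam B)" by (rule fam_Lam[OF A1 B])
  have R: "has G ?R (TFun TSet (TFun (TEl (sh A)) TSet))"
    by (rule derives.lam[OF derives.set_form[OF c] LB])
  have F: "has G ?F (TFun TSet (TEl (sh A)))"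
    by (rule derives.lam[OF derives.set_form[OF c] a])
  \<comment> \<open>The constants mention the abstracted relation applied to its arguments. This
    conversion returns to \<open>B\<close>, first for \<open>a\<close> and then for the uniform
    index.\<close>
  have eq: "derives Th (TSet # G) (EqTy (TEl (app2 (sh ?R) (Var 0) x)) (TEl (inst_tm y B)))"
    if x: "derives Th (TSet # G) (EqTm x y (TEl (sh A)))" and y: "has (TSet # G) y (TEl (sh A))" for x y
  proof -
    have "derives Th (TSet # G) (EqTm (app2 (sh ?R) (Var 0) x) (App (Lam B) y) TSet)"
      using derives.app_cong[OF Lam_shift_app[OF c1 LB] x] by (simp add: inst_ty_def)
    from derives.ty_trans[OF derives.el_cong[OF this] beta_el[OF B y]] show ?thesis .
  qed
  have "has (TSet # G) b (TEl (app2 (sh ?R) (Var 0) (App (sh ?F) (Var 0))))"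
    by (rule derives.conv[OF b derives.ty_sym[OF eq[OF Lam_shift_app[OF c1 a] a]]])
  then have r: "has G (Lam b) (TFun TSet (TEl (app2 (sh ?R) (Var 0) (App (sh ?F) (Var 0)))))"
    by (rule derives.lam[OF derives.set_form[OF c]])
  note i = gup_apply[OF c A R F r]
  let ?i = "app2 (app2 (Const Gup_elem) A ?R) ?F (Lam b)"
  have si: "has (TSet # G) (sh ?i) (TEl (sh A))" using weak_tm[OF c1 i(1)] by simp
  have "has (TSet # G) (App (sh (app2 (app2 (Const Gup_proof) A ?R) ?F (Lam b))) (Var 0))
      (TEl (app2 (sh ?R) (Var 0) (sh ?i)))"
    by (rule app_ty[OF weak_tm[OF c1 i(2), unfolded ren_ty.simps(1,3)] set_var_0[OF c1] inst_ty_Var_0])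
  from derives.conv[OF this eq[OF derives.tm_refl[OF si] si]] i(1) that show thesis by blast
qed

lemma not_all_DEC:
  assumes c: "ctx G" and all: "inh (TSet # G) (DEC (Var 0))"
  shows "inh G (cst cN0)"
proof -
  note c1 = ctx_set[OF c]
  note body = DEC_body[OF c1 set_var_0[OF c1]]
  obtain u q where u: "has (TSet # G) u (TEl (cst cU))"
    and q: "has (TSet # G) q (TEl (inst_tm u (IFF (sh (Var 0)) (App (cst cT) (Var 0)))))"
    using SG_elim[OF c1 const_tys(4)[OF c1] body all[unfolded DEC_def]] by blast
  obtain i t where i: "has G i (TEl (cst cU))"
    and t: "has (TSet # G) t (TEl (inst_tm (sh i) (IFF (sh (Var 0)) (App (cst cT) (Var 0)))))"
    using uniformity[OF c const_tys(4)[OF c] _ _ q] body u by auto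
  note T = T_ty[OF c i]
  note nT = NOT_form[OF c T]
  \<comment> \<open>The diagonal instance: the uniform proof is abstracted over its proposition and
    applied to the negation of what \<open>i\<close> codes.\<close>
  have "has G (App (Lam t) (NOT (App (cst cT) i))) (TEl (IFF (NOT (App (cst cT) i)) (App (cst cT) i)))"
    by (rule app_ty[OF derives.lam[OF derives.set_form[OF c] t] nT]) (simp add: inst_ty_def inst_tm_def)
  then have iff: "inh G (IFF (NOT (App (cst cT) i)) (App (cst cT) i))" by (rule inhI)
  have cT: "ctx (TEl (App (cst cT) i) # G)" by (rule ctx_el[OF c T])
  have "inh (TEl (App (cst cT) i) # G) (cst cN0)"
  proof (rule NOT_elim[OF cT set_weak[OF cT T] _ inh_var_0[OF cT]])
    show "inh (TEl (App (cst cT) i) # G) (NOT (sh (App (cst cT) i)))"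
      using IFF_elim[OF cT set_weak[OF cT nT] set_weak[OF cT T]] inh_weak[OF cT iff] inh_var_0[OF cT] by simp
  qed
  then have "inh G (NOT (App (cst cT) i))" by (rule NOT_intro[OF c T])
  moreover from this have "inh G (App (cst cT) i)" using IFF_elim[OF c nT T iff] by simp
  ultimately show ?thesis by (rule NOT_elim[OF c T])
qed

end

section \<open>The order, the relation and its presentation in context\<close>

context ctt
begin

text \<open>A constant family is the subset whose membership condition ignores the element. With
  \<open>DEC\<close> it is \<open>U(x)\<close> of the overview, with \<open>cN0\<close> the empty
  subset.\<close>

lemma const_family:
  assumes "ctx G" "has G S TSet" "has G A TSet" "has G u (TEl S)"
  shows "inh G (App (Lam (sh A)) u) \<longleftrightarrow> inh G A"
proof -
  have "derives Th G (EqTy (TEl (App (Lam (sh A)) u)) (TEl A))"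
    using beta_el[OF set_weak[OF ctx_el[OF assms(1,2)] assms(3)] assms(4)] by simp
  from derives.conv[OF _ this] derives.conv[OF _ derives.ty_sym[OF this]]
  show ?thesis unfolding inh_def by blast
qed

lemma const_family_ty: "ctx G \<Longrightarrow> has G S TSet \<Longrightarrow> has G A TSet \<Longrightarrow> fam G S (Lam (sh A))"
  by (intro fam_Lam set_weak ctx_el)

lemma fam_weak: "ctx (A # G) \<Longrightarrow> fam G S F \<Longrightarrow> fam (A # G) (sh S) (sh F)"
  using weak_tm by fastforce

lemma el_weak: "ctx (A # G) \<Longrightarrow> has G a (TEl S) \<Longrightarrow> has (A # G) (sh a) (TEl (sh S))"
  using weak_tm by fastforce

lemma el_var_0: "ctx (TEl A # G) \<Longrightarrow> has (TEl A # G) (Var 0) (TEl (sh A))"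
  using var_0 by fastforce

text \<open>A bundle of typing judgements, kept together because \<open>order_weak\<close> moves
  them jointly into nested contexts.\<close>

definition order :: "'c ctx \<Rightarrow> 'c tm \<Rightarrow> 'c tm \<Rightarrow> bool" where
  "order G S l \<longleftrightarrow> ctx G \<and> has G S TSet \<and> has G l (TFun (TEl S) (TFun (TEl (sh S)) TSet))"

lemma order_D: "order G S l \<Longrightarrow> ctx G" "order G S l \<Longrightarrow> has G S TSet"
  unfolding order_def by auto

lemma order_weak: "ctx (A # G) \<Longrightarrow> order G S l \<Longrightarrow> order (A # G) (sh S) (sh l)"
  unfolding order_def using weak_tm[of A G l] set_weak by fastforce

lemma order_ctx: "order G S l \<Longrightarrow> ctx (TEl S # G)"
  unfolding order_def using ctx_el by blast

lemma le_ty: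
  assumes "order G S l" "has G x (TEl S)" "has G y (TEl S)"
  shows "has G (app2 l x y) TSet"
proof -
  have "has G (App l x) (TFun (TEl S) TSet)"
    using assms(1) unfolding order_def by (auto intro!: app_ty[OF _ assms(2)] simp: inst_ty_def)
  then show ?thesis by (rule app_ty[OF _ assms(3)]) (simp add: inst_ty_def)
qed

definition UPPER :: "'c tm \<Rightarrow> 'c tm \<Rightarrow> 'c tm \<Rightarrow> 'c tm \<Rightarrow> 'c tm" where
  "UPPER S l U y = PI S (IMP (App (sh U) (Var 0)) (app2 (sh l) (Var 0) (sh y)))"

lemma ren_UPPER [simp]: "ren_tm r (UPPER S l U y) = UPPER (ren_tm r S) (ren_tm r l) (ren_tm r U) (ren_tm r y)"
  by (simp add: UPPER_def)

lemma sub_UPPER [simp]: "sub_tm r (UPPER S l U y) = UPPER (sub_tm r S) (sub_tm r l) (sub_tm r U) (sub_tm r y)"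
  by (simp add: UPPER_def)

lemma RC_UPPER: "RC S l x U = PI S (IMP (UPPER (sh S) (sh l) (sh U) (Var 0)) (app2 (sh l) (sh x) (Var 0)))"
  by (simp add: RC_def UPPER_def)

lemma UPPER_body:
  assumes o: "order G S l" and U: "fam G S U" and y: "has G y (TEl S)"
  shows "has (TEl S # G) (App (sh U) (Var 0)) TSet" "has (TEl S # G) (app2 (sh l) (Var 0) (sh y)) TSet"
proof -
  note c = order_ctx[OF o]
  show "has (TEl S # G) (App (sh U) (Var 0)) TSet" by (rule fam_app[OF fam_weak[OF c U] el_var_0[OF c]])
  show "has (TEl S # G) (app2 (sh l) (Var 0) (sh y)) TSet"
    by (rule le_ty[OF order_weak[OF c o] el_var_0[OF c] el_weak[OF c y]])
qed

lemma UPPER_form: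
  assumes o: "order G S l" and U: "fam G S U" and y: "has G y (TEl S)"
  shows "has G (UPPER S l U y) TSet"
  unfolding UPPER_def
  by (rule PI_form[OF order_D[OF o] IMP_form[OF order_ctx[OF o] UPPER_body[OF assms]]])

lemma UPPER_elim:
  assumes o: "order G S l" and U: "fam G S U" and y: "has G y (TEl S)"
    and up: "inh G (UPPER S l U y)" and u: "has G u (TEl S)" "inh G (App U u)"
  shows "inh G (app2 l u y)"
proof -
  have "inh G (IMP (App U u) (app2 l u y))"
    using PI_elim[OF order_D[OF o] IMP_form[OF order_ctx[OF o] UPPER_body[OF o U y]] up[unfolded UPPER_def] u(1)]
    by (simp add: inst_tm_def)
  from IMP_elim[OF order_D(1)[OF o] fam_app[OF U u(1)] le_ty[OF o u(1) y] this u(2)] show ?thesis .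
qed

lemma RC_body:
  assumes o: "order G S l" and U: "fam G S U" and x: "has G x (TEl S)"
  shows "has (TEl S # G) (UPPER (sh S) (sh l) (sh U) (Var 0)) TSet"
    and "has (TEl S # G) (app2 (sh l) (sh x) (Var 0)) TSet"
proof -
  note c = order_ctx[OF o]
  show "has (TEl S # G) (UPPER (sh S) (sh l) (sh U) (Var 0)) TSet"
    by (rule UPPER_form[OF order_weak[OF c o] fam_weak[OF c U] el_var_0[OF c]])
  show "has (TEl S # G) (app2 (sh l) (sh x) (Var 0)) TSet"
    by (rule le_ty[OF order_weak[OF c o] el_weak[OF c x] el_var_0[OF c]])
qed

lemma RC_form:
  assumes o: "order G S l" and U: "fam G S U" and x: "has G x (TEl S)"
  shows "has G (RC S l x U) TSet"
  unfolding RC_UPPER by (rule PI_form[OF order_D[OF o] IMP_form[OF order_ctx[OF o] RC_body[OF assms]]])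

lemma RC_elim:
  assumes o: "order G S l" and U: "fam G S U" and x: "has G x (TEl S)" and "inh G (RC S l x U)"
    and y: "has G y (TEl S)" and "inh G (UPPER S l U y)"
  shows "inh G (app2 l x y)"
proof -
  have "inh G (IMP (UPPER S l U y) (app2 l x y))"
    using PI_elim[OF order_D[OF o] IMP_form[OF order_ctx[OF o] RC_body[OF o U x]] assms(4)[unfolded RC_UPPER] y]
    by (simp add: inst_tm_def)
  from IMP_elim[OF order_D(1)[OF o] UPPER_form[OF o U y] le_ty[OF o x y] this assms(6)] show ?thesis .
qed

lemma SUBS_body:
  assumes "ctx G" and S: "has G S TSet" and V: "fam G S V"
  shows "has (TEl S # G) (App (sh V) (Var 0)) TSet"
  by (rule fam_app[OF fam_weak[OF ctx_el[OF assms(1) S] V] el_var_0[OF ctx_el[OF assms(1) S]]])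

lemma SUBS_form:
  assumes "ctx G" and S: "has G S TSet" and V: "fam G S V" and U: "fam G S U"
  shows "has G (SUBS S V U) TSet"
  unfolding SUBS_def
  by (rule PI_form[OF assms(1) S IMP_form[OF ctx_el[OF assms(1) S] SUBS_body[OF assms(1) S V] SUBS_body[OF assms(1) S U]]])

lemma SUBS_elim:
  assumes "ctx G" and S: "has G S TSet" and V: "fam G S V" and U: "fam G S U"
    and "inh G (SUBS S V U)" and u: "has G u (TEl S)" "inh G (App V u)"
  shows "inh G (App U u)"
proof -
  have "inh G (IMP (App V u) (App U u))"
    using PI_elim[OF assms(1) S IMP_form[OF ctx_el[OF assms(1) S] SUBS_body[OF assms(1) S V] SUBS_body[OF assms(1) S U]]
        assms(5)[unfolded SUBS_def] u(1)]
    by (simp add: inst_tm_def)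
  from IMP_elim[OF assms(1) fam_app[OF V u(1)] fam_app[OF U u(1)] this u(2)] show ?thesis .
qed

definition STABLE :: "'c tm \<Rightarrow> 'c tm \<Rightarrow> 'c tm \<Rightarrow> 'c tm" where
  "STABLE S l a = PI S (IMP (NOT (NOT (app2 (sh l) (sh a) (Var 0)))) (app2 (sh l) (sh a) (Var 0)))"

lemma ren_STABLE [simp]: "ren_tm r (STABLE S l a) = STABLE (ren_tm r S) (ren_tm r l) (ren_tm r a)"
  by (simp add: STABLE_def)

text \<open>If \<open>a\<close> were not below \<open>y\<close>, then \<open>DEC Q\<close> would be
  refuted: it puts \<open>a\<close> into the constant subset, which \<open>y\<close> bounds. This
  contradicts \<open>not_not_DEC\<close>, and stability removes the double negation.\<close>

lemma stable_le:
  assumes o: "order G S l" and a: "has G a (TEl S)" and st: "inh G (STABLE S l a)"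
    and Q: "has G Q TSet" and y: "has G y (TEl S)" and up: "inh G (UPPER S l (Lam (sh (DEC Q))) y)"
  shows "inh G (app2 l a y)"
proof -
  let ?L = "app2 l a y" and ?U = "Lam (sh (DEC Q))"
  note c = order_D(1)[OF o]
  note L = le_ty[OF o a y]
  note D = DEC_form[OF c Q]
  note cS = order_ctx[OF o]
  have LS: "has (TEl S # G) (app2 (sh l) (sh a) (Var 0)) TSet"
    by (rule le_ty[OF order_weak[OF cS o] el_weak[OF cS a] el_var_0[OF cS]])
  have *: "inh G (IMP (NOT (NOT ?L)) ?L)"
    using PI_elim[OF c order_D(2)[OF o] IMP_form[OF cS NOT_form[OF cS NOT_form[OF cS LS]] LS] st[unfolded STABLE_def] y]
    by (simp add: inst_tm_def)
  note nL = NOT_form[OF c L]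
  have c1: "ctx (TEl (NOT ?L) # G)" by (rule ctx_el[OF c nL])
  note Q1 = set_weak[OF c1 Q]
  note D1 = DEC_form[OF c1 Q1]
  have c2: "ctx (TEl (DEC (sh Q)) # TEl (NOT ?L) # G)" by (rule ctx_el[OF c1 D1])
  have U: "fam G S ?U" by (rule const_family_ty[OF c order_D(2)[OF o] D])
  let ?G2 = "TEl (DEC (sh Q)) # TEl (NOT ?L) # G"
  have "inh ?G2 (cst cN0)"
  proof (rule NOT_elim[OF c2])
    show "has ?G2 (sh (sh ?L)) TSet" by (rule set_weak[OF c2 set_weak[OF c1 L]])
    show "inh ?G2 (NOT (sh (sh ?L)))" using inh_weak[OF c2 inh_var_0[OF c1]] by simp
    have o2: "order ?G2 (sh (sh S)) (sh (sh l))" by (rule order_weak[OF c2 order_weak[OF c1 o]])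
    have a2: "has ?G2 (sh (sh a)) (TEl (sh (sh S)))" by (rule el_weak[OF c2 el_weak[OF c1 a]])
    have y2: "has ?G2 (sh (sh y)) (TEl (sh (sh S)))" by (rule el_weak[OF c2 el_weak[OF c1 y]])
    have U2: "fam ?G2 (sh (sh S)) (sh (sh ?U))" by (rule fam_weak[OF c2 fam_weak[OF c1 U]])
    have up2: "inh ?G2 (UPPER (sh (sh S)) (sh (sh l)) (sh (sh ?U)) (sh (sh y)))"
      using inh_weak[OF c2 inh_weak[OF c1 up]] by (simp del: ren_tm.simps)
    have "inh ?G2 (App (Lam (sh (sh (sh (DEC Q))))) (sh (sh a)))"
      by (subst const_family[OF c2 order_D(2)[OF o2] _ a2])
        (use set_weak[OF c2 set_weak[OF c1 D]] inh_var_0[OF c2] in simp_all)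
    then have "inh ?G2 (App (sh (sh ?U)) (sh (sh a)))" by simp
    from UPPER_elim[OF o2 U2 y2 up2 a2 this] show "inh ?G2 (sh (sh ?L))" by simp
  qed
  then have "inh (TEl (NOT ?L) # G) (NOT (DEC (sh Q)))" by (rule NOT_intro[OF c1 D1])
  then have "inh (TEl (NOT ?L) # G) (cst cN0)" by (rule not_not_DEC[OF c1 Q1])
  then have "inh G (NOT (NOT ?L))" by (rule NOT_intro[OF c nL])
  from IMP_elim[OF c NOT_form[OF c nL] L * this] show ?thesis .
qed

lemma RC_DEC:
  assumes o: "order G S l" and a: "has G a (TEl S)" and st: "inh G (STABLE S l a)"
    and Q: "has G Q TSet"
  shows "inh G (RC S l a (Lam (sh (DEC Q))))"
proof -
  let ?U = "Lam (sh (DEC Q))"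
  note c = order_D(1)[OF o]
  note cS = order_ctx[OF o]
  have U: "fam G S ?U" by (rule const_family_ty[OF c order_D(2)[OF o] DEC_form[OF c Q]])
  note body = RC_body[OF o U a]
  let ?G2 = "TEl (UPPER (sh S) (sh l) (sh ?U) (Var 0)) # TEl S # G"
  have c2: "ctx ?G2" by (rule ctx_el[OF cS body(1)])
  have "inh ?G2 (app2 (sh (sh l)) (sh (sh a)) (sh (Var 0)))"
  proof (rule stable_le)
    show "order ?G2 (sh (sh S)) (sh (sh l))" by (rule order_weak[OF c2 order_weak[OF cS o]])
    show "has ?G2 (sh (sh a)) (TEl (sh (sh S)))" by (rule el_weak[OF c2 el_weak[OF cS a]])
    show "inh ?G2 (STABLE (sh (sh S)) (sh (sh l)) (sh (sh a)))"
      using inh_weak[OF c2 inh_weak[OF cS st]] by (simp del: ren_tm.simps)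
    show "has ?G2 (sh (sh Q)) TSet" by (rule set_weak[OF c2 set_weak[OF cS Q]])
    show "has ?G2 (sh (Var 0)) (TEl (sh (sh S)))" by (rule el_weak[OF c2 el_var_0[OF cS]])
    show "inh ?G2 (UPPER (sh (sh S)) (sh (sh l)) (Lam (sh (DEC (sh (sh Q))))) (sh (Var 0)))"
      using inh_var_0[OF c2] by simp
  qed
  then show ?thesis
    unfolding RC_UPPER by (intro PI_intro[OF c order_D(2)[OF o]] IMP_intro IMP_form cS body) simp
qed

text \<open>Not a choice principle: the typing of the index family \<open>I\<close> and of the
  subset family \<open>C\<close> in a presentation.\<close>

definition choice :: "'c ctx \<Rightarrow> 'c tm \<Rightarrow> 'c tm \<Rightarrow> 'c tm \<Rightarrow> bool" where
  "choice G S I C \<longleftrightarrow> fam G S I \<and>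
     has G C (TFun (TEl S) (TFun (TEl (App (sh I) (Var 0))) (TFun (TEl (sh (sh S))) TSet)))"

lemma choice_weak: "ctx (A # G) \<Longrightarrow> choice G S I C \<Longrightarrow> choice (A # G) (sh S) (sh I) (sh C)"
  unfolding choice_def using weak_tm[of A G C] fam_weak by fastforce

lemma choice_index: "choice G S I C \<Longrightarrow> has G x (TEl S) \<Longrightarrow> has G (App I x) TSet"
  unfolding choice_def using fam_app by blast

lemma choice_fam:
  assumes "choice G S I C" and x: "has G x (TEl S)" and i: "has G i (TEl (App I x))"
  shows "fam G S (app2 C x i)"
proof -
  have "has G (App C x) (TFun (TEl (App I x)) (TFun (TEl (sh S)) TSet))"
    using assms(1) unfolding choice_def by (auto intro!: app_ty[OF _ x] simp: inst_ty_def)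
  then show ?thesis by (rule app_ty[OF _ i]) (simp add: inst_ty_def)
qed

lemma cover_form:
  assumes c: "ctx G" and S: "has G S TSet" and ch: "choice G S I C" and a: "has G a (TEl S)" and U: "fam G S U"
  shows "has (TEl (App I a) # G) (SUBS (sh S) (app2 (sh C) (sh a) (Var 0)) (sh U)) TSet"
proof -
  have c1: "ctx (TEl (App I a) # G)" by (rule ctx_el[OF c choice_index[OF ch a]])
  have "has (TEl (App I a) # G) (Var 0) (TEl (App (sh I) (sh a)))" using el_var_0[OF c1] by simp
  then show ?thesis
    by (intro SUBS_form c1 set_weak S fam_weak U choice_fam[OF choice_weak[OF c1 ch] el_weak[OF c1 a]])
qed

definition presents :: "'c ctx \<Rightarrow> 'c tm \<Rightarrow> 'c tm \<Rightarrow> 'c tm \<Rightarrow> 'c tm \<Rightarrow> 'c tm \<Rightarrow> bool" where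
  "presents G S l I C t \<longleftrightarrow> has G t (TFun (TEl S) (TFun (TFun (TEl (sh S)) TSet)
      (TEl (IFF (RC (sh (sh S)) (sh (sh l)) (Var (Suc 0)) (Var 0))
        (SG (App (sh (sh I)) (Var (Suc 0)))
          (SUBS (sh (sh (sh S))) (app2 (sh (sh (sh C))) (Var (Suc (Suc 0))) (Var 0)) (Var (Suc 0))))))))"

lemma presents_weak: "ctx (A # G) \<Longrightarrow> presents G S l I C t \<Longrightarrow> presents (A # G) (sh S) (sh l) (sh I) (sh C) (sh t)"
  unfolding presents_def using weak_tm[of A G t] by fastforce

text \<open>The proof term \<open>t\<close> is universal in the element and in the subset, so it may
  be applied in any context, including one that contains a propositional variable.\<close>

lemma presents_iff:
  assumes o: "order G S l" and ch: "choice G S I C" and p: "presents G S l I C t"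
    and a: "has G a (TEl S)" and U: "fam G S U"
  shows "inh G (RC S l a U) \<longleftrightarrow> inh G (SG (App I a) (SUBS (sh S) (app2 (sh C) (sh a) (Var 0)) (sh U)))"
proof -
  have "has G (App t a) (TFun (TFun (TEl S) TSet)
      (TEl (IFF (RC (sh S) (sh l) (sh a) (Var 0))
        (SG (App (sh I) (sh a)) (SUBS (sh (sh S)) (app2 (sh (sh C)) (sh (sh a)) (Var 0)) (Var (Suc 0)))))))"
    by (rule app_ty[OF p[unfolded presents_def] a]) (simp add: inst_ty_def)
  then have "has G (app2 t a U) (TEl (IFF (RC S l a U) (SG (App I a) (SUBS (sh S) (app2 (sh C) (sh a) (Var 0)) (sh U)))))"
    by (rule app_ty[OF _ U]) (simp add: inst_ty_def)
  then show ?thesis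
    by (intro IFF_elim[OF order_D(1)[OF o] RC_form[OF o U a]] inhI
        SG_form[OF order_D(1)[OF o] choice_index[OF ch a] cover_form[OF order_D[OF o] ch a U]])
qed

end

context ctt_gup
begin

text \<open>For a variable proposition the relation holds by \<open>RC_DEC\<close>, so the
  presentation yields an index \<open>j\<close> depending on the proposition;
  \<open>uniformity\<close> exchanges it for an \<open>i\<close> that does not.\<close>

lemma uniform_cover:
  assumes o: "order G S l" and a: "has G a (TEl S)" and st: "inh G (STABLE S l a)"
    and ch: "choice G S I C" and p: "presents G S l I C t"
  obtains i where "has G i (TEl (App I a))"
    "inh (TSet # G) (SUBS (sh S) (app2 (sh C) (sh a) (sh i)) (Lam (sh (DEC (Var 0)))))"
proof -
  let ?U = "Lam (sh (DEC (Var 0)))"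
  note c = order_D(1)[OF o]
  note c1 = ctx_set[OF c]
  note o1 = order_weak[OF c1 o]
  note a1 = el_weak[OF c1 a]
  note ch1 = choice_weak[OF c1 ch]
  note Q = set_var_0[OF c1]
  have U: "fam (TSet # G) (sh S) ?U"
    by (rule const_family_ty[OF order_D[OF o1] DEC_form[OF c1 Q]])
  have "inh (TSet # G) (STABLE (sh S) (sh l) (sh a))" using inh_weak[OF c1 st] by simp
  from RC_DEC[OF o1 a1 this Q]
  have SG: "inh (TSet # G) (SG (App (sh I) (sh a)) (SUBS (sh (sh S)) (app2 (sh (sh C)) (sh (sh a)) (Var 0)) (sh ?U)))"
    using presents_iff[OF o1 ch1 presents_weak[OF c1 p] a1 U] by blast
  note B = cover_form[OF order_D[OF o1] ch1 a1 U]
  obtain j b where j: "has (TSet # G) j (TEl (App (sh I) (sh a)))"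
    and b: "has (TSet # G) b (TEl (inst_tm j (SUBS (sh (sh S)) (app2 (sh (sh C)) (sh (sh a)) (Var 0)) (sh ?U))))"
    using SG_elim[OF c1 choice_index[OF ch1 a1] B SG] by blast
  have j': "has (TSet # G) j (TEl (sh (App I a)))" using j by simp
  \<comment> \<open>Written as a shift, the index set is visibly independent of the propositional
    variable, as \<open>uniformity\<close> requires.\<close>
  have B': "has (TEl (sh (App I a)) # TSet # G) (SUBS (sh (sh S)) (app2 (sh (sh C)) (sh (sh a)) (Var 0)) (sh ?U)) TSet"
    using B by simp
  obtain i t where "has G i (TEl (App I a))"
    and t: "has (TSet # G) t (TEl (inst_tm (sh i) (SUBS (sh (sh S)) (app2 (sh (sh C)) (sh (sh a)) (Var 0)) (sh ?U))))"
    by (rule uniformity[OF c choice_index[OF ch a] B' j' b])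
  from that[OF this(1)] inhI[OF t] show thesis by (simp add: inst_tm_def)
qed

lemma set_presented_contradiction:
  assumes o: "order G S l" and a: "has G a (TEl S)" and st: "inh G (STABLE S l a)"
    and least: "inh G (NOT (PI S (app2 (sh l) (sh a) (Var 0))))"
    and ch: "choice G S I C" and p: "presents G S l I C t"
  shows "inh G (cst cN0)"
proof -
  let ?E = "Lam (sh (cst cN0))" and ?U = "Lam (sh (DEC (Var 0)))"
  note c = order_D(1)[OF o]
  note S = order_D(2)[OF o]
  note cS = order_ctx[OF o]
  obtain i where i: "has G i (TEl (App I a))"
    and sub: "inh (TSet # G) (SUBS (sh S) (app2 (sh C) (sh a) (sh i)) ?U)"
    by (rule uniform_cover[OF o a st ch p])
  let ?V = "app2 C a i"
  have V: "fam G S ?V" by (rule choice_fam[OF ch a i])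
  have E: "fam G S ?E" by (rule const_family_ty[OF c S const_tys(1)[OF c]])
  have VS: "has (TEl S # G) (App (sh ?V) (Var 0)) TSet" by (rule SUBS_body[OF c S V])
  let ?G2 = "TEl (App (sh ?V) (Var 0)) # TEl S # G"
  have c2: "ctx ?G2" by (rule ctx_el[OF cS VS])
  have u2: "has ?G2 (sh (Var 0)) (TEl (sh (sh S)))" by (rule el_weak[OF c2 el_var_0[OF cS]])
  let ?G3 = "TSet # ?G2"
  have c3: "ctx ?G3" by (rule ctx_set[OF c2])
  have "inh ?G2 (cst cN0)"
  proof (rule not_all_DEC[OF c2])
    obtain t where "has (TSet # G) t (TEl (SUBS (sh S) (app2 (sh C) (sh a) (sh i)) ?U))"
      using sub unfolding inh_def by blast
    \<comment> \<open>An element of \<open>S\<close> and its membership in \<open>?V\<close> are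
      inserted beneath the propositional variable by \<open>weak1\<close>, so that
      \<open>DEC (Var 0)\<close> keeps referring to it. Then \<open>not_all_DEC\<close> applies in
      \<open>?G2\<close>.\<close>
    then have "has (TSet # TEl S # G) (ren_tm (up Suc) t) (TEl (SUBS (sh (sh S)) (app2 (sh (sh C)) (sh (sh a)) (sh (sh i))) ?U))"
      using weak1[of TSet "TEl S" G "HasTy t A" for A] ctx_set[OF cS] by fastforce
    then have "has ?G3 (ren_tm (up Suc) (ren_tm (up Suc) t))
        (TEl (SUBS (sh (sh (sh S))) (app2 (sh (sh (sh C))) (sh (sh (sh a))) (sh (sh (sh i)))) ?U))"
      using weak1[of TSet "TEl (App (sh ?V) (Var 0))" "TEl S # G" "HasTy t A" for t A] c3 by fastforce
    then have sub3: "inh ?G3 (SUBS (sh (sh (sh S))) (sh (sh (sh ?V))) ?U)" by (intro inhI) simp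
    have V3: "fam ?G3 (sh (sh (sh S))) (sh (sh (sh ?V)))"
      by (rule fam_weak[OF c3 fam_weak[OF c2 fam_weak[OF cS V]]])
    have S3: "has ?G3 (sh (sh (sh S))) TSet"
      by (rule set_weak[OF c3 set_weak[OF c2 set_weak[OF cS S]]])
    note D3 = DEC_form[OF c3 set_var_0[OF c3]]
    have U3: "fam ?G3 (sh (sh (sh S))) ?U" by (rule const_family_ty[OF c3 S3 D3])
    have u3: "has ?G3 (sh (sh (Var 0))) (TEl (sh (sh (sh S))))" by (rule el_weak[OF c3 u2])
    have "inh ?G3 (App (sh (sh (sh ?V))) (sh (sh (Var 0))))"
      using inh_weak[OF c3 inh_var_0[OF c2]] by simp
    from SUBS_elim[OF c3 S3 V3 U3 sub3 u3 this] show "inh ?G3 (DEC (Var 0))"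
      using const_family[OF c3 S3 D3 u3] by simp
  qed
  then have "inh ?G2 (App (Lam (sh (cst cN0))) (sh (Var 0)))"
    by (subst const_family[OF c2 set_weak[OF c2 set_weak[OF cS S]] const_tys(1)[OF c2] u2])
  then have "inh G (SUBS S ?V ?E)"
    unfolding SUBS_def
    by (intro PI_intro[OF c S] IMP_intro IMP_form cS VS SUBS_body[OF c S E]) simp
  \<comment> \<open>The uniform index is itself the witness that the empty subset is
    covered.\<close>
  then have "inh G (inst_tm i (SUBS (sh S) (app2 (sh C) (sh a) (Var 0)) (sh ?E)))"
    by (simp add: inst_tm_def)
  from SG_intro[OF c choice_index[OF ch a] cover_form[OF c S ch a E] i this]
  have RC: "inh G (RC S l a ?E)" using presents_iff[OF o ch p a E] by blast
  note oS = order_weak[OF cS o]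
  note aS = el_weak[OF cS a]
  note yS = el_var_0[OF cS]
  have ES: "fam (TEl S # G) (sh S) ?E"
    by (rule const_family_ty[OF order_D[OF oS] const_tys(1)[OF cS]])
  note body = UPPER_body[OF oS ES yS]
  note cSS = order_ctx[OF oS]
  let ?G4 = "TEl (App (sh ?E) (Var 0)) # TEl (sh S) # TEl S # G"
  have c4: "ctx ?G4" by (rule ctx_el[OF cSS body(1)])
  have u4: "has ?G4 (sh (Var 0)) (TEl (sh (sh (sh S))))" by (rule el_weak[OF c4 el_var_0[OF cSS]])
  have "inh ?G4 (App (Lam (sh (cst cN0))) (sh (Var 0)))" using inh_var_0[OF c4] by simp
  then have "inh ?G4 (cst cN0)"
    by (subst (asm) const_family[OF c4 set_weak[OF c4 set_weak[OF cSS order_D(2)[OF oS]]] const_tys(1)[OF c4] u4])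
  \<comment> \<open>The empty subset is bounded vacuously by every \<open>y\<close>, so the relation
    places \<open>a\<close> below every \<open>y\<close>.\<close>
  from N0_elim[OF c4 set_weak[OF c4 body(2)] this]
  have "inh (TEl S # G) (UPPER (sh S) (sh l) ?E (Var 0))"
    unfolding UPPER_def by (intro PI_intro[OF order_D[OF oS]] IMP_intro IMP_form cSS body)
  moreover have "inh (TEl S # G) (RC (sh S) (sh l) (sh a) ?E)" using inh_weak[OF cS RC] by simp
  ultimately have "inh (TEl S # G) (app2 (sh l) (sh a) (Var 0))"
    by (intro RC_elim[OF oS ES aS _ yS])
  note L = le_ty[OF oS aS yS]
  have "inh G (PI S (app2 (sh l) (sh a) (Var 0)))"
    by (rule PI_intro[OF c S L]) fact
  then show ?thesis by (rule NOT_elim[OF c PI_form[OF c S L] least])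
qed

end

section \<open>From named notation to de Bruijn terms, and the final theorems\<close>

lemma weaken_0 [simp]: "weaken s 0 = s"
proof -
  have "(\<lambda>n. n + 0) = (\<lambda>n::nat. n)" by simp
  then show ?thesis unfolding weaken_def using sub_Var_Suc_tm[of "\<lambda>n. n" s] by simp
qed

lemma weaken_Suc [simp]: "weaken s (Suc d) = sh (weaken s d)"
  by (simp add: weaken_def ren_ren_tm comp_def)

lemma connectives_at:
  "p_all A P d = PI (A d) (P (\<lambda>d'. Var (d' - Suc d)) (Suc d))"
  "p_ex A P d = SG (A d) (P (\<lambda>d'. Var (d' - Suc d)) (Suc d))"
  by (simp_all add: p_all_def p_ex_def PI_def SG_def K_def t_app_def t_lam_def)

lemma least_stable_at:
  "p_ex (weaken s) (\<lambda>a. p_not (ctt_is_least (weaken s) (weaken l) a) \<otimes> ctt_is_stable (weaken s) (weaken l) a) 0 =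
   SG s (AND (NOT (PI (sh s) (app2 (sh (sh l)) (Var (Suc 0)) (Var 0))))
     (PI (sh s) (IMP (NOT (NOT (app2 (sh (sh l)) (Var (Suc 0)) (Var 0)))) (app2 (sh (sh l)) (Var (Suc 0)) (Var 0)))))"
  by (simp add: connectives_at p_imp_def p_and_def p_not_def IMP_def AND_def NOT_def
      ctt_is_least_def ctt_is_stable_def t_app_def K_def eval_nat_numeral)

lemma presentation_at:
  "(EL (weaken s) \<Rrightarrow> (\<lambda>x. (EL (weaken s) \<rightarrow> SET) \<Rrightarrow> (\<lambda>U.
     EL (p_iff (ctt_R\<^sub>c (weaken s) (weaken l) x U)
       (p_ex (weaken I \<cdot> x) (\<lambda>i. ctt_subset (weaken s) (weaken C \<cdot> x \<cdot> i) U)))))) 0 =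
   TFun (TEl s) (TFun (TFun (TEl (sh s)) TSet)
      (TEl (IFF (RC (sh (sh s)) (sh (sh l)) (Var (Suc 0)) (Var 0))
        (SG (App (sh (sh I)) (Var (Suc 0)))
          (SUBS (sh (sh (sh s))) (app2 (sh (sh (sh C))) (Var (Suc (Suc 0))) (Var 0)) (Var (Suc 0)))))))"
  by (simp add: connectives_at p_imp_def p_and_def p_iff_def IMP_def AND_def IFF_def RC_def SUBS_def
      ctt_R\<^sub>c_def ctt_subset_def t_dfun_def EL_def SET_def t_app_def eval_nat_numeral)

text \<open>The hypotheses are derivations over \<open>Th\<close>, whereas the contradiction arises
  over \<open>Th \<union> GUP_CTT\<close>, the theory assumed consistent.\<close>

lemma derives_mono: "derives Th G j \<Longrightarrow> Th \<subseteq> Th' \<Longrightarrow> derives Th' G j"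
proof (induction rule: derives.induct)
  case (ax G j)
  then show ?case by (intro derives.ax) auto
next
  case (subst D j G s)
  then show ?case by (intro derives.subst)
next
  case (conv G a A B)
  then show ?case by (intro derives.conv[of _ _ a A B])
next
  case (conv_eq G a b A B)
  then show ?case by (intro derives.conv_eq[of _ _ a b A B])
next
  case (ty_trans G A B C)
  then show ?case by (intro derives.ty_trans[of _ _ A B C])
next
  case (tm_trans G a b A c)
  then show ?case by (intro derives.tm_trans[of _ _ a b A c])
next
  case (ty_sym G A B)
  then show ?case by (simp add: derives.ty_sym)
next
  case (tm_sym G a b A)
  then show ?case by (simp add: derives.tm_sym)
next
  case (app G f A B a)
  then show ?case by (intro derives.app[of _ _ f A B a])
next
  case (app_cong G f f' A B a a')
  then show ?case by (intro derives.app_cong[of _ _ f f' A B a a'])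
next
  case (beta A G b B a)
  then show ?case by (intro derives.beta[of _ A G b B a])
qed (blast intro: derives.ctx_empty derives.ctx_ext derives.var derives.set_form derives.el_form
    derives.el_cong derives.fun_form derives.fun_cong derives.ty_refl derives.tm_refl derives.lam
    derives.lam_cong derives.eta)+

theorem CTT_not_set_presented:
  assumes Th: "CTT \<subseteq> Th" "ctt_consistent (Th \<union> GUP_CTT)"
    and s: "derives Th [] (HasTy s TSet)"
    and l: "derives Th [] (HasTy l ((EL (weaken s) \<rightarrow> EL (weaken s) \<rightarrow> SET) 0))"
    and ex_a: "ctt_true Th (p_ex (weaken s) (\<lambda>a. p_not (ctt_is_least (weaken s) (weaken l) a) \<otimes>
      ctt_is_stable (weaken s) (weaken l) a))"
  shows "\<not> ctt_set_presented Th (weaken s) (ctt_R\<^sub>c (weaken s) (weaken l))"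
proof
  assume pres: "ctt_set_presented Th (weaken s) (ctt_R\<^sub>c (weaken s) (weaken l))"
  interpret ctt_gup "Th \<union> GUP_CTT"
    using Th(1) by unfold_locales auto
  have up: "derives (Th \<union> GUP_CTT) G j" if "derives Th G j" for G j
    using derives_mono[OF that] by simp
  note c = derives.ctx_empty[of "Th \<union> GUP_CTT"]
  have o: "order [] s l"
    unfolding order_def using c up[OF s] up[OF l] by (simp add: t_dfun_def EL_def SET_def)
  note oS = order_weak[OF order_ctx[OF o] o]
  note cS = order_ctx[OF o]
  note cSS = order_ctx[OF oS]
  have L: "has (TEl (sh s) # TEl s # []) (app2 (sh (sh l)) (Var (Suc 0)) (Var 0)) TSet"
    using le_ty[OF order_weak[OF cSS oS] el_weak[OF cSS el_var_0[OF cS]] el_var_0[OF cSS]] by simp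
  note PL = PI_form[OF order_D[OF oS] L]
  note PS = PI_form[OF order_D[OF oS] IMP_form[OF cSS NOT_form[OF cSS NOT_form[OF cSS L]] L]]
  have "inh [] (SG s (AND (NOT (PI (sh s) (app2 (sh (sh l)) (Var (Suc 0)) (Var 0))))
     (PI (sh s) (IMP (NOT (NOT (app2 (sh (sh l)) (Var (Suc 0)) (Var 0)))) (app2 (sh (sh l)) (Var (Suc 0)) (Var 0))))))"
    using ex_a up unfolding ctt_true_def inh_def least_stable_at by blast
  \<comment> \<open>The existential proof projects to a closed term \<open>a\<close>, so the
    argument can start in the empty context.\<close>
  then obtain a p where a: "has [] a (TEl s)"
    and p: "has [] p (TEl (AND (NOT (PI s (app2 (sh l) (sh a) (Var 0)))) (STABLE s l a)))"
    by (rule SG_elim[OF order_D[OF o] AND_form[OF cS NOT_form[OF cS PL] PS]])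
      (simp add: inst_tm_def STABLE_def)
  have La: "has (TEl s # []) (app2 (sh l) (sh a) (Var 0)) TSet"
    by (rule le_ty[OF oS el_weak[OF cS a] el_var_0[OF cS]])
  have stable_ty: "has [] (STABLE s l a) TSet"
    unfolding STABLE_def by (intro PI_form[OF order_D[OF o]] IMP_form NOT_form cS La)
  note least_stable = AND_elim[OF c NOT_form[OF c PI_form[OF order_D[OF o] La]] stable_ty inhI[OF p]]
  obtain I C t where I: "has [] I ((EL (weaken s) \<rightarrow> SET) 0)"
    and C: "has [] C ((EL (weaken s) \<Rrightarrow> (\<lambda>x. EL (weaken I \<cdot> x) \<rightarrow> EL (weaken s) \<rightarrow> SET)) 0)"
    and t: "presents [] s l I C t"
    using pres up unfolding ctt_set_presented_def presentation_at presents_def by blast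
  have "choice [] s I C"
    unfolding choice_def using I C by (simp add: t_dfun_def EL_def SET_def t_app_def eval_nat_numeral)
  from set_presented_contradiction[OF o a least_stable(2,1) this t]
  show False using Th(2) unfolding ctt_consistent_def ctt_true_def inh_def by (simp add: K_def)
qed

theorem proposition5p2:
  "(\<forall>Th :: fm set.
      CZF \<subseteq> Th \<and> (\<forall>p\<in>Th. sentence p) \<and> \<not> (Th \<union> GUP_CZF \<turnstile> Fls) \<longrightarrow>
      (\<forall>\<sigma> \<phi>. fv \<sigma> \<subseteq> {0} \<and> fv \<phi> \<subseteq> {0, 1} \<longrightarrow>
        (let le = (\<lambda>x y. at_vars \<phi> [x, y]) in
          (Th \<turnstile> (\<^bold>\<exists>!S. at_vars \<sigma> [S]) 0) \<and>
          (Th \<turnstile> (\<^bold>\<forall>S. at_vars \<sigma> [S] \<^bold>\<longrightarrow> partial_order S le) 0) \<and>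
          (Th \<turnstile> (\<^bold>\<forall>S. at_vars \<sigma> [S] \<^bold>\<longrightarrow>
                   (\<^bold>\<exists>a. a \<^bold>\<in> S \<^bold>\<and> \<^bold>\<not> is_least S le a \<^bold>\<and> is_stable S le a)) 0) \<longrightarrow>
          \<not> (Th \<turnstile> (\<^bold>\<forall>S. at_vars \<sigma> [S] \<^bold>\<longrightarrow> set_presented S (R\<^sub>c S le)) 0)))) \<and>
   (\<forall>Th :: ('c ctx \<times> 'c jdg) set.
      CTT \<subseteq> Th \<and> ctt_consistent (Th \<union> GUP_CTT) \<longrightarrow>
      (\<forall>s l. let S = weaken s; le = weaken l in
        derives Th [] (HasTy s TSet) \<and>
        derives Th [] (HasTy l ((EL S \<rightarrow> EL S \<rightarrow> SET) 0)) \<and>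
        ctt_true Th (ctt_partial_order S le) \<and>
        ctt_true Th (p_ex S (\<lambda>a. p_not (ctt_is_least S le a) \<otimes> ctt_is_stable S le a)) \<longrightarrow>
        \<not> ctt_set_presented Th S (ctt_R\<^sub>c S le)))"
  unfolding Let_def
proof (intro conjI allI impI; elim conjE)
qed (rule CZF_not_set_presented CTT_not_set_presented; assumption)+

end
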